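(* Let $\varepsilon\in(0,1)$ be any constant. There exists a constant $\beta_0>0$ such that any $\varepsilon$-identity testing algorithm for $\mathcal{M}^-_{\textsc{Ising}}(n,n,\beta_0,0)$ with $\mathrm{poly}(n)$ sample complexity and running time yields (using it as a subroutine) a $\mathrm{poly}(N)$-time algorithm for the decision $r$-approximate counting problem for $\hat{\mathcal{M}}^-_{\textsc{Ising}}(N,3,-0.6,0)$, where $N=\Theta(\sqrt n)$ and $r=\mathrm{poly}(N)$.
   Context: An Ising model $(G,\beta_G,h_G)$ on $G=(V,E)$ with spins $\{1,2\}$ has Gibbs distribution $\mu(\sigma)\propto w(\sigma)=\exp\big(\sum_{\{u,v\}\in E}\beta_G(\{u,v\})\mathbb{1}(\sigma(u)=\sigma(v))+\sum_vh_G(v,\sigma(v))\big)$ and partition function $Z=\sum_\sigma w(\sigma)$; it is antiferromagnetic if $\beta_G(e)<0$ for all edges. $\mathcal{M}^-_{\textsc{Ising}}(n,d,\beta,h)$ is the family of antiferromagnetic Ising models on $n$-vertex graphs of maximum degree at most $d$ with $|\beta_G(e)|\le\beta$ and $|h_G(v,i)|\le h$. $\hat{\mathcal{M}}^-_{\textsc{Ising}}(N,3,-0.6,0)$ is the family of antiferromagnetic Ising models on $N$-vertex graphs of maximum degree at most 3 with every edge weight exactly $-0.6$ and no external field. The $\varepsilon$-identity testing problem for a family $\mathcal{M}$: given explicit $M\in\mathcal{M}$ and sample access to $\mu_{M^*}$, $M^*\in\mathcal{M}$ unknown, distinguish with probability at least $3/4$ between $\mu_M=\mu_{M^*}$ and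 $\|\mu_M-\mu_{M^*}\|_{\mathrm{TV}}\ge1-\varepsilon$. Decision $r$-approximate counting: given a model with partition function $Z$, $r>1$ and $\hat Z$, distinguish with probability at least $5/8$ between $Z\le\hat Z/r$ and $Z\ge r\hat Z$. *)

theory Defs
  imports "HOL-Probability.Probability" "HOL-Computational_Algebra.Polynomial"
    "HOL-Library.Landau_Symbols" "HOL-Library.Log_Nat"
begin

section \<open>Ising models\<close>

text \<open>The vertex set of an \<open>n\<close>-vertex graph is \<open>{..<n}\<close>. An edge is a two-element set of
  vertices; the values of \<open>coupling\<close> off the edge set, and of \<open>ext_field\<close> off the vertices and spins,
  are irrelevant.\<close>

record ising =
  nverts :: nat
  edges :: "nat set set"
  coupling :: "nat set \<Rightarrow> real"
  ext_field :: "nat \<Rightarrow> nat \<Rightarrow> real"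

definition simple_graph :: "ising \<Rightarrow> bool" where
  "simple_graph M \<longleftrightarrow> edges M \<subseteq> {{u, v} | u v. u < nverts M \<and> v < nverts M \<and> u \<noteq> v}"

definition max_degree_le :: "ising \<Rightarrow> nat \<Rightarrow> bool" where
  "max_degree_le M d \<longleftrightarrow> (\<forall>v<nverts M. card {e \<in> edges M. v \<in> e} \<le> d)"

definition configs :: "nat \<Rightarrow> (nat \<Rightarrow> nat) set" where
  "configs n = {..<n} \<rightarrow>\<^sub>E {1, 2}"

definition weight :: "ising \<Rightarrow> (nat \<Rightarrow> nat) \<Rightarrow> real" where
  "weight M \<sigma> = exp ((\<Sum>e\<in>edges M. coupling M e * of_bool (\<forall>u\<in>e. \<forall>v\<in>e. \<sigma> u = \<sigma> v))
                      + (\<Sum>v<nverts M. ext_field M v (\<sigma> v)))"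

definition partition_function :: "ising \<Rightarrow> real" where
  "partition_function M = (\<Sum>\<sigma>\<in>configs (nverts M). weight M \<sigma>)"

definition gibbs :: "ising \<Rightarrow> (nat \<Rightarrow> nat) pmf" where
  "gibbs M = embed_pmf (\<lambda>\<sigma>. if \<sigma> \<in> configs (nverts M) then weight M \<sigma> / partition_function M else 0)"

definition antiferromagnetic :: "ising \<Rightarrow> bool" where
  "antiferromagnetic M \<longleftrightarrow> (\<forall>e\<in>edges M. coupling M e < 0)"

definition ising_minus :: "nat \<Rightarrow> nat \<Rightarrow> real \<Rightarrow> real \<Rightarrow> ising set" where
  "ising_minus n d \<beta> h = {M. simple_graph M \<and> nverts M = n \<and> max_degree_le M d \<and> antiferromagnetic M \<and>
     (\<forall>e\<in>edges M. \<bar>coupling M e\<bar> \<le> \<beta>) \<and> (\<forall>v<n. \<forall>i\<in>{1, 2}. \<bar>ext_field M v i\<bar> \<le> h)}"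

definition ising_minus_hat :: "nat \<Rightarrow> nat \<Rightarrow> real \<Rightarrow> ising set" where
  "ising_minus_hat n d b = {M. simple_graph M \<and> nverts M = n \<and> max_degree_le M d \<and> antiferromagnetic M \<and>
     (\<forall>e\<in>edges M. coupling M e = b) \<and> (\<forall>v<n. \<forall>i\<in>{1, 2}. ext_field M v i = 0)}"

definition tv_dist :: "'a pmf \<Rightarrow> 'a pmf \<Rightarrow> real" where
  "tv_dist p q = (SUP A. \<bar>measure_pmf.prob p A - measure_pmf.prob q A\<bar>)"

lemma finite_configs: "finite (configs n)"
  by (simp add: configs_def finite_PiE)

lemma partition_function_pos: "partition_function M > 0"
proof -
  have "configs (nverts M) \<noteq> {}"
    by (simp add: configs_def PiE_eq_empty_iff)
  then show ?thesis
    unfolding partition_function_def by (intro sum_pos) (auto simp: finite_configs weight_def)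
qed

lemma pmf_gibbs:
  "pmf (gibbs M) \<sigma> = (if \<sigma> \<in> configs (nverts M) then weight M \<sigma> / partition_function M else 0)"
  unfolding gibbs_def
proof (rule pmf_embed_pmf)
  let ?C = "configs (nverts M)" and ?Z = "partition_function M"
  let ?f = "\<lambda>\<sigma>. if \<sigma> \<in> ?C then weight M \<sigma> / ?Z else 0"
  have nn: "weight M \<sigma> / ?Z \<ge> 0" for \<sigma>
    using partition_function_pos[of M] by (simp add: weight_def)
  then show "0 \<le> ?f x" for x by simp
  have "(\<integral>\<^sup>+x. ennreal (?f x) \<partial>count_space UNIV) = (\<integral>\<^sup>+x. ennreal (?f x) \<partial>count_space ?C)"
    by (rule nn_integral_count_space_eq) auto
  also have "\<dots> = (\<Sum>x\<in>?C. ennreal (?f x))"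
    by (simp add: nn_integral_count_space_finite finite_configs)
  also have "\<dots> = ennreal (\<Sum>x\<in>?C. weight M x / ?Z)"
    using nn by (subst sum_ennreal[symmetric]) auto
  also have "(\<Sum>x\<in>?C. weight M x / ?Z) = 1"
    using partition_function_pos[of M]
    by (simp add: sum_divide_distrib[symmetric] partition_function_def)
  finally show "(\<integral>\<^sup>+x. ennreal (?f x) \<partial>count_space UNIV) = 1" by simp
qed

lemma set_pmf_gibbs: "set_pmf (gibbs M) = configs (nverts M)"
  using partition_function_pos[of M] by (auto simp: set_pmf_iff pmf_gibbs weight_def split: if_splits)


section \<open>Randomized algorithms\<close>

text \<open>Algorithms are while programs over binary trees with natural numbers at the leaves. Every
  operation costs one unit of time, except that arithmetic additionally pays for the bit lengths of
  its operands (logarithmic cost); trees are thought of as pointer structures, so copying a value or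
  forming a cell costs one unit. Up to a polynomial this agrees with Turing machine time: in
  time \<open>t\<close> only \<open>t\<close> new cells and only numbers of \<open>O(t)\<close> bits in total can be produced.\<close>

datatype val = Atom nat | Cell val val

primrec vsize :: "val \<Rightarrow> nat" where
  "vsize (Atom n) = 1 + floorlog 2 n"
| "vsize (Cell a b) = 1 + vsize a + vsize b"

primrec nat_of_val :: "val \<Rightarrow> nat" where
  "nat_of_val (Atom n) = n"
| "nat_of_val (Cell a b) = 0"

primrec left_val :: "val \<Rightarrow> val" where
  "left_val (Atom n) = Atom 0"
| "left_val (Cell a b) = a"

primrec right_val :: "val \<Rightarrow> val" where
  "right_val (Atom n) = Atom 0"
| "right_val (Cell a b) = b"

primrec is_cell :: "val \<Rightarrow> bool" where
  "is_cell (Atom n) = False"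
| "is_cell (Cell a b) = True"

datatype arith_op = Add | Sub | Mul | Div | Less

primrec arith_val :: "arith_op \<Rightarrow> nat \<Rightarrow> nat \<Rightarrow> nat" where
  "arith_val Add a b = a + b"
| "arith_val Sub a b = a - b"
| "arith_val Mul a b = a * b"
| "arith_val Div a b = a div b"
| "arith_val Less a b = of_bool (a < b)"

datatype expr =
    Lit val | Reg nat | MkCell expr expr | Left expr | Right expr | IsCell expr
  | Arith arith_op expr expr

type_synonym store = "nat \<Rightarrow> val"

primrec expr_val :: "expr \<Rightarrow> store \<Rightarrow> val" where
  "expr_val (Lit v) s = v"
| "expr_val (Reg x) s = s x"
| "expr_val (MkCell a b) s = Cell (expr_val a s) (expr_val b s)"
| "expr_val (Left a) s = left_val (expr_val a s)"
| "expr_val (Right a) s = right_val (expr_val a s)"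
| "expr_val (IsCell a) s = Atom (of_bool (is_cell (expr_val a s)))"
| "expr_val (Arith f a b) s = Atom (arith_val f (nat_of_val (expr_val a s)) (nat_of_val (expr_val b s)))"

primrec expr_cost :: "expr \<Rightarrow> store \<Rightarrow> nat" where
  "expr_cost (Lit v) s = 1"
| "expr_cost (Reg x) s = 1"
| "expr_cost (MkCell a b) s = 1 + expr_cost a s + expr_cost b s"
| "expr_cost (Left a) s = 1 + expr_cost a s"
| "expr_cost (Right a) s = 1 + expr_cost a s"
| "expr_cost (IsCell a) s = 1 + expr_cost a s"
| "expr_cost (Arith f a b) s = 1 + expr_cost a s + expr_cost b s +
     floorlog 2 (nat_of_val (expr_val a s)) + floorlog 2 (nat_of_val (expr_val b s))"

definition truthy :: "val \<Rightarrow> bool" where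
  "truthy v \<longleftrightarrow> v \<noteq> Atom 0"

text \<open>\<open>Flip x\<close> stores a fair random bit and \<open>Sample x\<close> a fresh sample in register \<open>x\<close>.
  \<open>Call x c y\<close> runs the subroutine on the content of \<open>x\<close> and stores its answer in \<open>y\<close>; whenever
  the subroutine asks for a sample, \<open>c\<close> is executed (with fresh random bits) on the store of the
  caller and the resulting content of register \<open>0\<close> is handed over.\<close>

datatype com =
    Skip | Assign nat expr | Seq com com | If expr com com | While expr com
  | Flip nat | Sample nat | Call nat com nat

partial_function (spmf) while_spmf :: "('a \<Rightarrow> bool) \<Rightarrow> ('a \<Rightarrow> 'a spmf) \<Rightarrow> 'a \<Rightarrow> 'a spmf" where
  "while_spmf b f x = (if b x then bind_spmf (f x) (\<lambda>y. while_spmf b f y) else return_spmf x)"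

text \<open>A \<^emph>\<open>source\<close> produces a value together with the time spent on producing it. A \<^emph>\<open>subroutine\<close> maps
  an input and a source of samples to an answer together with the time spent, the time
  spent by the source included.\<close>

type_synonym source = "(val \<times> nat) spmf"
type_synonym subroutine = "val \<Rightarrow> source \<Rightarrow> (val \<times> nat) spmf"

text \<open>States consist of the store, the time spent and the number of samples drawn so far. The missing
  mass of a sub-probability distribution accounts for divergence and for illegal operations.\<close>

primrec exec :: "source \<Rightarrow> subroutine \<Rightarrow> com \<Rightarrow> store \<times> nat \<times> nat \<Rightarrow> (store \<times> nat \<times> nat) spmf" where
  "exec smp sub Skip = return_spmf"
| "exec smp sub (Assign x e) = (\<lambda>(s, t, k). return_spmf (s(x := expr_val e s), t + 1 + expr_cost e s, k))"
| "exec smp sub (Seq c d) = (\<lambda>z. bind_spmf (exec smp sub c z) (exec smp sub d))"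
| "exec smp sub (If e c d) = (\<lambda>(s, t, k).
     (if truthy (expr_val e s) then exec smp sub c else exec smp sub d) (s, t + 1 + expr_cost e s, k))"
| "exec smp sub (While e c) = (\<lambda>z.
     map_spmf (\<lambda>(s, t, k). (s, t + 1 + expr_cost e s, k))
       (while_spmf (\<lambda>(s, t, k). truthy (expr_val e s))
          (\<lambda>(s, t, k). exec smp sub c (s, t + 1 + expr_cost e s, k)) z))"
| "exec smp sub (Flip x) = (\<lambda>(s, t, k).
     map_spmf (\<lambda>b. (s(x := Atom (of_bool b)), t + 1, k)) coin_spmf)"
| "exec smp sub (Sample x) = (\<lambda>(s, t, k).
     map_spmf (\<lambda>(v, t'). (s(x := v), t + 1 + t', k + 1)) smp)"
| "exec smp sub (Call x c y) = (\<lambda>(s, t, k).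
     map_spmf (\<lambda>(v, t'). (s(y := v), t + 1 + t', k))
       (sub (s x) (map_spmf (\<lambda>(s', t', k'). (s' 0, t')) (exec smp sub c (s, 0, 0)))))"

text \<open>Input and output are passed in register \<open>0\<close>; the result lists output, time and number of
  samples.\<close>

definition run :: "source \<Rightarrow> subroutine \<Rightarrow> com \<Rightarrow> val \<Rightarrow> (val \<times> nat \<times> nat) spmf" where
  "run smp sub c v = map_spmf (\<lambda>(s, t, k). (s 0, t, k)) (exec smp sub c ((\<lambda>_. Atom 0)(0 := v), 0, 0))"

definition no_samples :: source where
  "no_samples = return_pmf None"

definition no_subroutine :: subroutine where
  "no_subroutine = (\<lambda>_ _. return_pmf None)"

text \<open>The program \<open>A\<close> as a subroutine, callable on inputs from \<open>Q\<close> only.\<close>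

definition subroutine_on :: "val set \<Rightarrow> com \<Rightarrow> subroutine" where
  "subroutine_on Q A = (\<lambda>v smp. if v \<in> Q
     then map_spmf (\<lambda>(a, t, k). (a, t)) (run smp no_subroutine A v) else return_pmf None)"


section \<open>Encodings\<close>

definition enc_list :: "val list \<Rightarrow> val" where
  "enc_list vs = foldr Cell vs (Atom 0)"

definition enc_rat :: "rat \<Rightarrow> val" where
  "enc_rat q = (case quotient_of q of (a, b) \<Rightarrow>
     Cell (Cell (Atom (of_bool (a < 0))) (Atom (nat \<bar>a\<bar>))) (Atom (nat b)))"

definition enc_real :: "real \<Rightarrow> val" where
  "enc_real x = enc_rat (THE q. of_rat q = x)"

definition rational_model :: "ising \<Rightarrow> bool" where
  "rational_model M \<longleftrightarrow> (\<forall>e\<in>edges M. coupling M e \<in> \<rat>) \<and> (\<forall>v<nverts M. \<forall>i\<in>{1, 2}. ext_field M v i \<in> \<rat>)"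

text \<open>A model with rational parameters is written down as the number of vertices, the weighted
  adjacency matrix (with \<open>Atom 0\<close> for a non-edge, which is not the code of a rational) and the
  list of external fields.\<close>

definition enc_model :: "ising \<Rightarrow> val" where
  "enc_model M = (let n = nverts M in
     Cell (Atom n)
       (Cell (enc_list (map (\<lambda>u. enc_list (map (\<lambda>v.
                if {u, v} \<in> edges M then enc_real (coupling M {u, v}) else Atom 0) [0..<n])) [0..<n]))
             (enc_list (map (\<lambda>v. Cell (enc_real (ext_field M v 1)) (enc_real (ext_field M v 2))) [0..<n]))))"

definition enc_config :: "nat \<Rightarrow> (nat \<Rightarrow> nat) \<Rightarrow> val" where
  "enc_config n \<sigma> = enc_list (map (\<lambda>v. Atom (\<sigma> v)) [0..<n])"

definition sample_access :: "ising \<Rightarrow> source" where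
  "sample_access M = spmf_of_pmf (map_pmf (\<lambda>\<sigma>. (enc_config (nverts M) \<sigma>, 0)) (gibbs M))"


section \<open>Identity testing and decision approximate counting\<close>

definition prob_accept :: "(val \<times> nat \<times> nat) spmf \<Rightarrow> real" where
  "prob_accept p = measure (measure_spmf p) {(v, t, k). v = Atom 1}"

definition prob_reject :: "(val \<times> nat \<times> nat) spmf \<Rightarrow> real" where
  "prob_reject p = measure (measure_spmf p) {(v, t, k). v = Atom 0}"

text \<open>The program \<open>A\<close> is an \<open>\<epsilon>\<close>-identity testing algorithm for the families \<open>\<M> n\<close>, drawing at most
  \<open>ps(n)\<close> samples and running in time polynomial (bounded by \<open>pt\<close>) in the size of its input, the
  explicit model. Both bounds hold for all outcomes of the coin flips and of the samples. The
  explicit model needs rational parameters, the hidden one does not.\<close>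

definition identity_tester ::
    "(nat \<Rightarrow> ising set) \<Rightarrow> real \<Rightarrow> nat poly \<Rightarrow> nat poly \<Rightarrow> com \<Rightarrow> bool" where
  "identity_tester \<M> \<epsilon> ps pt A \<longleftrightarrow>
     (\<forall>n. \<forall>M\<in>\<M> n. \<forall>M'\<in>\<M> n. rational_model M \<longrightarrow>
        (let res = run (sample_access M') no_subroutine A (enc_model M) in
           lossless_spmf res \<and>
           (\<forall>(v, t, k)\<in>set_spmf res. t \<le> poly pt (vsize (enc_model M)) \<and> k \<le> poly ps n) \<and>
           (gibbs M = gibbs M' \<longrightarrow> prob_accept res \<ge> 3/4) \<and>
           (tv_dist (gibbs M) (gibbs M') \<ge> 1 - \<epsilon> \<longrightarrow> prob_reject res \<ge> 3/4)))"

text \<open>The program \<open>R\<close>, using the subroutine \<open>sub N\<close> on instances with \<open>N\<close> vertices, solves the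
  decision \<open>r(N)\<close>-approximate counting problem for the families \<open>\<M> N\<close>. Its running time, which
  includes the time spent in the subroutine, is polynomial in \<open>N\<close> and the bit length of the
  number \<open>Zhat\<close>.\<close>

definition decision_counter ::
    "(nat \<Rightarrow> ising set) \<Rightarrow> (nat \<Rightarrow> nat) \<Rightarrow> nat poly \<Rightarrow> (nat \<Rightarrow> subroutine) \<Rightarrow> com \<Rightarrow> bool" where
  "decision_counter \<M> r p sub R \<longleftrightarrow>
     (\<forall>N. \<forall>M\<in>\<M> N. \<forall>Zhat::rat. Zhat > 0 \<longrightarrow>
        (let res = run no_samples (sub N) R
                     (Cell (enc_model M) (Cell (Atom (r N)) (enc_rat Zhat))) in
           lossless_spmf res \<and>
           (\<forall>(v, t, k)\<in>set_spmf res. t \<le> poly p (N + vsize (enc_rat Zhat))) \<and>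
           (partition_function M \<le> of_rat Zhat / real (r N) \<longrightarrow> prob_reject res \<ge> 5/8) \<and>
           (partition_function M \<ge> real (r N) * of_rat Zhat \<longrightarrow> prob_accept res \<ge> 5/8)))"

end

theory Submission
  imports Defs
begin

text \<open>Given a cubic graph \<open>G\<close> on \<open>N\<close> vertices and \<open>Zhat\<close>, add four blocks \<open>S\<close>, \<open>T\<close>, \<open>A\<close>, \<open>B\<close> of
  \<open>m = \<Theta>(N\<^sup>2)\<close> vertices. Strong antiferromagnetic complete bipartite graphs on \<open>S, T\<close> and on
  \<open>A, B\<close> leave two phases: if \<open>S\<close> and \<open>A\<close> agree, their couplings to \<open>G\<close> add up and freeze \<open>G\<close>, so that only
  two complementary configurations matter; if they disagree, the couplings cancel and \<open>G\<close> contributes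
  its full partition function \<open>Z\<close>. The coupling between \<open>S\<close> and \<open>A\<close> is tuned such that the frozen phase has about
  the weight that the free phase would have for \<open>Z = Zhat\<close>. Feed the tester this gadget together with
  samples that are uniform on the two frozen configurations. If \<open>Z\<close> is much smaller than \<open>Zhat\<close>, these are
  nearly samples of the gadget. If \<open>Z\<close> is much larger, they are nearly samples of a complete bipartite
  model, which is almost singular to the gadget. So the negated answer of the tester decides the
  counting problem. Samples are compared by domination: the sampling distribution is at most \<open>\<rho>\<close>
  times the Gibbs measure with \<open>\<rho>\<close> close to 1, hence every event of a run with at most \<open>K\<close> samples
  has probability at most \<open>\<rho>\<^sup>K\<close> times its probability under the Gibbs measure.\<close>

section \<open>Domination of runs\<close>

text \<open>A Gibbs measure charges every configuration, so the two-point samples belong to no model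
  and the tester promises nothing about them. Two genuine models stand in: the gadget itself when
  \<open>Z\<close> is small, \<open>bipartite\<close> when it is large. A failure probability of 1/4
  grows by a factor \<open>\<rho> ^ K\<close> of at most 3/2 to 3/8, which leaves the required 5/8.
  The size of \<open>m\<close> comes from two demands on the coupling \<open>\<kappa>\<close>
  between blocks and graph. The free phase costs \<open>\<kappa> * m * N\<close>, which must stay of
  order \<open>m\<close>, below the energy \<open>10 * m\<close> of a broken lock. Hence
  \<open>\<kappa>\<close> is about \<open>1 / N\<close> and \<open>m\<close> about \<open>N\<close>
  squared. Tuning also needs \<open>ln Zhat\<close>, while programs have integer arithmetic only; an
  integer search finds it up to a constant, and an error of 5 in the exponent costs a factor
  \<open>exp 5 \<le> 243\<close>, absorbed in \<open>r\<close>. A \<open>Zhat\<close> out of reach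
  for \<open>Z\<close> is answered directly.\<close>

lemma nn_integral_bind_spmf:
  "(\<integral>\<^sup>+ y. g y \<partial>measure_spmf (bind_spmf p f)) = (\<integral>\<^sup>+ x. (\<integral>\<^sup>+ y. g y \<partial>measure_spmf (f x)) \<partial>measure_spmf p)"
  unfolding measure_spmf_bind
  by (subst nn_integral_bind[where B = "count_space UNIV"]) auto

lemma lossless_spmf_nonempty:
  assumes "lossless_spmf p"
  obtains x where "x \<in> set_spmf p"
proof -
  obtain y where "y \<in> set_pmf p"
    using set_pmf_not_empty[of p] by blast
  with assms that show ?thesis
    by (cases y) (auto simp: lossless_iff_set_pmf_None in_set_spmf)
qed

text \<open>\<open>P\<close> links a state to the final one, so a round is undone backwards. Fixed
  point induction applies because the claim bounds a support, which is empty for the bottom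
  element.\<close>

lemma while_spmf_invariant:
  assumes step: "\<And>x y z. b x \<Longrightarrow> y \<in> set_spmf (f x) \<Longrightarrow> P y z \<Longrightarrow> P x z"
    and stop: "\<And>x. \<not> b x \<Longrightarrow> P x x"
    and "z \<in> set_spmf (while_spmf b f x)"
  shows "P x z"
proof -
  have "\<forall>x. set_spmf (while_spmf b f x) \<subseteq> {z. P x z}"
    apply (induction rule: while_spmf.fixp_induct)
    subgoal by simp
    subgoal by simp
    subgoal using step stop by (auto simp: set_bind_spmf bind_UNION) blast
    done
  then show ?thesis
    using assms(3) by blast
qed

lemma exec_time_mono:
  "(s', t', k') \<in> set_spmf (exec smp sub c (s, t, k)) \<Longrightarrow> t \<le> t'"
proof (induction c arbitrary: s t k s' t' k')
  case (Seq c d)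
  then show ?case
    by (fastforce simp: set_bind_spmf bind_UNION intro: order_trans)
next
  case (If e c d)
  then show ?case
    by (fastforce split: if_splits)
next
  case (While e c)
  let ?b = "\<lambda>(s, t, k). truthy (expr_val e s)"
  let ?f = "\<lambda>(s, t, k). exec smp sub c (s, t + 1 + expr_cost e s, k)"
  have "fst (snd x) \<le> fst (snd z)" if "z \<in> set_spmf (while_spmf ?b ?f x)" for x z
    using that
  proof (rule while_spmf_invariant[rotated 2])
    fix x y z
    assume "y \<in> set_spmf (?f x)" "fst (snd y) \<le> fst (snd z)"
    then show "fst (snd x) \<le> fst (snd z)"
      by (cases x; cases y) (auto dest!: While.IH)
  qed simp
  then show ?case
    using While.prems by fastforce
qed (auto simp: no_subroutine_def)

text \<open>\<open>sample_access\<close> charges no time, the program simulating it charges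
  \<open>d\<close> per sample. Runs with the two sources thus correspond up to \<open>d\<close>
  extra units for each sample drawn.\<close>

definition delay :: "nat \<Rightarrow> store \<times> nat \<times> nat \<Rightarrow> store \<times> nat \<times> nat" where
  "delay d = (\<lambda>(s, t, k). (s, t + d * k, k))"

definition samples :: "store \<times> nat \<times> nat \<Rightarrow> nat" where
  "samples z = snd (snd z)"

text \<open>Domination of measures, phrased through expectations of all nonnegative functions: a
  final state of \<open>q\<close> may be overcharged by one factor \<open>\<rho>\<close> per sample.
  The factor \<open>\<rho> ^ k\<close>, with \<open>k\<close> the samples drawn before the start,
  credits what is already paid, so that the relation composes. Losslessness of \<open>p\<close> is
  carried along because an upper bound cannot yield it.\<close>

definition dominated :: "ennreal \<Rightarrow> nat \<Rightarrow> nat \<Rightarrow>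
    (store \<times> nat \<times> nat) spmf \<Rightarrow> (store \<times> nat \<times> nat) spmf \<Rightarrow> bool" where
  "dominated \<rho> d k p q \<longleftrightarrow> lossless_spmf p \<and>
     (\<forall>g. \<rho> ^ k * (\<integral>\<^sup>+ z. g z \<partial>measure_spmf p) \<le> (\<integral>\<^sup>+ z. g (delay d z) * \<rho> ^ samples z \<partial>measure_spmf q))"

lemma dominated_return:
  "dominated \<rho> d (samples z) (return_spmf (delay d z)) (return_spmf z)"
  by (simp add: dominated_def measure_spmf_return_spmf nn_integral_return mult.commute)

text \<open>Test with the indicator of \<open>{z}\<close>: if no state of \<open>q\<close> is
  delayed to \<open>z\<close>, the right side vanishes.\<close>

lemma dominated_support:
  assumes "dominated \<rho> d k p q" "\<rho> \<noteq> 0" "z \<in> set_spmf p"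
  obtains w where "w \<in> set_spmf q" "z = delay d w"
proof -
  have "z \<in> delay d ` set_spmf q"
  proof (rule ccontr)
    assume *: "z \<notin> delay d ` set_spmf q"
    have "\<rho> ^ k * (\<integral>\<^sup>+ x. indicator {z} x \<partial>measure_spmf p)
        \<le> (\<integral>\<^sup>+ x. indicator {z} (delay d x) * \<rho> ^ samples x \<partial>measure_spmf q)"
      using assms(1) unfolding dominated_def by blast
    also have "\<dots> = 0"
      using * by (subst nn_integral_0_iff_AE) (auto simp: indicator_def)
    finally have "emeasure (measure_spmf p) {z} = 0"
      using assms(2) by simp
    then show False
      using assms(3) by (simp add: emeasure_spmf_single in_set_spmf_iff_spmf ennreal_eq_0_iff not_le less_le)
  qed
  then show ?thesis using that by blast
qed

text \<open>The bound for \<open>p\<close> and \<open>q\<close> is applied to the function that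
  sends a state to the expectation of \<open>g\<close> under \<open>f\<close>. The weight
  \<open>\<rho> ^ samples w\<close> that it leaves behind is exactly the left factor of the bound
  for \<open>f\<close> and \<open>f'\<close>.\<close>

lemma dominated_bind:
  assumes pq: "dominated \<rho> d k p q" and "\<rho> \<noteq> 0"
    and fg: "\<And>w. w \<in> set_spmf q \<Longrightarrow> dominated \<rho> d (samples w) (f (delay d w)) (f' w)"
  shows "dominated \<rho> d k (bind_spmf p f) (bind_spmf q f')"
  unfolding dominated_def
proof (intro conjI allI)
  show "lossless_spmf (bind_spmf p f)"
    using pq fg dominated_support[OF pq \<open>\<rho> \<noteq> 0\<close>]
    by (auto simp: dominated_def) metis
  fix g :: "store \<times> nat \<times> nat \<Rightarrow> ennreal"
  have "\<rho> ^ k * (\<integral>\<^sup>+ z. g z \<partial>measure_spmf (bind_spmf p f))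
      = \<rho> ^ k * (\<integral>\<^sup>+ x. (\<integral>\<^sup>+ z. g z \<partial>measure_spmf (f x)) \<partial>measure_spmf p)"
    by (simp add: nn_integral_bind_spmf)
  also have "\<dots> \<le> (\<integral>\<^sup>+ w. (\<integral>\<^sup>+ z. g z \<partial>measure_spmf (f (delay d w))) * \<rho> ^ samples w \<partial>measure_spmf q)"
    using pq unfolding dominated_def by blast
  also have "\<dots> \<le> (\<integral>\<^sup>+ w. (\<integral>\<^sup>+ z. g (delay d z) * \<rho> ^ samples z \<partial>measure_spmf (f' w)) \<partial>measure_spmf q)"
  proof (rule nn_integral_mono_AE, rule AE_measure_spmf_iff[THEN iffD2], rule ballI)
    fix w assume "w \<in> set_spmf q"
    from fg[OF this] show "(\<integral>\<^sup>+ z. g z \<partial>measure_spmf (f (delay d w))) * \<rho> ^ samples w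
        \<le> (\<integral>\<^sup>+ z. g (delay d z) * \<rho> ^ samples z \<partial>measure_spmf (f' w))"
      unfolding dominated_def by (subst mult.commute) blast
  qed
  finally show "\<rho> ^ k * (\<integral>\<^sup>+ z. g z \<partial>measure_spmf (bind_spmf p f))
      \<le> (\<integral>\<^sup>+ z. g (delay d z) * \<rho> ^ samples z \<partial>measure_spmf (bind_spmf q f'))"
    by (simp add: nn_integral_bind_spmf)
qed

text \<open>The bound \<open>T\<close> is what makes loops tractable: each iteration takes time, so one can induct on the
  time that is left, and no fixed point argument is needed.\<close>

lemma exec_dominated:
  assumes "\<rho> \<noteq> 0"
    and lossless: "lossless_spmf smp"
    and dom: "\<And>g. (\<integral>\<^sup>+ x. g x \<partial>measure_spmf smp) \<le> \<rho> * (\<integral>\<^sup>+ (v, t). g (v, t + d) \<partial>measure_spmf smp')"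
    and "lossless_spmf (exec smp' no_subroutine c z)"
    and "\<And>s t k. (s, t, k) \<in> set_spmf (exec smp' no_subroutine c z) \<Longrightarrow> t \<le> T"
  shows "dominated \<rho> d (samples z) (exec smp no_subroutine c (delay d z)) (exec smp' no_subroutine c z)"
  using assms(4,5)
proof (induction c arbitrary: z T)
  case Skip
  then show ?case by (simp add: dominated_return)
next
  case (Assign x e)
  show ?case
    using dominated_return[of \<rho> d "case z of (s, t, k) \<Rightarrow> (s(x := expr_val e s), t + 1 + expr_cost e s, k)"]
    by (cases z) (auto simp: delay_def samples_def ac_simps)
next
  case (Seq c1 c2)
  have l: "lossless_spmf (exec smp' no_subroutine c1 z)"
    and l': "\<And>w. w \<in> set_spmf (exec smp' no_subroutine c1 z) \<Longrightarrow> lossless_spmf (exec smp' no_subroutine c2 w)"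
    using Seq.prems(1) by auto
  have T2: "t \<le> T" if "w \<in> set_spmf (exec smp' no_subroutine c1 z)"
      "(s, t, k) \<in> set_spmf (exec smp' no_subroutine c2 w)" for w s t k
    using Seq.prems(2)[of s t k] that by (auto simp: set_bind_spmf bind_UNION)
  \<comment> \<open>The second program terminates and time never decreases, so the bound on final
    times also limits the intermediate ones.\<close>
  have T1: "t \<le> T" if w: "(s, t, k) \<in> set_spmf (exec smp' no_subroutine c1 z)" for s t k
  proof -
    obtain s' t' k' where "(s', t', k') \<in> set_spmf (exec smp' no_subroutine c2 (s, t, k))"
      using lossless_spmf_nonempty[OF l'[OF w]] by (metis prod_cases3)
    then show ?thesis
      using T2[OF w] exec_time_mono order_trans by blast
  qed
  show ?case
    using dominated_bind[OF Seq.IH(1)[OF l T1] \<open>\<rho> \<noteq> 0\<close> Seq.IH(2)[OF l' T2]] by auto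
next
  case (If e c1 c2)
  obtain s t k where z: "z = (s, t, k)" by (cases z) auto
  let ?z = "(s, t + 1 + expr_cost e s, k)"
  have d: "delay d z = (s, t + d * k, k)" "samples z = samples ?z"
      "delay d ?z = (s, t + d * k + 1 + expr_cost e s, k)"
    by (auto simp: delay_def samples_def z)
  show ?case
  proof (cases "truthy (expr_val e s)")
    case True
    then have ex: "exec smp' no_subroutine (If e c1 c2) z = exec smp' no_subroutine c1 ?z"
        "exec smp no_subroutine (If e c1 c2) (delay d z) = exec smp no_subroutine c1 (delay d ?z)"
      unfolding d by (simp_all add: z)
    show ?thesis
      using If.prems unfolding ex d(2) by (rule If.IH(1))
  next
    case False
    then have ex: "exec smp' no_subroutine (If e c1 c2) z = exec smp' no_subroutine c2 ?z"
        "exec smp no_subroutine (If e c1 c2) (delay d z) = exec smp no_subroutine c2 (delay d ?z)"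
      unfolding d by (simp_all add: z)
    show ?thesis
      using If.prems unfolding ex d(2) by (rule If.IH(2))
  qed
next
  case (While e c)
  let ?b = "\<lambda>(s, t, k). truthy (expr_val e s)"
  let ?f = "\<lambda>smp. \<lambda>(s, t, k). exec smp no_subroutine c (s, t + 1 + expr_cost e s, k)"
  let ?W = "\<lambda>smp. while_spmf ?b (?f smp)"
  have time: "fst (snd x) \<le> fst (snd w)" if "w \<in> set_spmf (?W smp' x)" for x w
    using that
  proof (rule while_spmf_invariant[rotated 2])
    fix x y z
    assume "y \<in> set_spmf (?f smp' x)" "fst (snd y) \<le> fst (snd z)"
    then show "fst (snd x) \<le> fst (snd z)"
      by (cases x; cases y) (auto dest!: exec_time_mono)
  qed simp
  have W: "dominated \<rho> d (samples z) (?W smp (delay d z)) (?W smp' z)"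
    if "lossless_spmf (?W smp' z)" "\<And>w. w \<in> set_spmf (?W smp' z) \<Longrightarrow> fst (snd w) \<le> T" for z
    using that
  proof (induction "T - fst (snd z)" arbitrary: z rule: less_induct)
    case (less z)
    obtain s t k where z: "z = (s, t, k)" by (cases z) auto
    show ?case
    proof (cases "truthy (expr_val e s)")
      case False
      then show ?thesis
        using dominated_return[of \<rho> d z]
        by (subst (1 2) while_spmf.simps) (simp add: z delay_def)
    next
      case True
      let ?z = "(s, t + 1 + expr_cost e s, k)"
      let ?p = "exec smp' no_subroutine c ?z"
      have unf: "?W smp' z = bind_spmf ?p (?W smp')"
        by (subst while_spmf.simps) (simp add: z True)
      have unf': "?W smp (delay d z) = bind_spmf (exec smp no_subroutine c (delay d ?z)) (?W smp)"
        by (subst while_spmf.simps) (simp add: z True delay_def ac_simps)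
      have l: "lossless_spmf ?p" and l': "\<And>w. w \<in> set_spmf ?p \<Longrightarrow> lossless_spmf (?W smp' w)"
        using less.prems(1) unfolding unf by auto
      have T2: "fst (snd w') \<le> T" if "w \<in> set_spmf ?p" "w' \<in> set_spmf (?W smp' w)" for w w'
        using less.prems(2)[of w'] that unfolding unf by (auto simp: set_bind_spmf bind_UNION)
      have T1: "fst (snd w) \<le> T" if w: "w \<in> set_spmf ?p" for w
      proof -
        obtain w' where "w' \<in> set_spmf (?W smp' w)"
          using lossless_spmf_nonempty[OF l'[OF w]] .
        then show ?thesis
          using T2[OF w] time order_trans by blast
      qed
      \<comment> \<open>Already the loop test costs time, hence the strict inequality that drives
        the induction.\<close>
      have T0: "fst (snd z) < fst (snd w)" if w: "w \<in> set_spmf ?p" for w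
        using exec_time_mono[of "fst w" "fst (snd w)" "snd (snd w)" smp' no_subroutine c s "t + 1 + expr_cost e s" k] w
        by (simp add: z)
      have A: "dominated \<rho> d (samples w) (?W smp (delay d w)) (?W smp' w)" if w: "w \<in> set_spmf ?p" for w
        using T0[OF w] T1[OF w] by (intro less.hyps l'[OF w] T2[OF w]) auto
      have B: "dominated \<rho> d (samples ?z) (exec smp no_subroutine c (delay d ?z)) ?p"
        using T1 by (intro While.IH[OF l, of T]) force
      have "dominated \<rho> d (samples ?z) (?W smp (delay d z)) (?W smp' z)"
        unfolding unf unf' by (rule dominated_bind[OF B \<open>\<rho> \<noteq> 0\<close> A])
      then show ?thesis
        by (simp add: samples_def z)
    qed
  qed
  let ?g = "\<lambda>(s, t, k). (s, t + 1 + expr_cost e s, k)"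
  have ex: "exec sm no_subroutine (While e c) w = bind_spmf (?W sm w) (\<lambda>x. return_spmf (?g x))" for sm w
    by (simp add: map_spmf_conv_bind_spmf)
  have "dominated \<rho> d (samples z) (?W smp (delay d z)) (?W smp' z)"
  proof (rule W)
    show "lossless_spmf (?W smp' z)"
      using While.prems(1) by simp
    fix w assume w: "w \<in> set_spmf (?W smp' z)"
    obtain s t k where wd: "w = (s, t, k)" by (cases w) auto
    have "(s, t + 1 + expr_cost e s, k) \<in> set_spmf (exec smp' no_subroutine (While e c) z)"
      using w unfolding ex by (force simp: wd set_bind_spmf bind_UNION)
    then show "fst (snd w) \<le> T"
      using While.prems(2) by (fastforce simp: wd)
  qed
  moreover have "dominated \<rho> d (samples w) (return_spmf (?g (delay d w))) (return_spmf (?g w))" for w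
    using dominated_return[of \<rho> d "?g w"] by (cases w) (auto simp: delay_def samples_def ac_simps)
  ultimately show ?case
    unfolding ex by (intro dominated_bind \<open>\<rho> \<noteq> 0\<close>)
next
  case (Flip x)
  obtain s t k where z: "z = (s, t, k)" by (cases z) auto
  show ?case
    unfolding dominated_def
  proof (intro conjI allI)
    show "lossless_spmf (exec smp no_subroutine (Flip x) (delay d z))"
      by (simp add: z delay_def)
    fix g :: "store \<times> nat \<times> nat \<Rightarrow> ennreal"
    let ?G = "\<lambda>b. g (s(x := Atom (of_bool b)), t + d * k + 1, k)"
    have "\<rho> ^ k * (\<integral>\<^sup>+ b. ?G b \<partial>measure_spmf coin_spmf) = (\<integral>\<^sup>+ b. ?G b * \<rho> ^ k \<partial>measure_spmf coin_spmf)"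
      by (subst nn_integral_multc) (auto simp: mult.commute)
    then show "\<rho> ^ samples z * (\<integral>\<^sup>+ w. g w \<partial>measure_spmf (exec smp no_subroutine (Flip x) (delay d z)))
        \<le> (\<integral>\<^sup>+ w. g (delay d w) * \<rho> ^ samples w \<partial>measure_spmf (exec smp' no_subroutine (Flip x) z))"
      by (simp add: z delay_def samples_def o_def)
  qed
next
  case (Sample x)
  obtain s t k where z: "z = (s, t, k)" by (cases z) auto
  show ?case
    unfolding dominated_def
  proof (intro conjI allI)
    show "lossless_spmf (exec smp no_subroutine (Sample x) (delay d z))"
      using lossless by (simp add: z delay_def)
    fix g :: "store \<times> nat \<times> nat \<Rightarrow> ennreal"
    let ?G = "\<lambda>w. g (s(x := fst w), t + d * k + 1 + snd w, k + 1)"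
    have "\<rho> ^ k * (\<integral>\<^sup>+ x. ?G x \<partial>measure_spmf smp)
        \<le> \<rho> ^ k * (\<rho> * (\<integral>\<^sup>+ w. ?G (fst w, snd w + d) \<partial>measure_spmf smp'))"
      using dom[of ?G, unfolded case_prod_beta] by (intro mult_left_mono) auto
    also have "\<dots> = (\<integral>\<^sup>+ w. ?G (fst w, snd w + d) * \<rho> ^ Suc k \<partial>measure_spmf smp')"
      by (subst nn_integral_multc) (simp_all add: ac_simps)
    finally show "\<rho> ^ samples z * (\<integral>\<^sup>+ w. g w \<partial>measure_spmf (exec smp no_subroutine (Sample x) (delay d z)))
        \<le> (\<integral>\<^sup>+ w. g (delay d w) * \<rho> ^ samples w \<partial>measure_spmf (exec smp' no_subroutine (Sample x) z))"
      by (simp add: z delay_def samples_def o_def case_prod_beta ac_simps)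
  qed
next
  \<comment> \<open>With \<open>no_subroutine\<close> a call never returns, which contradicts
    losslessness.\<close>
  case (Call x c y)
  then show ?case
    by (cases z) (simp add: no_subroutine_def)
qed

text \<open>A run starts with no samples drawn, so the left factor is 1, and ends with at most
  \<open>K\<close>, so the weight on the right is at most \<open>\<rho> ^ K\<close>.\<close>

lemma run_dominated:
  fixes \<rho> :: real
  assumes "\<rho> > 0"
    and "lossless_spmf smp"
    and "\<And>g. (\<integral>\<^sup>+ x. g x \<partial>measure_spmf smp) \<le> ennreal \<rho> * (\<integral>\<^sup>+ (v, t). g (v, t + d) \<partial>measure_spmf smp')"
    and l: "lossless_spmf (run smp' no_subroutine c v)"
    and b: "\<forall>(v, t, k) \<in> set_spmf (run smp' no_subroutine c v). t \<le> T \<and> k \<le> K"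
    and "\<rho> \<ge> 1"
  shows "lossless_spmf (run smp no_subroutine c v)"
    and "\<forall>(v, t, k) \<in> set_spmf (run smp no_subroutine c v). t \<le> T + d * K"
    and "measure (measure_spmf (run smp no_subroutine c v)) {(v, t, k). v \<in> A}
        \<le> \<rho> ^ K * measure (measure_spmf (run smp' no_subroutine c v)) {(v, t, k). v \<in> A}"
proof -
  let ?z = "((\<lambda>_. Atom 0)(0 := v), 0, 0) :: store \<times> nat \<times> nat"
  let ?p = "exec smp no_subroutine c ?z" and ?q = "exec smp' no_subroutine c ?z"
  have bq: "t \<le> T" "k \<le> K" if "(s, t, k) \<in> set_spmf ?q" for s t k
    using b that by (force simp: run_def)+
  have "dominated \<rho> d (samples ?z) (exec smp no_subroutine c (delay d ?z)) ?q"
    using assms(1-3) l bq by (intro exec_dominated[where T = T]) (auto simp: run_def)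
  then have D: "dominated \<rho> d 0 ?p ?q"
    by (simp add: delay_def samples_def)
  then show "lossless_spmf (run smp no_subroutine c v)"
    by (simp add: run_def dominated_def)
  show "\<forall>(v, t, k) \<in> set_spmf (run smp no_subroutine c v). t \<le> T + d * K"
  proof clarify
    fix u t k assume "(u, t, k) \<in> set_spmf (run smp no_subroutine c v)"
    then obtain s where "(s, t, k) \<in> set_spmf ?p"
      by (auto simp: run_def)
    then obtain w where w: "w \<in> set_spmf ?q" "(s, t, k) = delay d w"
      using assms(1) by (elim dominated_support[OF D, rotated]) auto
    obtain s' t' k' where "w = (s', t', k')" by (cases w) auto
    with w bq[of s' t' k'] show "t \<le> T + d * K"
      by (auto simp: delay_def intro: add_mono)
  qed
  let ?g = "\<lambda>(s, t, k). indicator A (s 0 :: val) :: ennreal"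
  let ?P = "run smp no_subroutine c v" and ?Q = "run smp' no_subroutine c v"
  let ?E = "{(v, t, k). v \<in> A}"
  have em: "emeasure (measure_spmf (run sm no_subroutine c v)) ?E
      = (\<integral>\<^sup>+ z. ?g z \<partial>measure_spmf (exec sm no_subroutine c ?z))" for sm
    by (subst nn_integral_indicator[symmetric])
      (auto simp: run_def o_def intro!: nn_integral_cong split: split_indicator)
  have "emeasure (measure_spmf ?P) ?E \<le> (\<integral>\<^sup>+ z. ?g (delay d z) * ennreal \<rho> ^ samples z \<partial>measure_spmf ?q)"
    using D[unfolded dominated_def, THEN conjunct2, THEN spec, of ?g] unfolding em by simp
  also have "\<dots> \<le> (\<integral>\<^sup>+ z. ennreal (\<rho> ^ K) * ?g z \<partial>measure_spmf ?q)"
  proof (rule nn_integral_mono_AE, rule AE_measure_spmf_iff[THEN iffD2], rule ballI)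
    fix z assume z: "z \<in> set_spmf ?q"
    obtain s t k where "z = (s, t, k)" by (cases z) auto
    with bq(2)[of s t k] z assms(6) show "?g (delay d z) * ennreal \<rho> ^ samples z \<le> ennreal (\<rho> ^ K) * ?g z"
      by (auto simp: delay_def samples_def ennreal_power indicator_def intro!: power_increasing)
  qed
  also have "\<dots> = ennreal (\<rho> ^ K) * emeasure (measure_spmf ?Q) ?E"
    unfolding em by (rule nn_integral_cmult) auto
  finally show "measure (measure_spmf ?P) ?E \<le> \<rho> ^ K * measure (measure_spmf ?Q) ?E"
    using assms(1) by (simp add: measure_spmf.emeasure_eq_measure flip: ennreal_mult)
qed

section \<open>Ising models as pair couplings\<close>

definition pair_coupling :: "ising \<Rightarrow> nat \<Rightarrow> nat \<Rightarrow> real" where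
  "pair_coupling M u v = (if {u, v} \<in> edges M then coupling M {u, v} else 0)"

text \<open>Ordered pairs meet each edge twice, hence the halving. In this form the energy splits
  along blocks without orienting edges.\<close>

definition pair_energy :: "nat \<Rightarrow> (nat \<Rightarrow> nat \<Rightarrow> real) \<Rightarrow> (nat \<Rightarrow> nat) \<Rightarrow> real" where
  "pair_energy n W \<sigma> = (\<Sum>u<n. \<Sum>v<n. W u v * of_bool (\<sigma> u = \<sigma> v)) / 2"

text \<open>Edges correspond to the increasing pairs \<open>P\<close>, and \<open>P'\<close> is the
  mirror image. All remaining ordered pairs, the diagonal included, have coupling 0.\<close>

lemma edge_sum_eq_pair_energy:
  assumes "simple_graph M"
  shows "(\<Sum>e\<in>edges M. coupling M e * of_bool (\<forall>u\<in>e. \<forall>v\<in>e. \<sigma> u = \<sigma> v))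
    = pair_energy (nverts M) (pair_coupling M) \<sigma>"
proof -
  let ?n = "nverts M"
  let ?f = "\<lambda>e. coupling M e * of_bool (\<forall>u\<in>e. \<forall>v\<in>e. \<sigma> u = \<sigma> v) :: real"
  let ?g = "\<lambda>(u, v). ?f {u, v}"
  define P where "P = {(u, v). u < v \<and> v < ?n \<and> {u, v} \<in> edges M}"
  define P' where "P' = {(u, v). v < u \<and> u < ?n \<and> {u, v} \<in> edges M}"
  have fin: "finite P" "finite P'"
    by (rule finite_subset[of _ "{..<?n} \<times> {..<?n}"]; auto simp: P_def P'_def)+
  have loop: "{u} \<notin> edges M" for u
    using assms by (auto simp: simple_graph_def doubleton_eq_iff)
  have "(\<lambda>(u, v). {u, v}) ` P = edges M"
  proof
    show "edges M \<subseteq> (\<lambda>(u, v). {u, v}) ` P"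
    proof
      fix e assume e: "e \<in> edges M"
      with assms obtain u v where uv: "e = {u, v}" "u < ?n" "v < ?n" "u \<noteq> v"
        by (auto simp: simple_graph_def)
      show "e \<in> (\<lambda>(u, v). {u, v}) ` P"
      proof (cases "u < v")
        case True
        then show ?thesis using uv e by (intro image_eqI[of _ _ "(u, v)"]) (auto simp: P_def)
      next
        case False
        then show ?thesis using uv e by (intro image_eqI[of _ _ "(v, u)"]) (auto simp: P_def insert_commute)
      qed
    qed
  qed (auto simp: P_def)
  moreover have "inj_on (\<lambda>(u, v). {u, v}) P"
    by (auto simp: inj_on_def P_def doubleton_eq_iff)
  ultimately have E: "(\<Sum>e\<in>edges M. ?f e) = sum ?g P"
    using sum.reindex[of "\<lambda>(u, v). {u, v}" P ?f] by (simp add: o_def case_prod_beta)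
  have swap: "P' = prod.swap ` P"
    by (force simp: P_def P'_def image_iff insert_commute)
  have "sum ?g P' = (\<Sum>x\<in>P. ?g (prod.swap x))"
    unfolding swap by (subst sum.reindex) (simp_all add: o_def)
  also have "\<dots> = sum ?g P"
    by (rule sum.cong[OF refl]) (simp only: case_prod_beta fst_swap snd_swap insert_commute)
  finally have "2 * sum ?g P = sum ?g P + sum ?g P'"
    by simp
  also have "\<dots> = sum ?g (P \<union> P')"
    by (rule sum.union_disjoint[symmetric]) (use fin in \<open>auto simp: P_def P'_def\<close>)
  also have "\<dots> = (\<Sum>(u, v)\<in>{..<?n} \<times> {..<?n}. pair_coupling M u v * of_bool (\<sigma> u = \<sigma> v))"
  proof (rule sum.mono_neutral_cong_left)
    show "\<forall>x\<in>{..<?n} \<times> {..<?n} - (P \<union> P').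
        (case x of (u, v) \<Rightarrow> pair_coupling M u v * of_bool (\<sigma> u = \<sigma> v)) = 0"
    proof
      fix x assume x: "x \<in> {..<?n} \<times> {..<?n} - (P \<union> P')"
      obtain u v where uv: "x = (u, v)" by (cases x)
      then have "{u, v} \<notin> edges M"
        using x loop[of u] by (cases u v rule: linorder_cases) (auto simp: P_def P'_def)
      then show "(case x of (u, v) \<Rightarrow> pair_coupling M u v * of_bool (\<sigma> u = \<sigma> v)) = 0"
        by (simp add: pair_coupling_def uv)
    qed
    show "?g x = (case x of (u, v) \<Rightarrow> pair_coupling M u v * of_bool (\<sigma> u = \<sigma> v))" if "x \<in> P \<union> P'" for x
    proof (cases x)
      case (Pair u v)
      then have "{u, v} \<in> edges M"
        using that by (auto simp: P_def P'_def)
      then show ?thesis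
        by (auto simp: Pair pair_coupling_def)
    qed
  qed (auto simp: P_def P'_def)
  finally show ?thesis
    unfolding E pair_energy_def sum.cartesian_product by linarith
qed

lemma weight_eq_exp_pair_energy:
  assumes "simple_graph M" "\<forall>v<nverts M. \<forall>i\<in>{1, 2}. ext_field M v i = 0" "\<sigma> \<in> configs (nverts M)"
  shows "weight M \<sigma> = exp (pair_energy (nverts M) (pair_coupling M) \<sigma>)"
proof -
  have "\<sigma> v \<in> {1, 2}" if "v < nverts M" for v
    using assms(3) that by (auto simp: configs_def PiE_iff)
  then have "(\<Sum>v<nverts M. ext_field M v (\<sigma> v)) = 0"
    using assms(2) by (intro sum.neutral) (metis lessThan_iff)
  then show ?thesis
    using edge_sum_eq_pair_energy[OF assms(1)] by (simp add: weight_def)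
qed

text \<open>An edge is an unordered set, so its coupling is read off at minimum and maximum; for
  symmetric \<open>W\<close> this is the right entry. Zero entries must become non-edges since
  antiferromagnetic couplings are strictly negative.\<close>

definition model_of :: "nat \<Rightarrow> (nat \<Rightarrow> nat \<Rightarrow> real) \<Rightarrow> ising" where
  "model_of n W = \<lparr>nverts = n, edges = {{u, v} | u v. u < n \<and> v < n \<and> u \<noteq> v \<and> W u v \<noteq> 0},
     coupling = (\<lambda>e. W (Min e) (Max e)), ext_field = (\<lambda>_ _. 0)\<rparr>"

lemma nverts_model_of [simp]: "nverts (model_of n W) = n"
  by (simp add: model_of_def)

lemma ext_field_model_of [simp]: "ext_field (model_of n W) v i = 0"
  by (simp add: model_of_def)

lemma simple_graph_model_of: "simple_graph (model_of n W)"
  by (auto simp: simple_graph_def model_of_def)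

lemma edges_model_of_iff:
  assumes "\<And>u v. W u v = W v u" "u < n" "v < n"
  shows "{u, v} \<in> edges (model_of n W) \<longleftrightarrow> u \<noteq> v \<and> W u v \<noteq> 0"
proof -
  have "(\<exists>a b. {u, v} = {a, b} \<and> a < n \<and> b < n \<and> a \<noteq> b \<and> W a b \<noteq> 0) \<longleftrightarrow> u \<noteq> v \<and> W u v \<noteq> 0"
    using assms(1)[of u v] assms(2,3) by (auto simp: doubleton_eq_iff)
  then show ?thesis by (simp add: model_of_def)
qed

lemma coupling_model_of:
  assumes "\<And>u v. W u v = W v u"
  shows "coupling (model_of n W) {u, v} = W u v"
  using assms[of u v] by (cases u v rule: linorder_cases) (simp_all add: model_of_def min_def max_def)

lemma pair_coupling_model_of:
  assumes "\<And>u v. W u v = W v u" "\<And>u. W u u = 0" "u < n" "v < n"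
  shows "pair_coupling (model_of n W) u v = W u v"
  using assms(2) edges_model_of_iff[OF assms(1,3,4)] coupling_model_of[OF assms(1), where n = n and u = u and v = v]
  by (auto simp: pair_coupling_def)

lemma model_of_in_ising_minus:
  assumes "\<And>u v. W u v = W v u" "\<And>u v. W u v \<le> 0" "\<And>u v. \<bar>W u v\<bar> \<le> \<beta>"
  shows "model_of n W \<in> ising_minus n n \<beta> 0"
proof -
  have "max_degree_le (model_of n W) n"
    unfolding max_degree_le_def
  proof (intro allI impI)
    fix v
    have "{e \<in> edges (model_of n W). v \<in> e} \<subseteq> (\<lambda>u. {v, u}) ` {..<n}"
      by (auto simp: model_of_def)
    then have "card {e \<in> edges (model_of n W). v \<in> e} \<le> card {..<n}"
      by (meson card_image_le card_mono finite_imageI finite_lessThan order_trans)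
    then show "card {e \<in> edges (model_of n W). v \<in> e} \<le> n" by simp
  qed
  moreover have "coupling (model_of n W) e < 0 \<and> \<bar>coupling (model_of n W) e\<bar> \<le> \<beta>"
    if e: "e \<in> edges (model_of n W)" for e
  proof -
    obtain u v where "e = {u, v}" "W u v \<noteq> 0"
      using e by (auto simp: model_of_def)
    then show ?thesis
      using assms(2)[of u v] assms(3)[of u v] coupling_model_of[OF assms(1), where n = n and u = u and v = v] by simp
  qed
  ultimately show ?thesis
    by (simp add: ising_minus_def antiferromagnetic_def simple_graph_model_of)
qed

lemma weight_model_of:
  assumes "\<And>u v. W u v = W v u" "\<And>u. W u u = 0" "\<sigma> \<in> configs n"
  shows "weight (model_of n W) \<sigma> = exp (pair_energy n W \<sigma>)"
proof -
  have "weight (model_of n W) \<sigma> = exp (pair_energy n (pair_coupling (model_of n W)) \<sigma>)"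
    using weight_eq_exp_pair_energy[OF simple_graph_model_of, of n W \<sigma>] assms(3) by simp
  also have "pair_energy n (pair_coupling (model_of n W)) \<sigma> = pair_energy n W \<sigma>"
    unfolding pair_energy_def by (simp add: pair_coupling_model_of assms)
  finally show ?thesis .
qed

lemma card_configs: "card (configs n) = 2 ^ n"
  by (simp add: configs_def card_PiE numeral_2_eq_2)

section \<open>The block models\<close>

definition mono_pairs :: "nat set \<Rightarrow> nat set \<Rightarrow> (nat \<Rightarrow> nat) \<Rightarrow> real" where
  "mono_pairs X Y \<sigma> = (\<Sum>u\<in>X. \<Sum>v\<in>Y. of_bool (\<sigma> u = \<sigma> v))"

lemma mono_pairs_nonneg: "mono_pairs X Y \<sigma> \<ge> 0"
  unfolding mono_pairs_def by (intro sum_nonneg) simp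

lemma mono_pairs_commute: "mono_pairs X Y \<sigma> = mono_pairs Y X \<sigma>"
  unfolding mono_pairs_def by (subst sum.swap) (simp only: eq_commute)

lemma mono_pairs_ge_rows:
  assumes "finite X" "finite Y" "\<And>u. u \<in> X \<Longrightarrow> \<exists>v\<in>Y. \<sigma> u = \<sigma> v"
  shows "mono_pairs X Y \<sigma> \<ge> card X"
proof -
  have "1 \<le> (\<Sum>v\<in>Y. of_bool (\<sigma> u = \<sigma> v) :: real)" if u: "u \<in> X" for u
  proof -
    obtain v where v: "v \<in> Y" "\<sigma> u = \<sigma> v" using assms(3)[OF u] by blast
    have "of_bool (\<sigma> u = \<sigma> v) \<le> (\<Sum>v\<in>Y. of_bool (\<sigma> u = \<sigma> v) :: real)"
      using v assms(2) by (intro member_le_sum) auto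
    then show ?thesis using v by simp
  qed
  then have "(\<Sum>u\<in>X. 1) \<le> mono_pairs X Y \<sigma>"
    unfolding mono_pairs_def by (intro sum_mono)
  then show ?thesis by simp
qed

text \<open>The energy gap of a complete bipartite block pair. If \<open>X\<close> has one spin
  only, \<open>v\<close> agrees with all of \<open>X\<close>; if both spins occur in
  \<open>X\<close>, each vertex of \<open>Y\<close> agrees with some vertex of
  \<open>X\<close>.\<close>

lemma mono_pairs_ge:
  assumes "finite X" "finite Y" "card X = m" "card Y = m"
    and two: "\<And>u. u \<in> X \<union> Y \<Longrightarrow> \<sigma> u \<in> {1, 2}"
    and "u \<in> X" "v \<in> Y" "\<sigma> u = \<sigma> v"
  shows "mono_pairs X Y \<sigma> \<ge> m"
proof (cases "\<forall>w\<in>X. \<sigma> w = \<sigma> u")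
  case True
  then show ?thesis
    using mono_pairs_ge_rows[of X Y \<sigma>] assms by auto
next
  case False
  then obtain w where "w \<in> X" "\<sigma> w \<noteq> \<sigma> u" by blast
  moreover from this have "\<sigma> y = \<sigma> u \<or> \<sigma> y = \<sigma> w" if "y \<in> Y" for y
    using two[of y] two[of w] two[of u] that assms(6) by auto
  ultimately have "\<exists>x\<in>X. \<sigma> y = \<sigma> x" if "y \<in> Y" for y
    using that assms(6) by blast
  then show ?thesis
    using mono_pairs_ge_rows[of Y X \<sigma>] assms mono_pairs_commute[of X Y] by auto
qed

definition block :: "nat \<Rightarrow> nat \<Rightarrow> nat \<Rightarrow> nat set" where
  "block m N a = (if a < 4 then {a * m..<a * m + m} else {4 * m..<4 * m + N})"

definition block_of :: "nat \<Rightarrow> nat \<Rightarrow> nat" where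
  "block_of m u = (if u < 4 * m then u div m else 4)"

lemma finite_block [simp]: "finite (block m N a)"
  by (simp add: block_def)

lemma card_block: "a < 4 \<Longrightarrow> card (block m N a) = m"
  by (simp add: block_def)

lemma block_of_eq:
  assumes "u \<in> block m N a" "a < 5"
  shows "block_of m u = a"
proof (cases "a < 4")
  case True
  then have u: "a * m \<le> u" "u < a * m + m"
    using assms by (auto simp: block_def)
  then have "u div m = a"
    by (intro div_nat_eqI) (auto simp: mult.commute)
  moreover have "a * m + m \<le> 4 * m"
    using True mult_le_mono1[of "Suc a" 4 m] by simp
  then have "u < 4 * m" using u by linarith
  ultimately show ?thesis
    by (simp add: block_of_def)
qed (use assms in \<open>auto simp: block_def block_of_def\<close>)

lemma less_5: "{..<5::nat} = {0, 1, 2, 3, 4}"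
  by auto

lemma sum_blocks:
  fixes f :: "nat \<Rightarrow> 'a :: comm_monoid_add"
  shows "(\<Sum>u<4 * m + N. f u) = (\<Sum>a<5. \<Sum>u\<in>block m N a. f u)"
proof -
  have "(\<Sum>u<4 * m + N. f u) = sum f {0..<m} + sum f {m..<m + m} + sum f {2 * m..<3 * m}
      + sum f {3 * m..<4 * m} + sum f {4 * m..<4 * m + N}"
    by (simp add: sum.atLeastLessThan_concat mult_2[symmetric] flip: atLeast0LessThan)
  then show ?thesis
    by (simp add: less_5 block_def ac_simps)
qed

definition block_coupling :: "nat \<Rightarrow> (nat \<Rightarrow> nat \<Rightarrow> real) \<Rightarrow> (nat \<Rightarrow> nat \<Rightarrow> real) \<Rightarrow> nat \<Rightarrow> nat \<Rightarrow> real" where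
  "block_coupling m g J u v = (if 4 * m \<le> u \<and> 4 * m \<le> v then g (u - 4 * m) (v - 4 * m)
     else J (block_of m u) (block_of m v))"

text \<open>The coupling is a table part \<open>?f\<close>, switched off inside the last block, plus
  a graph part \<open>?h\<close> living only there. Because of \<open>J 4 4 = 0\<close> the table
  part may be summed over all pairs of blocks.\<close>

lemma pair_energy_block_coupling:
  assumes "J 4 4 = 0"
  shows "pair_energy (4 * m + N) (block_coupling m g J) \<sigma>
    = (\<Sum>a<5. \<Sum>b<5. J a b * mono_pairs (block m N a) (block m N b) \<sigma>) / 2
      + pair_energy N g (\<lambda>i. \<sigma> (4 * m + i))"
proof -
  let ?B = "block m N" and ?n = "4 * m + N"
  let ?h = "\<lambda>u v. (if 4 * m \<le> u \<and> 4 * m \<le> v then g (u - 4 * m) (v - 4 * m) else 0) * of_bool (\<sigma> u = \<sigma> v)"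
  let ?f = "\<lambda>u v. (if 4 * m \<le> u \<and> 4 * m \<le> v then 0 else J (block_of m u) (block_of m v)) * of_bool (\<sigma> u = \<sigma> v)"
  have eq: "block_coupling m g J u v * of_bool (\<sigma> u = \<sigma> v) = ?f u v + ?h u v" for u v
    by (simp add: block_coupling_def)
  have f: "?f u v = J a b * of_bool (\<sigma> u = \<sigma> v)" if "u \<in> ?B a" "v \<in> ?B b" "a < 5" "b < 5" for u v a b
    using that block_of_eq[OF that(1,3)] block_of_eq[OF that(2,4)] assms
    by (auto simp: block_of_def split: if_splits)
  have "(\<Sum>u<?n. \<Sum>v<?n. ?f u v) = (\<Sum>a<5. \<Sum>u\<in>?B a. \<Sum>b<5. \<Sum>v\<in>?B b. ?f u v)"
    by (simp only: sum_blocks)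
  also have "\<dots> = (\<Sum>a<5. \<Sum>u\<in>?B a. \<Sum>b<5. \<Sum>v\<in>?B b. J a b * of_bool (\<sigma> u = \<sigma> v))"
    by (intro sum.cong refl f) auto
  also have "\<dots> = (\<Sum>a<5. \<Sum>b<5. \<Sum>u\<in>?B a. \<Sum>v\<in>?B b. J a b * of_bool (\<sigma> u = \<sigma> v))"
    by (intro sum.cong refl sum.swap)
  also have "\<dots> = (\<Sum>a<5. \<Sum>b<5. J a b * mono_pairs (?B a) (?B b) \<sigma>)"
    unfolding mono_pairs_def sum_distrib_left ..
  finally have F: "(\<Sum>u<?n. \<Sum>v<?n. ?f u v) = (\<Sum>a<5. \<Sum>b<5. J a b * mono_pairs (?B a) (?B b) \<sigma>)" .
  have shift: "(\<Sum>u<?n. k u) = (\<Sum>i<N. k (4 * m + i))" if "\<And>u. u < 4 * m \<Longrightarrow> k u = 0" for k :: "nat \<Rightarrow> real"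
  proof -
    have "(\<Sum>u<?n. k u) = (\<Sum>u<4 * m. k u) + (\<Sum>u = 4 * m..<?n. k u)"
      by (simp add: sum.atLeastLessThan_concat flip: atLeast0LessThan)
    also have "(\<Sum>u = 4 * m..<?n. k u) = (\<Sum>i<N. k (4 * m + i))"
      using sum.shift_bounds_nat_ivl[of k 0 "4 * m" N] by (simp add: add.commute lessThan_atLeast0)
    finally show ?thesis using that by simp
  qed
  have "(\<Sum>u<?n. \<Sum>v<?n. ?h u v) = (\<Sum>i<N. \<Sum>v<?n. ?h (4 * m + i) v)"
    by (rule shift) simp
  also have "\<dots> = (\<Sum>i<N. \<Sum>j<N. ?h (4 * m + i) (4 * m + j))"
    by (intro sum.cong refl shift) simp
  finally have H: "(\<Sum>u<?n. \<Sum>v<?n. ?h u v) = 2 * pair_energy N g (\<lambda>i. \<sigma> (4 * m + i))"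
    by (simp add: pair_energy_def)
  show ?thesis
    unfolding pair_energy_def[of ?n] eq sum.distrib F H by (simp add: add_divide_distrib)
qed

text \<open>The blocks are numbered in the order \<open>S\<close>, \<open>T\<close>, \<open>A\<close>, \<open>B\<close>, \<open>V\<close>; the last one carries the given
  graph. In \<open>gadget_table\<close> the pairs \<open>S, T\<close> and \<open>A, B\<close> are locked in opposite states, and \<open>V\<close> is either
  pinned (if \<open>S\<close> and \<open>A\<close> agree) or free (if they disagree); the coupling \<open>\<omega>\<close> balances the two phases.\<close>

definition gadget_table :: "real \<Rightarrow> real \<Rightarrow> real \<Rightarrow> nat \<Rightarrow> nat \<Rightarrow> real" where
  "gadget_table \<beta> \<omega> \<kappa> a b =
    (if {a, b} \<in> {{0, 1}, {2, 3}} then - \<beta> else if {a, b} = {0, 2} then - \<omega>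
     else if {a, b} \<in> {{0, 4}, {2, 4}} then - \<kappa> else 0)"

text \<open>The complete bipartite graph with sides \<open>S\<close>, \<open>A\<close> and
  \<open>T\<close>, \<open>B\<close>, \<open>V\<close>. Its ground states are the two frozen
  configurations, which makes it the model that the samples imitate if \<open>Z\<close> is
  large.\<close>

definition bipartite_table :: "real \<Rightarrow> nat \<Rightarrow> nat \<Rightarrow> real" where
  "bipartite_table \<beta> a b = (if (a \<in> {0, 2}) \<noteq> (b \<in> {0, 2}) then - \<beta> else 0)"

lemma gadget_energy:
  "pair_energy (4 * m + N) (block_coupling m g (gadget_table \<beta> \<omega> \<kappa>)) \<sigma>
    = - \<beta> * (mono_pairs (block m N 0) (block m N 1) \<sigma> + mono_pairs (block m N 2) (block m N 3) \<sigma>)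
      - \<omega> * mono_pairs (block m N 0) (block m N 2) \<sigma>
      - \<kappa> * (mono_pairs (block m N 0) (block m N 4) \<sigma> + mono_pairs (block m N 2) (block m N 4) \<sigma>)
      + pair_energy N g (\<lambda>i. \<sigma> (4 * m + i))"
proof -
  have c: "mono_pairs (block m N b) (block m N a) \<sigma> = mono_pairs (block m N a) (block m N b) \<sigma>" if "a < b" for a b
    by (rule mono_pairs_commute)
  show ?thesis
    by (subst pair_energy_block_coupling)
      (simp_all add: gadget_table_def doubleton_eq_iff less_5 c field_simps)
qed

lemma bipartite_energy:
  "pair_energy (4 * m + N) (block_coupling m (\<lambda>_ _. 0) (bipartite_table \<beta>)) \<sigma>
    = - \<beta> * (mono_pairs (block m N 0) (block m N 1) \<sigma> + mono_pairs (block m N 0) (block m N 3) \<sigma>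
      + mono_pairs (block m N 0) (block m N 4) \<sigma> + mono_pairs (block m N 1) (block m N 2) \<sigma>
      + mono_pairs (block m N 2) (block m N 3) \<sigma> + mono_pairs (block m N 2) (block m N 4) \<sigma>)"
proof -
  have c: "mono_pairs (block m N b) (block m N a) \<sigma> = mono_pairs (block m N a) (block m N b) \<sigma>" if "a < b" for a b
    by (rule mono_pairs_commute)
  have "pair_energy N (\<lambda>_ _. 0) \<tau> = 0" for \<tau>
    by (simp add: pair_energy_def)
  then show ?thesis
    by (subst pair_energy_block_coupling)
      (simp_all add: bipartite_table_def less_5 c field_simps)
qed

text \<open>The value \<open>undefined\<close> outside the vertex range makes this a member of
  \<open>configs\<close>, which is an extensional function space.\<close>

definition conf :: "nat \<Rightarrow> nat \<Rightarrow> nat \<Rightarrow> nat \<Rightarrow> (nat \<Rightarrow> nat) \<Rightarrow> nat \<Rightarrow> nat" where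
  "conf m N c a \<tau> u = (if u < m then c else if u < 2 * m then 3 - c else if u < 3 * m then a
     else if u < 4 * m then 3 - a else if u < 4 * m + N then \<tau> (u - 4 * m) else undefined)"

definition special :: "nat \<Rightarrow> nat \<Rightarrow> nat \<Rightarrow> nat \<Rightarrow> nat" where
  "special m N c = conf m N c c (\<lambda>_. 3 - c)"

lemma conf_in_configs:
  assumes "c \<in> {1, 2}" "a \<in> {1, 2}" "\<And>i. i < N \<Longrightarrow> \<tau> i \<in> {1, 2}"
  shows "conf m N c a \<tau> \<in> configs (4 * m + N)"
proof -
  have "\<tau> (u - 4 * m) \<in> {1, 2}" if "\<not> u < 4 * m" "u < 4 * m + N" for u
    using that by (intro assms(3)) auto
  with assms(1,2) show ?thesis
    by (auto simp: configs_def PiE_iff conf_def extensional_def)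
qed

lemma conf_block:
  "u \<in> block m N 0 \<Longrightarrow> conf m N c a \<tau> u = c"
  "u \<in> block m N 1 \<Longrightarrow> conf m N c a \<tau> u = 3 - c"
  "u \<in> block m N 2 \<Longrightarrow> conf m N c a \<tau> u = a"
  "u \<in> block m N 3 \<Longrightarrow> conf m N c a \<tau> u = 3 - a"
  by (auto simp: block_def conf_def)

lemma mono_pairs_const:
  assumes "\<And>u. u \<in> X \<Longrightarrow> \<sigma> u = c" "\<And>v. v \<in> Y \<Longrightarrow> \<sigma> v = a"
  shows "mono_pairs X Y \<sigma> = (if c = a then real (card X) * real (card Y) else 0)"
  using assms by (simp add: mono_pairs_def)

lemma mono_pairs_last:
  assumes "\<And>u. u \<in> X \<Longrightarrow> \<sigma> u = c" "\<And>i. i < N \<Longrightarrow> \<sigma> (4 * m + i) = \<tau> i"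
  shows "mono_pairs X (block m N 4) \<sigma> = real (card X) * real (card {i. i < N \<and> \<tau> i = c})"
proof -
  have "(\<Sum>v\<in>block m N 4. of_bool (c = \<sigma> v) :: real) = (\<Sum>i<N. of_bool (c = \<sigma> (4 * m + i)))"
    using sum.shift_bounds_nat_ivl[of "\<lambda>v. of_bool (c = \<sigma> v) :: real" 0 "4 * m" N]
    by (simp add: block_def add.commute lessThan_atLeast0)
  also have "\<dots> = (\<Sum>i<N. of_bool (\<tau> i = c))"
    using assms(2) by (intro sum.cong) auto
  also have "\<dots> = real (card {i. i < N \<and> \<tau> i = c})"
    by (simp add: Int_def)
  finally show ?thesis
    using assms(1) by (simp add: mono_pairs_def)
qed

text \<open>The main configurations are given by a parametrisation \<open>f\<close>, which need not
  be injective: repetitions only enlarge the sum.\<close>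

lemma partition_function_le:
  assumes "finite P" "B \<ge> 0" "\<And>\<sigma>. \<sigma> \<in> configs (nverts M) \<Longrightarrow> \<sigma> \<notin> f ` P \<Longrightarrow> weight M \<sigma> \<le> B"
  shows "partition_function M \<le> (\<Sum>x\<in>P. weight M (f x)) + 2 ^ nverts M * B"
proof -
  let ?C = "configs (nverts M)"
  have nn: "weight M \<sigma> \<ge> 0" for \<sigma> by (simp add: weight_def)
  have "partition_function M \<le> (\<Sum>\<sigma>\<in>f ` P \<union> (?C - f ` P). weight M \<sigma>)"
    unfolding partition_function_def using assms(1) nn finite_configs by (intro sum_mono2) auto
  also have "\<dots> = (\<Sum>\<sigma>\<in>f ` P. weight M \<sigma>) + (\<Sum>\<sigma>\<in>?C - f ` P. weight M \<sigma>)"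
    using assms(1) finite_configs by (intro sum.union_disjoint) auto
  also have "(\<Sum>\<sigma>\<in>f ` P. weight M \<sigma>) \<le> (\<Sum>x\<in>P. weight M (f x))"
    using sum_image_le[of P "weight M" f] assms(1) nn by (simp add: o_def)
  also have "(\<Sum>\<sigma>\<in>?C - f ` P. weight M \<sigma>) \<le> (\<Sum>\<sigma>\<in>?C - f ` P. B)"
    using assms(3) by (intro sum_mono) auto
  also have "\<dots> = real (card (?C - f ` P)) * B"
    by simp
  also have "\<dots> \<le> real (card ?C) * B"
    using assms(2) by (intro mult_right_mono of_nat_mono card_mono finite_configs) auto
  finally show ?thesis by (simp add: card_configs)
qed

lemma configs_value: "\<sigma> \<in> configs n \<Longrightarrow> u < n \<Longrightarrow> \<sigma> u \<in> {1, 2}"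
  unfolding configs_def PiE_iff by blast

lemma less_of_block: "u \<in> block m N a \<Longrightarrow> u < 4 * m + N"
proof (cases "a < 4")
  case True
  assume "u \<in> block m N a"
  then have "u < a * m + m" using True by (simp add: block_def)
  also have "\<dots> \<le> 4 * m" using True mult_le_mono1[of "Suc a" 4 m] by simp
  finally show ?thesis by simp
qed (simp add: block_def)

text \<open>By \<open>mono_pairs_ge\<close> a count below \<open>m\<close> is zero. With only two
  spins available, nonempty blocks without an agreeing pair are constant and opposite.\<close>

lemma locked_blocks:
  assumes "\<sigma> \<in> configs (4 * m + N)" "m > 0" "a < 4" "b < 4"
    and less: "mono_pairs (block m N a) (block m N b) \<sigma> < m"
  shows "\<exists>c\<in>{1, 2}. (\<forall>u\<in>block m N a. \<sigma> u = c) \<and> (\<forall>u\<in>block m N b. \<sigma> u = 3 - c)"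
proof -
  have two: "\<sigma> u \<in> {1, 2}" if "u \<in> block m N a \<union> block m N b" for u
    using that configs_value[OF assms(1)] less_of_block by blast
  have ne: "\<sigma> u \<noteq> \<sigma> v" if "u \<in> block m N a" "v \<in> block m N b" for u v
    using mono_pairs_ge[of "block m N a" "block m N b" m \<sigma> u v] two that less assms(3,4)
    by (auto simp: card_block)
  have "block m N a \<noteq> {}" "block m N b \<noteq> {}"
    using assms(2-4) by (auto simp: block_def)
  then obtain x y where xy: "x \<in> block m N a" "y \<in> block m N b"
    by blast
  have "\<sigma> u = \<sigma> x" if "u \<in> block m N a" for u
    using two[of u] two[of x] two[of y] ne[OF that xy(2)] ne[OF xy] that xy by auto
  moreover have "\<sigma> u = 3 - \<sigma> x" if "u \<in> block m N b" for u
    using two[of u] two[of x] ne[OF xy(1) that] that xy by auto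
  ultimately show ?thesis
    using two[of x] xy(1) by blast
qed

lemma eq_conf_of_locked:
  assumes \<sigma>: "\<sigma> \<in> configs (4 * m + N)" and "m > 0"
    and "mono_pairs (block m N 0) (block m N 1) \<sigma> < m" "mono_pairs (block m N 2) (block m N 3) \<sigma> < m"
  shows "\<exists>c\<in>{1, 2}. \<exists>a\<in>{1, 2}. \<exists>\<tau>\<in>configs N. \<sigma> = conf m N c a \<tau>"
proof -
  have "\<exists>c\<in>{1, 2}. (\<forall>u\<in>block m N 0. \<sigma> u = c) \<and> (\<forall>u\<in>block m N 1. \<sigma> u = 3 - c)"
    by (rule locked_blocks[OF \<sigma> \<open>m > 0\<close> _ _ assms(3)]) simp_all
  then obtain c where c: "c \<in> {1, 2}" "\<forall>u\<in>block m N 0. \<sigma> u = c" "\<forall>u\<in>block m N 1. \<sigma> u = 3 - c"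
    by blast
  have "\<exists>c\<in>{1, 2}. (\<forall>u\<in>block m N 2. \<sigma> u = c) \<and> (\<forall>u\<in>block m N 3. \<sigma> u = 3 - c)"
    by (rule locked_blocks[OF \<sigma> \<open>m > 0\<close> _ _ assms(4)]) simp_all
  then obtain a where a: "a \<in> {1, 2}" "\<forall>u\<in>block m N 2. \<sigma> u = a" "\<forall>u\<in>block m N 3. \<sigma> u = 3 - a"
    by blast
  define \<tau> where "\<tau> = restrict (\<lambda>i. \<sigma> (4 * m + i)) {..<N}"
  have "\<tau> \<in> configs N"
    using configs_value[OF \<sigma>] by (auto simp: \<tau>_def configs_def)
  moreover have "\<sigma> u = conf m N c a \<tau> u" for u
  proof (cases "u < 4 * m + N")
    case True
    then consider "u < m" | "m \<le> u" "u < 2 * m" | "2 * m \<le> u" "u < 3 * m" | "3 * m \<le> u" "u < 4 * m"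
      | "4 * m \<le> u" "u < 4 * m + N" by linarith
    then show ?thesis
      using a c by cases (auto simp: conf_def block_def \<tau>_def)
  next
    case False
    then have "\<sigma> u = undefined"
      using \<sigma> unfolding configs_def by (intro PiE_arb[of \<sigma> "{..<4 * m + N}"]) auto
    with False show ?thesis by (simp add: conf_def)
  qed
  ultimately show ?thesis using a(1) c(1) by blast
qed

section \<open>The gadget, the bipartite comparison model and their partition functions\<close>

definition gadget :: "nat \<Rightarrow> nat \<Rightarrow> (nat \<Rightarrow> nat \<Rightarrow> real) \<Rightarrow> real \<Rightarrow> real \<Rightarrow> real \<Rightarrow> ising" where
  "gadget m N g \<beta> \<omega> \<kappa> = model_of (4 * m + N) (block_coupling m g (gadget_table \<beta> \<omega> \<kappa>))"

definition bipartite :: "nat \<Rightarrow> nat \<Rightarrow> real \<Rightarrow> ising" where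
  "bipartite m N \<beta> = model_of (4 * m + N) (block_coupling m (\<lambda>_ _. 0) (bipartite_table \<beta>))"

lemma block_coupling_sym:
  assumes "\<And>u v. g u v = g v u" "\<And>a b. J a b = J b a"
  shows "block_coupling m g J u v = block_coupling m g J v u"
  unfolding block_coupling_def
  by (simp only: conj_commute[of "4 * m \<le> u"] assms(1)[of "u - 4 * m"] assms(2)[of "block_of m u"])

lemma gadget_table_sym: "gadget_table \<beta> \<omega> \<kappa> a b = gadget_table \<beta> \<omega> \<kappa> b a"
  unfolding gadget_table_def by (simp only: insert_commute[of a])

lemma gadget_table_diag: "gadget_table \<beta> \<omega> \<kappa> a a = 0"
proof -
  have "{a} \<noteq> {x, y}" if "x \<noteq> y" for x y
    using that by (auto simp: doubleton_eq_iff)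
  then show ?thesis by (simp add: gadget_table_def)
qed

lemma bipartite_table_sym: "bipartite_table \<beta> a b = bipartite_table \<beta> b a"
  by (auto simp: bipartite_table_def)

lemma weight_gadget:
  assumes "\<And>u v. g u v = g v u" "\<And>u. g u u = 0" "\<sigma> \<in> configs (4 * m + N)"
  shows "weight (gadget m N g \<beta> \<omega> \<kappa>) \<sigma> = exp (pair_energy (4 * m + N) (block_coupling m g (gadget_table \<beta> \<omega> \<kappa>)) \<sigma>)"
  unfolding gadget_def
proof (rule weight_model_of[where W = "block_coupling m g (gadget_table \<beta> \<omega> \<kappa>)"])
  show "block_coupling m g (gadget_table \<beta> \<omega> \<kappa>) u v = block_coupling m g (gadget_table \<beta> \<omega> \<kappa>) v u" for u v
    by (rule block_coupling_sym[where g = g and J = "gadget_table \<beta> \<omega> \<kappa>", OF assms(1) gadget_table_sym])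
  show "block_coupling m g (gadget_table \<beta> \<omega> \<kappa>) u u = 0" for u
    by (simp add: block_coupling_def assms(2) gadget_table_diag)
qed (rule assms(3))

lemma weight_bipartite:
  assumes "\<sigma> \<in> configs (4 * m + N)"
  shows "weight (bipartite m N \<beta>) \<sigma>
    = exp (pair_energy (4 * m + N) (block_coupling m (\<lambda>_ _. 0) (bipartite_table \<beta>)) \<sigma>)"
  unfolding bipartite_def
proof (rule weight_model_of[where W = "block_coupling m (\<lambda>_ _. 0) (bipartite_table \<beta>)"])
  show "block_coupling m (\<lambda>_ _. 0) (bipartite_table \<beta>) u v = block_coupling m (\<lambda>_ _. 0) (bipartite_table \<beta>) v u" for u v
    by (rule block_coupling_sym[where g = "\<lambda>_ _. 0" and J = "bipartite_table \<beta>", OF refl bipartite_table_sym])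
  show "block_coupling m (\<lambda>_ _. 0) (bipartite_table \<beta>) u u = 0" for u
    by (simp add: block_coupling_def bipartite_table_def)
qed (rule assms)

lemma pair_energy_nonpos:
  assumes "\<And>u v. g u v \<le> 0"
  shows "pair_energy N g \<tau> \<le> 0"
proof -
  have "(\<Sum>u<N. \<Sum>v<N. g u v * of_bool (\<tau> u = \<tau> v)) \<le> 0"
    by (intro sum_nonpos mult_nonpos_nonneg assms) simp
  then show ?thesis by (simp only: pair_energy_def divide_le_0_iff) simp
qed

lemma pair_energy_ge:
  assumes "\<And>u v. g u v \<le> 0"
  shows "pair_energy N g \<tau> \<ge> (\<Sum>u<N. \<Sum>v<N. g u v) / 2"
  unfolding pair_energy_def
proof (intro divide_right_mono sum_mono)
  show "g u v \<le> g u v * of_bool (\<tau> u = \<tau> v)" for u v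
    using assms[of u v] by (cases "\<tau> u = \<tau> v") simp_all
qed simp

lemma pair_energy_const: "pair_energy N g (\<lambda>_. c) = (\<Sum>u<N. \<Sum>v<N. g u v) / 2"
  by (simp add: pair_energy_def)

lemma pair_energy_cong: "(\<And>i. i < N \<Longrightarrow> \<tau> i = \<tau>' i) \<Longrightarrow> pair_energy N g \<tau> = pair_energy N g \<tau>'"
  by (simp add: pair_energy_def)

text \<open>If \<open>S\<close> and \<open>A\<close> differ, every vertex of the graph agrees with
  exactly one of them, so their influence is a constant; if they agree, each graph vertex of spin
  \<open>c\<close> is penalised by both.\<close>

lemma gadget_energy_conf:
  assumes "c \<in> {1, 2}" "a \<in> {1, 2}" "\<And>i. i < N \<Longrightarrow> \<tau> i \<in> {1, 2}"
  shows "pair_energy (4 * m + N) (block_coupling m g (gadget_table \<beta> \<omega> \<kappa>)) (conf m N c a \<tau>)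
    = (if a = c then - \<omega> * (real m)\<^sup>2 - 2 * \<kappa> * real m * card {i. i < N \<and> \<tau> i = c}
       else - \<kappa> * real m * real N) + pair_energy N g \<tau>"
proof -
  let ?\<sigma> = "conf m N c a \<tau>"
  have \<tau>: "?\<sigma> (4 * m + i) = \<tau> i" if "i < N" for i
    using that by (simp add: conf_def)
  have e: "pair_energy N g (\<lambda>i. ?\<sigma> (4 * m + i)) = pair_energy N g \<tau>"
    by (rule pair_energy_cong) (rule \<tau>)
  have m: "mono_pairs (block m N 0) (block m N 1) ?\<sigma> = 0" "mono_pairs (block m N 2) (block m N 3) ?\<sigma> = 0"
    "mono_pairs (block m N 0) (block m N 2) ?\<sigma> = (if a = c then (real m)\<^sup>2 else 0)"
    "mono_pairs (block m N 0) (block m N 4) ?\<sigma> = real m * card {i. i < N \<and> \<tau> i = c}"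
    "mono_pairs (block m N 2) (block m N 4) ?\<sigma> = real m * card {i. i < N \<and> \<tau> i = a}"
    using mono_pairs_const[of "block m N 0" ?\<sigma> c "block m N 1" "3 - c", OF conf_block(1,2)]
      mono_pairs_const[of "block m N 2" ?\<sigma> a "block m N 3" "3 - a", OF conf_block(3,4)]
      mono_pairs_const[of "block m N 0" ?\<sigma> c "block m N 2" a, OF conf_block(1,3)]
      mono_pairs_last[of "block m N 0" ?\<sigma> c N m \<tau>, OF conf_block(1) \<tau>]
      mono_pairs_last[of "block m N 2" ?\<sigma> a N m \<tau>, OF conf_block(3) \<tau>] assms(1,2)
    by (auto simp: card_block power2_eq_square)
  have N: "card {i. i < N \<and> \<tau> i = c} + card {i. i < N \<and> \<tau> i = a} = N" if "a \<noteq> c"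
  proof -
    have "card {i. i < N \<and> \<tau> i = c} + card {i. i < N \<and> \<tau> i = a}
        = card ({i. i < N \<and> \<tau> i = c} \<union> {i. i < N \<and> \<tau> i = a})"
      using that by (subst card_Un_disjoint) auto
    also have "{i. i < N \<and> \<tau> i = c} \<union> {i. i < N \<and> \<tau> i = a} = {..<N}"
      using assms that by auto
    finally show ?thesis by simp
  qed
  have "real m * card {i. i < N \<and> \<tau> i = c} + real m * card {i. i < N \<and> \<tau> i = a} = real m * real N"
    if "a \<noteq> c"
    unfolding distrib_left[symmetric] of_nat_add[symmetric] N[OF that] by (rule refl)
  then show ?thesis
    unfolding gadget_energy e m by (cases "a = c") auto
qed

lemma weight_gadget_conf:
  assumes "\<And>u v. g u v = g v u" "\<And>u. g u u = 0" and ca: "c \<in> {1, 2}" "a \<in> {1, 2}" and \<tau>: "\<tau> \<in> configs N"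
  shows "weight (gadget m N g \<beta> \<omega> \<kappa>) (conf m N c a \<tau>)
    = exp ((if a = c then - \<omega> * (real m)\<^sup>2 - 2 * \<kappa> * real m * card {i. i < N \<and> \<tau> i = c}
       else - \<kappa> * real m * real N) + pair_energy N g \<tau>)"
proof -
  have "conf m N c a \<tau> \<in> configs (4 * m + N)"
    by (rule conf_in_configs[OF ca configs_value[OF \<tau>]])
  then have 1: "weight (gadget m N g \<beta> \<omega> \<kappa>) (conf m N c a \<tau>)
      = exp (pair_energy (4 * m + N) (block_coupling m g (gadget_table \<beta> \<omega> \<kappa>)) (conf m N c a \<tau>))"
    by (intro weight_gadget assms)
  show ?thesis
    unfolding 1 by (rule arg_cong[where f = exp], rule gadget_energy_conf[OF ca]) (rule configs_value[OF \<tau>])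
qed

lemma special_in_configs: "c \<in> {1, 2} \<Longrightarrow> special m N c \<in> configs (4 * m + N)"
  unfolding special_def by (rule conf_in_configs) auto

lemma special_ne:
  assumes "m > 0"
  shows "special m N 1 \<noteq> special m N 2"
proof
  assume "special m N 1 = special m N 2"
  then have "special m N 1 0 = special m N 2 0" by (rule fun_cong)
  with assms show False by (simp add: special_def conf_def)
qed

text \<open>Four of the six block pairs already force a frozen configuration: the pairs
  \<open>0 1\<close> and \<open>2 3\<close> lock, \<open>1 2\<close> aligns \<open>A\<close> with
  \<open>S\<close>, and \<open>0 4\<close> pins the graph. Any failure yields \<open>m\<close>
  monochromatic pairs.\<close>

lemma bipartite_special:
  assumes "\<sigma> \<in> configs (4 * m + N)" "m > 0" "\<beta> \<ge> 0" "\<sigma> \<notin> special m N ` {1, 2}"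
  shows "weight (bipartite m N \<beta>) \<sigma> \<le> exp (- \<beta> * m)"
proof -
  let ?p = "\<lambda>a b. mono_pairs (block m N a) (block m N b) \<sigma>"
  have nn: "?p a b \<ge> 0" for a b by (rule mono_pairs_nonneg)
  have "\<exists>(a, b)\<in>{(0, 1), (2, 3), (1, 2), (0, 4)}. ?p a b \<ge> m"
  proof (rule ccontr)
    assume "\<not> ?thesis"
    then have less: "?p 0 1 < m" "?p 2 3 < m" "?p 1 2 < m" "?p 0 4 < m" by auto
    then obtain c a \<tau> where c: "c \<in> {1, 2}" "a \<in> {1, 2}" and \<tau>: "\<tau> \<in> configs N" and \<sigma>: "\<sigma> = conf m N c a \<tau>"
      using eq_conf_of_locked[OF assms(1,2)] by blast
    have "?p 1 2 = (if 3 - c = a then real m * real m else 0)"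
      using mono_pairs_const[of "block m N 1" \<sigma> "3 - c" "block m N 2" a] conf_block[of _ m N c a \<tau>]
      by (simp add: \<sigma> card_block)
    moreover have "real m * real m \<ge> real m"
      using assms(2) by (simp flip: of_nat_mult)
    ultimately have ac: "a = c"
      using less(3) c by (auto split: if_splits)
    have "?p 0 4 = real m * real (card {i. i < N \<and> \<tau> i = c})"
      using mono_pairs_last[of "block m N 0" \<sigma> c N m \<tau>] conf_block(1)[of _ m N c a \<tau>]
      by (simp add: \<sigma> card_block conf_def)
    with less(4) assms(2) have "card {i. i < N \<and> \<tau> i = c} = 0"
      by (cases "card {i. i < N \<and> \<tau> i = c}") (auto simp: algebra_simps not_less simp flip: of_nat_mult of_nat_add)
    then have "\<tau> i \<noteq> c" if "i < N" for i using that by auto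
    then have "\<tau> i = 3 - c" if "i < N" for i
      using that c(1) configs_value[OF \<tau>, of i] by fastforce
    then have "\<sigma> = special m N c"
      by (auto simp: \<sigma> special_def ac conf_def fun_eq_iff)
    with assms(4) c(1) show False by blast
  qed
  then have "\<beta> * m \<le> \<beta> * (?p 0 1 + ?p 0 3 + ?p 0 4 + ?p 1 2 + ?p 2 3 + ?p 2 4)"
    using nn[of 0 1] nn[of 0 3] nn[of 0 4] nn[of 1 2] nn[of 2 3] nn[of 2 4] assms(3)
    by (intro mult_left_mono) auto
  then show ?thesis
    unfolding weight_bipartite[OF assms(1)] bipartite_energy by simp
qed

lemma weight_bipartite_special:
  assumes "c \<in> {1, 2}"
  shows "weight (bipartite m N \<beta>) (special m N c) = 1"
proof -
  let ?\<sigma> = "special m N c"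
  have b: "u \<in> block m N 4 \<Longrightarrow> ?\<sigma> u = 3 - c" for u
    by (auto simp: special_def conf_def block_def)
  have s: "?\<sigma> u = c" if "u \<in> block m N 0 \<union> block m N 2" for u
    using that conf_block(1,3)[of u m N c c] by (auto simp: special_def)
  have t: "?\<sigma> u = 3 - c" if "u \<in> block m N 1 \<union> block m N 3 \<union> block m N 4" for u
    using that conf_block(2,4)[of u m N c c] b by (auto simp: special_def)
  have z: "mono_pairs (block m N x) (block m N y) ?\<sigma> = 0" if "x \<in> {0, 2}" "y \<in> {1, 3, 4}" for x y
    using mono_pairs_const[of "block m N x" ?\<sigma> c "block m N y" "3 - c"] s t that assms by auto
  have z': "mono_pairs (block m N 1) (block m N 2) ?\<sigma> = 0"
    using z[of 2 1] mono_pairs_commute[of "block m N 1"] by simp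
  show ?thesis
    unfolding weight_bipartite[OF special_in_configs[OF assms]] bipartite_energy
    by (simp add: z z' del: One_nat_def)
qed

lemma partition_function_bipartite_le:
  assumes "m > 0" "\<beta> \<ge> 0"
  shows "partition_function (bipartite m N \<beta>) \<le> 2 + 2 ^ (4 * m + N) * exp (- \<beta> * m)"
proof -
  have "partition_function (bipartite m N \<beta>)
      \<le> (\<Sum>c\<in>{1, 2}. weight (bipartite m N \<beta>) (special m N c)) + 2 ^ nverts (bipartite m N \<beta>) * exp (- \<beta> * m)"
    using bipartite_special[OF _ assms] by (intro partition_function_le) (auto simp: bipartite_def)
  then show ?thesis
    using weight_bipartite_special[of 1] weight_bipartite_special[of 2] by (simp add: bipartite_def)
qed

lemma gadget_bad:
  assumes "\<And>u v. g u v = g v u" "\<And>u. g u u = 0" "\<And>u v. g u v \<le> 0"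
    and "\<sigma> \<in> configs (4 * m + N)" "m > 0" "\<beta> \<ge> 0" "\<omega> \<ge> 0" "\<kappa> \<ge> 0"
    and "\<sigma> \<notin> (\<lambda>(c, a, \<tau>). conf m N c a \<tau>) ` ({1, 2} \<times> {1, 2} \<times> configs N)"
  shows "weight (gadget m N g \<beta> \<omega> \<kappa>) \<sigma> \<le> exp (- \<beta> * m)"
proof -
  let ?p = "\<lambda>a b. mono_pairs (block m N a) (block m N b) \<sigma>"
  have nn: "?p a b \<ge> 0" for a b by (rule mono_pairs_nonneg)
  have "?p 0 1 \<ge> m \<or> ?p 2 3 \<ge> m"
  proof (rule ccontr)
    assume "\<not> ?thesis"
    then have "?p 0 1 < m" "?p 2 3 < m" by (simp_all only: de_Morgan_disj not_le)
    then obtain c a \<tau> where "c \<in> {1, 2}" "a \<in> {1, 2}" "\<tau> \<in> configs N" "\<sigma> = conf m N c a \<tau>"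
      using eq_conf_of_locked[OF assms(4,5)] by blast
    then have "\<sigma> \<in> (\<lambda>(c, a, \<tau>). conf m N c a \<tau>) ` ({1, 2} \<times> {1, 2} \<times> configs N)"
      by (intro image_eqI[of _ _ "(c, a, \<tau>)"]) simp_all
    with assms(9) show False by blast
  qed
  then have "\<beta> * m \<le> \<beta> * (?p 0 1 + ?p 2 3)"
    using nn[of 0 1] nn[of 2 3] assms(6) by (intro mult_left_mono) auto
  moreover have "\<omega> * ?p 0 2 \<ge> 0" "\<kappa> * (?p 0 4 + ?p 2 4) \<ge> 0"
    using nn assms(7,8) by simp_all
  moreover have "pair_energy N g (\<lambda>i. \<sigma> (4 * m + i)) \<le> 0"
    using assms(3) by (rule pair_energy_nonpos)
  ultimately show ?thesis
    unfolding weight_gadget[where g = g, OF assms(1,2,4)] gadget_energy by simp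
qed

lemma weight_gadget_special:
  assumes "\<And>u v. g u v = g v u" "\<And>u. g u u = 0" "c \<in> {1, 2}"
  shows "weight (gadget m N g \<beta> \<omega> \<kappa>) (special m N c) = exp (- \<omega> * (real m)\<^sup>2 + (\<Sum>u<N. \<Sum>v<N. g u v) / 2)"
proof -
  have "{i. i < N \<and> 3 - c = c} = {}"
    using assms(3) by auto
  then show ?thesis
    unfolding weight_gadget[where g = g, OF assms(1,2) special_in_configs[OF assms(3)]]
    unfolding special_def using assms(3) by (subst gadget_energy_conf) (auto simp: pair_energy_const)
qed

lemma partition_function_gadget_le:
  assumes g: "\<And>u v. g u v = g v u" "\<And>u. g u u = 0" "\<And>u v. g u v \<le> 0"
    and pos: "m > 0" "\<beta> \<ge> 0" "\<omega> \<ge> 0" "\<kappa> \<ge> 0"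
  shows "partition_function (gadget m N g \<beta> \<omega> \<kappa>)
    \<le> 2 * exp (- \<omega> * (real m)\<^sup>2) * (exp ((\<Sum>u<N. \<Sum>v<N. g u v) / 2) + 2 ^ N * exp (- 2 * \<kappa> * m))
      + 2 * exp (- \<kappa> * m * N) * (\<Sum>\<tau>\<in>configs N. exp (pair_energy N g \<tau>))
      + 2 ^ (4 * m + N) * exp (- \<beta> * m)"
proof -
  let ?M = "gadget m N g \<beta> \<omega> \<kappa>" and ?E = "\<lambda>\<tau>. exp (pair_energy N g \<tau>)"
  let ?h = "exp ((\<Sum>u<N. \<Sum>v<N. g u v) / 2)"
  have w: "weight ?M (conf m N c a \<tau>)
      = exp ((if a = c then - \<omega> * (real m)\<^sup>2 - 2 * \<kappa> * real m * card {i. i < N \<and> \<tau> i = c}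
       else - \<kappa> * real m * real N) + pair_energy N g \<tau>)"
    if "c \<in> {1, 2}" "a \<in> {1, 2}" "\<tau> \<in> configs N" for c a \<tau>
    by (rule weight_gadget_conf[where g = g]) (rule g that)+
  have aligned: "(\<Sum>\<tau>\<in>configs N. weight ?M (conf m N c c \<tau>))
      \<le> exp (- \<omega> * (real m)\<^sup>2) * (?h + 2 ^ N * exp (- 2 * \<kappa> * m))" if c: "c \<in> {1, 2}" for c
  proof -
    \<comment> \<open>Only this configuration avoids the penalty; any other has a vertex of spin
      \<open>c\<close> and pays at least \<open>2 * \<kappa> * m\<close>.\<close>
    let ?\<tau> = "restrict (\<lambda>_. 3 - c) {..<N}"
    have \<tau>: "?\<tau> \<in> configs N" using c by (auto simp: configs_def)
    have empty: "{i. i < N \<and> ?\<tau> i = c} = {}" using c by auto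
    have "pair_energy N g ?\<tau> = (\<Sum>u<N. \<Sum>v<N. g u v) / 2"
      by (subst pair_energy_cong[of N ?\<tau> "\<lambda>_. 3 - c"]) (simp_all add: pair_energy_const)
    then have "weight ?M (conf m N c c ?\<tau>) = exp (- \<omega> * (real m)\<^sup>2) * ?h"
      unfolding w[OF c c \<tau>] empty by (simp only: exp_add[symmetric]) simp
    moreover have "weight ?M (conf m N c c \<tau>) \<le> exp (- \<omega> * (real m)\<^sup>2) * exp (- 2 * \<kappa> * m)"
      if \<tau>: "\<tau> \<in> configs N - {?\<tau>}" for \<tau>
    proof -
      have "\<exists>i<N. \<tau> i = c"
      proof (rule ccontr)
        assume *: "\<not> ?thesis"
        have "\<tau> = ?\<tau>"
        proof
          fix i
          show "\<tau> i = ?\<tau> i"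
          proof (cases "i < N")
            case True
            then have "\<tau> i \<in> {1, 2}" "\<tau> i \<noteq> c"
              using * \<tau> configs_value[of \<tau> N i] by blast+
            then show ?thesis using True c by auto
          next
            case False
            have "\<tau> \<in> {..<N} \<rightarrow>\<^sub>E {1, 2}" using \<tau> unfolding configs_def by blast
            from PiE_arb[OF this, of i] False show ?thesis by simp
          qed
        qed
        with \<tau> show False by blast
      qed
      then have "card {i. i < N \<and> \<tau> i = c} \<noteq> 0" by auto
      then have "1 \<le> card {i. i < N \<and> \<tau> i = c}" by linarith
      then have "1 \<le> real (card {i. i < N \<and> \<tau> i = c})" by linarith
      then have "2 * \<kappa> * m * 1 \<le> 2 * \<kappa> * m * real (card {i. i < N \<and> \<tau> i = c})"
        using pos by (intro mult_left_mono) simp_all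
      moreover have "\<tau> \<in> configs N" using \<tau> by blast
      from w[OF c c this] have "weight ?M (conf m N c c \<tau>)
          = exp (- \<omega> * (real m)\<^sup>2 - 2 * \<kappa> * m * real (card {i. i < N \<and> \<tau> i = c}) + pair_energy N g \<tau>)"
        by (simp only: if_True simp_thms)
      ultimately show ?thesis
        using pair_energy_nonpos[where g = g, OF g(3), of N \<tau>]
        by (simp only: exp_add[symmetric] exp_le_cancel_iff)
    qed
    then have "(\<Sum>\<tau>\<in>configs N - {?\<tau>}. weight ?M (conf m N c c \<tau>))
        \<le> (\<Sum>\<tau>\<in>configs N - {?\<tau>}. exp (- \<omega> * (real m)\<^sup>2) * exp (- 2 * \<kappa> * m))"
      by (rule sum_mono)
    moreover have "\<dots> \<le> 2 ^ N * (exp (- \<omega> * (real m)\<^sup>2) * exp (- 2 * \<kappa> * m))"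
    proof -
      have "card (configs N - {?\<tau>}) \<le> 2 ^ N"
        using card_mono[OF finite_configs, of "configs N - {?\<tau>}" N] by (auto simp: card_configs)
      then have "real (card (configs N - {?\<tau>})) \<le> real (2 ^ N)"
        by (simp only: of_nat_le_iff)
      then show ?thesis
        by (simp add: mult_right_mono)
    qed
    moreover have "(\<Sum>\<tau>\<in>configs N. weight ?M (conf m N c c \<tau>))
        = weight ?M (conf m N c c ?\<tau>) + (\<Sum>\<tau>\<in>configs N - {?\<tau>}. weight ?M (conf m N c c \<tau>))"
      by (rule sum.remove[OF finite_configs \<tau>])
    moreover have "exp (- \<omega> * (real m)\<^sup>2) * (?h + 2 ^ N * exp (- 2 * \<kappa> * m))
        = exp (- \<omega> * (real m)\<^sup>2) * ?h + 2 ^ N * (exp (- \<omega> * (real m)\<^sup>2) * exp (- 2 * \<kappa> * m))"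
      by (simp only: distrib_left mult.left_commute)
    ultimately show ?thesis by linarith
  qed
  have anti: "(\<Sum>\<tau>\<in>configs N. weight ?M (conf m N c a \<tau>)) = exp (- \<kappa> * m * N) * (\<Sum>\<tau>\<in>configs N. ?E \<tau>)"
    if "c \<in> {1, 2}" "a \<in> {1, 2}" "a \<noteq> c" for c a
    unfolding sum_distrib_left
  proof (rule sum.cong[OF refl])
    fix \<tau> assume "\<tau> \<in> configs N"
    then show "weight ?M (conf m N c a \<tau>) = exp (- \<kappa> * m * N) * ?E \<tau>"
      using that by (simp only: w if_False exp_add)
  qed
  let ?P = "{1, 2} \<times> {1, 2} \<times> configs N"
  have "partition_function ?M
      \<le> (\<Sum>x\<in>?P. weight ?M ((\<lambda>(c, a, \<tau>). conf m N c a \<tau>) x)) + 2 ^ nverts ?M * exp (- \<beta> * m)"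
  proof (rule partition_function_le)
    fix \<sigma> assume "\<sigma> \<in> configs (nverts ?M)" "\<sigma> \<notin> (\<lambda>(c, a, \<tau>). conf m N c a \<tau>) ` ?P"
    then show "weight ?M \<sigma> \<le> exp (- \<beta> * m)"
      by (intro gadget_bad[where g = g, OF g _ pos]) (simp_all only: gadget_def nverts_model_of not_False_eq_True)
  qed (simp_all add: finite_configs)
  also have "nverts ?M = 4 * m + N"
    by (simp add: gadget_def)
  also have "(\<Sum>x\<in>?P. weight ?M ((\<lambda>(c, a, \<tau>). conf m N c a \<tau>) x))
      = (\<Sum>c\<in>{1, 2}. \<Sum>a\<in>{1, 2}. \<Sum>\<tau>\<in>configs N. weight ?M (conf m N c a \<tau>))"
    by (simp only: sum.cartesian_product' prod.case)
  also have "\<dots> \<le> 2 * exp (- \<omega> * (real m)\<^sup>2) * (?h + 2 ^ N * exp (- 2 * \<kappa> * m))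
      + 2 * exp (- \<kappa> * m * N) * (\<Sum>\<tau>\<in>configs N. ?E \<tau>)"
    using aligned[of 1] aligned[of 2] anti[of 1 2] anti[of 2 1] by simp
  finally show ?thesis by simp
qed

text \<open>Keeps only one of the two sectors of the free phase, \<open>S\<close> with spin 1 and
  \<open>A\<close> with spin 2; the factor lost is a constant.\<close>

lemma partition_function_gadget_ge:
  assumes g: "\<And>u v. g u v = g v u" "\<And>u. g u u = 0"
  shows "exp (- \<kappa> * m * N) * (\<Sum>\<tau>\<in>configs N. exp (pair_energy N g \<tau>))
    \<le> partition_function (gadget m N g \<beta> \<omega> \<kappa>)"
proof -
  let ?M = "gadget m N g \<beta> \<omega> \<kappa>"
  have inj: "inj_on (conf m N 1 2) (configs N)"
  proof (rule inj_onI)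
    fix \<tau> \<tau>' assume \<tau>: "\<tau> \<in> configs N" "\<tau>' \<in> configs N" "conf m N 1 2 \<tau> = conf m N 1 2 \<tau>'"
    show "\<tau> = \<tau>'"
    proof (rule PiE_ext)
      show "\<tau> \<in> {..<N} \<rightarrow>\<^sub>E {1, 2}" "\<tau>' \<in> {..<N} \<rightarrow>\<^sub>E {1, 2}"
        using \<tau> by (auto simp: configs_def)
      show "\<tau> i = \<tau>' i" if "i \<in> {..<N}" for i
        using fun_cong[OF \<tau>(3), of "4 * m + i"] that by (simp add: conf_def)
    qed
  qed
  have "exp (- \<kappa> * m * N) * (\<Sum>\<tau>\<in>configs N. exp (pair_energy N g \<tau>))
      = (\<Sum>\<tau>\<in>configs N. weight ?M (conf m N 1 2 \<tau>))"
    unfolding sum_distrib_left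
  proof (rule sum.cong[OF refl])
    fix \<tau> assume "\<tau> \<in> configs N"
    then show "exp (- \<kappa> * m * N) * exp (pair_energy N g \<tau>) = weight ?M (conf m N 1 2 \<tau>)"
      by (subst weight_gadget_conf[where g = g, OF g]) (simp_all flip: exp_add)
  qed
  also have "\<dots> = (\<Sum>\<sigma>\<in>conf m N 1 2 ` configs N. weight ?M \<sigma>)"
    by (rule sum.reindex[OF inj, unfolded o_def, symmetric])
  also have "\<dots> \<le> partition_function ?M"
    unfolding partition_function_def
    using conf_in_configs[of 1 2 N _ m] configs_value
    by (intro sum_mono2) (auto simp: finite_configs gadget_def weight_def simp del: insert_iff)
  finally show ?thesis .
qed

section \<open>Gibbs measures of the block models\<close>

definition coin_source :: "val \<Rightarrow> val \<Rightarrow> nat \<Rightarrow> source" where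
  "coin_source v w d = map_spmf (\<lambda>b. (if b then v else w, d)) coin_spmf"

text \<open>The source has mass 1/2 at two points, where the hypotheses give the Gibbs measure mass
  at least \<open>1 / (2 * \<rho>)\<close>. The rest of the Gibbs measure is dropped, as
  \<open>g\<close> is nonnegative.\<close>

lemma coin_source_dominated:
  assumes "\<sigma> \<noteq> \<sigma>'" "1 \<le> 2 * \<rho> * pmf (gibbs M) \<sigma>" "1 \<le> 2 * \<rho> * pmf (gibbs M) \<sigma>'" "\<rho> \<ge> 0"
  shows "(\<integral>\<^sup>+ x. g x \<partial>measure_spmf (coin_source (enc_config (nverts M) \<sigma>) (enc_config (nverts M) \<sigma>') d))
    \<le> ennreal \<rho> * (\<integral>\<^sup>+ (v, t). g (v, t + d) \<partial>measure_spmf (sample_access M))"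
proof -
  let ?e = "enc_config (nverts M)"
  let ?f = "\<lambda>\<tau>. g (?e \<tau>, d)"
  have half: "inverse 2 \<le> ennreal \<rho> * ennreal (pmf (gibbs M) \<tau>)" if "1 \<le> 2 * \<rho> * pmf (gibbs M) \<tau>" for \<tau>
  proof -
    have "ennreal (1 / 2) \<le> ennreal (\<rho> * pmf (gibbs M) \<tau>)"
      using that by (intro ennreal_leI) simp
    then show ?thesis
      using assms(4) by (simp add: ennreal_mult)
  qed
  have "(\<integral>\<^sup>+ x. g x \<partial>measure_spmf (coin_source (?e \<sigma>) (?e \<sigma>') d)) = (?f \<sigma> + ?f \<sigma>') / 2"
    by (simp add: coin_source_def nn_integral_spmf_of_set UNIV_bool add.commute)
  also have "\<dots> = inverse 2 * ?f \<sigma> + inverse 2 * ?f \<sigma>'"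
    by (simp add: divide_ennreal_def distrib_left mult.commute)
  also have "\<dots> \<le> ennreal \<rho> * ennreal (pmf (gibbs M) \<sigma>) * ?f \<sigma> + ennreal \<rho> * ennreal (pmf (gibbs M) \<sigma>') * ?f \<sigma>'"
    by (intro add_mono mult_right_mono half assms) simp_all
  also have "\<dots> = ennreal \<rho> * (\<Sum>\<tau>\<in>{\<sigma>, \<sigma>'}. ?f \<tau> * ennreal (pmf (gibbs M) \<tau>))"
    using assms(1) by (simp add: distrib_left ac_simps)
  also have "(\<Sum>\<tau>\<in>{\<sigma>, \<sigma>'}. ?f \<tau> * ennreal (pmf (gibbs M) \<tau>))
      = (\<integral>\<^sup>+ \<tau>. ?f \<tau> * indicator {\<sigma>, \<sigma>'} \<tau> \<partial>measure_pmf (gibbs M))"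
    by (subst nn_integral_measure_pmf_support[of "{\<sigma>, \<sigma>'}"]) (auto intro!: sum.cong)
  also have "\<dots> \<le> (\<integral>\<^sup>+ \<tau>. ?f \<tau> \<partial>measure_pmf (gibbs M))"
    by (intro nn_integral_mono) (auto split: split_indicator)
  also have "\<dots> = (\<integral>\<^sup>+ (v, t). g (v, t + d) \<partial>measure_spmf (sample_access M))"
    by (simp add: sample_access_def)
  finally show ?thesis
    by (simp add: mult_left_mono)
qed

text \<open>\<open>M'\<close> is a fictitious hidden model. Domination only bounds probabilities
  from above, so it is applied to the event of a wrong answer, which also covers outputs other than
  0 and 1.\<close>

lemma tester_on_coin_source:
  fixes d :: nat
  assumes tester: "identity_tester \<M> \<epsilon> ps pt A" and M: "M \<in> \<M> n" "rational_model M" and M': "M' \<in> \<M> n"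
    and n: "nverts M' = n"
    and \<sigma>: "\<sigma> \<noteq> \<sigma>'" "1 \<le> 2 * \<rho> * pmf (gibbs M') \<sigma>" "1 \<le> 2 * \<rho> * pmf (gibbs M') \<sigma>'"
    and \<rho>: "\<rho> \<ge> 1" "\<rho> ^ poly ps n \<le> 3 / 2"
  defines "res \<equiv> run (coin_source (enc_config n \<sigma>) (enc_config n \<sigma>') d) no_subroutine A (enc_model M)"
  shows "lossless_spmf res"
    and "\<forall>(v, t, k)\<in>set_spmf res. t \<le> poly pt (vsize (enc_model M)) + d * poly ps n"
    and "gibbs M = gibbs M' \<Longrightarrow> prob_accept res \<ge> 5 / 8"
    and "tv_dist (gibbs M) (gibbs M') \<ge> 1 - \<epsilon> \<Longrightarrow> prob_reject res \<ge> 5 / 8"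
proof -
  let ?res = "run (sample_access M') no_subroutine A (enc_model M)"
  have l: "lossless_spmf ?res"
    and b: "\<forall>(v, t, k)\<in>set_spmf ?res. t \<le> poly pt (vsize (enc_model M)) \<and> k \<le> poly ps n"
    and acc: "gibbs M = gibbs M' \<Longrightarrow> prob_accept ?res \<ge> 3 / 4"
    and rej: "tv_dist (gibbs M) (gibbs M') \<ge> 1 - \<epsilon> \<Longrightarrow> prob_reject ?res \<ge> 3 / 4"
    using tester M M' unfolding identity_tester_def Let_def by blast+
  have "\<rho> > 0" "\<rho> \<ge> 0" using \<rho>(1) by simp_all
  have lc: "lossless_spmf (coin_source (enc_config n \<sigma>) (enc_config n \<sigma>') d)"
    by (simp add: coin_source_def)
  note D = run_dominated[OF \<open>\<rho> > 0\<close> lc coin_source_dominated[OF \<sigma> \<open>\<rho> \<ge> 0\<close>, unfolded n] l b \<rho>(1), folded res_def]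
  show l': "lossless_spmf res" by (rule D(1))
  show "\<forall>(v, t, k)\<in>set_spmf res. t \<le> poly pt (vsize (enc_model M)) + d * poly ps n" by (rule D(2))
  have "measure (measure_spmf res) {(v, t, k). v = a} \<ge> 5 / 8"
    if "measure (measure_spmf ?res) {(v, t, k). v = a} \<ge> 3 / 4" for a
  proof -
    have compl: "measure (measure_spmf p) {(v, t, k). v \<in> - {a}} = 1 - measure (measure_spmf p) {(v, t, k). v = a}"
      if "lossless_spmf p" for p :: "(val \<times> nat \<times> nat) spmf"
    proof -
      have "{(v, t, k). v \<in> - {a}} = space (measure_spmf p) - {(v :: val, t :: nat, k :: nat). v = a}"
        by (auto simp: space_measure_spmf)
      then show ?thesis
        using that measure_spmf.finite_measure_compl[of "{(v, t, k). v = a}" p]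
        by (simp add: lossless_spmf_def weight_spmf_def)
    qed
    have "1 - measure (measure_spmf res) {(v, t, k). v = a}
        \<le> \<rho> ^ poly ps n * (1 - measure (measure_spmf ?res) {(v, t, k). v = a})"
      using D(3)[of "- {a}"] unfolding compl[OF l] compl[OF l'] .
    also have "\<dots> \<le> 3 / 2 * (1 / 4)"
      using that \<rho> by (intro mult_mono) (auto simp: measure_spmf.subprob_measure_le_1)
    finally show ?thesis by simp
  qed
  then show "gibbs M = gibbs M' \<Longrightarrow> prob_accept res \<ge> 5 / 8"
    "tv_dist (gibbs M) (gibbs M') \<ge> 1 - \<epsilon> \<Longrightarrow> prob_reject res \<ge> 5 / 8"
    using acc rej unfolding prob_accept_def prob_reject_def by blast+
qed

section \<open>Total variation and numerical estimates\<close>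

lemma tv_dist_ge:
  "\<bar>measure_pmf.prob p A - measure_pmf.prob q A\<bar> \<le> tv_dist p q"
  unfolding tv_dist_def
proof (rule cSUP_upper)
  show "bdd_above (range (\<lambda>A. \<bar>measure_pmf.prob p A - measure_pmf.prob q A\<bar>))"
  proof (rule bdd_aboveI2)
    show "\<bar>measure_pmf.prob p A - measure_pmf.prob q A\<bar> \<le> 1" for A
      using measure_pmf.prob_le_1[of p A] measure_pmf.prob_le_1[of q A]
        measure_nonneg[of "measure_pmf p" A] measure_nonneg[of "measure_pmf q" A] by linarith
  qed
qed simp

text \<open>The allowance 3/10 is what \<open>tester_answers\<close> spends in the low case: 2/10 on
  the \<open>exp (- y)\<close> term and 1/10 on \<open>243 / r\<close>.\<close>

lemma one_plus_power_le:
  fixes x :: real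
  assumes "x \<ge> 0" "real K * x \<le> 3 / 10"
  shows "(1 + x) ^ K \<le> 3 / 2"
proof -
  have "(1 + x) ^ K \<le> exp x ^ K"
    using assms(1) exp_ge_add_one_self[of x] by (intro power_mono) auto
  also have "\<dots> = exp (real K * x)"
    by (simp add: exp_of_nat_mult)
  also have "\<dots> \<le> exp (3 / 10)"
    using assms(2) by simp
  also have "\<dots> \<le> 1 + 3 / 10 + (3 / 10)\<^sup>2"
    by (rule exp_bound) auto
  also have "\<dots> \<le> 3 / 2"
    by (simp add: power2_eq_square)
  finally show ?thesis .
qed

lemma two_power_le_exp: "2 ^ n \<le> exp (real n)"
proof -
  have "(2::real) ^ n \<le> exp 1 ^ n"
    using exp_ge_add_one_self[of 1] by (intro power_mono) auto
  then show ?thesis by (simp add: exp_of_nat_mult[symmetric])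
qed

lemma exp_5_le: "exp (5::real) \<le> 243"
proof -
  have "exp (5::real) = exp 1 ^ 5"
    by (simp add: exp_of_nat_mult[symmetric])
  also have "\<dots> \<le> 3 ^ 5"
    using exp_le by (intro power_mono) auto
  finally show ?thesis by simp
qed

lemma measure_gibbs_pair:
  assumes "\<sigma> \<noteq> \<sigma>'"
  shows "measure_pmf.prob (gibbs M) {\<sigma>, \<sigma>'} = pmf (gibbs M) \<sigma> + pmf (gibbs M) \<sigma>'"
  using assms by (simp add: measure_measure_pmf_finite)

text \<open>\<open>y\<close> will be the total coupling \<open>\<kappa> * m\<close> of a graph
  vertex to one block, and \<open>D\<close> is the number of pairs between \<open>S\<close> and
  \<open>A\<close>. \<open>L\<close> remains free until the sample polynomial is known; it controls
  how small \<open>exp (- y)\<close> is.\<close>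

locale reduction =
  fixes N L m :: nat and y D :: real
  assumes L: "L \<ge> 4"
    and m_def: "m = L * (N + 1)\<^sup>2" and y_def: "y = real L * (real N + 1)" and D_def: "D = (real m)\<^sup>2"
begin

lemma y_ge: "y \<ge> 4 * real N" "y \<ge> 4"
proof -
  have "4 * (real N + 1) \<le> y"
    unfolding y_def using L by (intro mult_right_mono) auto
  then show "y \<ge> 4 * real N" "y \<ge> 4" by (simp_all add: algebra_simps)
qed

lemma m_eq: "real m = y * (real N + 1)"
  by (simp add: m_def y_def power2_eq_square algebra_simps)

lemma m_ge: "real m \<ge> y" "m > 0"
proof -
  have "y * 1 \<le> y * (real N + 1)"
    using y_ge(2) by (intro mult_left_mono) auto
  then show "real m \<ge> y" by (simp add: m_eq)
  then show "m > 0" using y_ge(2) by (cases m) auto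
qed

lemma D_ge: "D \<ge> 1"
proof -
  have "1 * 1 \<le> real m * real m"
    using m_ge(2) by (intro mult_mono) auto
  then show ?thesis by (simp add: D_def power2_eq_square)
qed

text \<open>There are at most \<open>exp (4 * m + N)\<close> other configurations, each of weight at
  most \<open>exp (- 10 * m)\<close>; together they weigh at most \<open>exp (N - 6 * m)\<close>,
  less than \<open>exp (- y)\<close>.\<close>

lemma gibbs_bipartite:
  defines "M \<equiv> bipartite m N 10"
  shows "c \<in> {1, 2} \<Longrightarrow> 1 \<le> 2 * (1 + exp (- y)) * pmf (gibbs M) (special m N c)"
    and "measure_pmf.prob (gibbs M) {special m N 1, special m N 2} \<ge> 1 - exp (- y)"
proof -
  let ?Z = "partition_function M"
  have "2 ^ (4 * m + N) * exp (- 10 * real m) \<le> exp (real (4 * m + N)) * exp (- 10 * real m)"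
    by (intro mult_right_mono two_power_le_exp) auto
  also have "\<dots> = exp (real N - 6 * real m)"
    by (simp flip: exp_add)
  also have "\<dots> \<le> exp (- y)"
    using y_ge m_ge(1) by simp
  finally have "2 ^ (4 * m + N) * exp (- 10 * real m) \<le> exp (- y)" .
  moreover have "?Z \<le> 2 + 2 ^ (4 * m + N) * exp (- 10 * real m)"
    unfolding M_def by (rule partition_function_bipartite_le[OF m_ge(2)]) simp
  moreover have "exp (- y) \<ge> 0" by simp
  ultimately have Z: "?Z \<le> 2 * (1 + exp (- y))"
    unfolding distrib_left by linarith
  have pos: "?Z > 0" by (rule partition_function_pos)
  have p: "pmf (gibbs M) (special m N c) = 1 / ?Z" if "c \<in> {1, 2}" for c
    using that special_in_configs[OF that] weight_bipartite_special[OF that, of m N 10]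
    by (auto simp: pmf_gibbs M_def bipartite_def simp del: insert_iff)
  show "1 \<le> 2 * (1 + exp (- y)) * pmf (gibbs M) (special m N c)" if "c \<in> {1, 2}" for c
    using Z pos by (simp only: p[OF that]) (simp add: field_simps)
  have prob: "measure_pmf.prob (gibbs M) {special m N 1, special m N 2} = 2 / ?Z"
    unfolding measure_gibbs_pair[OF special_ne[OF m_ge(2)]] by (subst (1 2) p) auto
  have "(1 - exp (- y)) * ?Z \<le> (1 - exp (- y)) * (2 * (1 + exp (- y)))"
    using Z y_ge(2) by (intro mult_left_mono) auto
  also have "\<dots> \<le> 2"
    by (simp add: algebra_simps)
  finally show "measure_pmf.prob (gibbs M) {special m N 1, special m N 2} \<ge> 1 - exp (- y)"
    unfolding prob using pos by (simp only: pos_le_divide_eq)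
qed

end

text \<open>\<open>cnt\<close> counts every edge twice, just as the program does when it scans the
  adjacency matrix; hence the 3/10 per unit of \<open>cnt\<close> below, half of 0.6.\<close>

locale cubic_instance =
  fixes N :: nat and G :: ising and cnt :: nat
  assumes G: "G \<in> ising_minus_hat N 3 (-0.6)"
    and cnt_def: "cnt = (\<Sum>u<N. \<Sum>v<N. of_bool ({u, v} \<in> edges G))"
begin

definition "g = pair_coupling G"
definition "Z = partition_function G"

lemma G_simps: "simple_graph G" "nverts G = N" "\<And>e. e \<in> edges G \<Longrightarrow> coupling G e = - 6 / 10"
    "\<And>v. v < N \<Longrightarrow> card {e \<in> edges G. v \<in> e} \<le> 3"
    "\<forall>v<nverts G. \<forall>i\<in>{1, 2}. ext_field G v i = 0"
  using G by (auto simp: ising_minus_hat_def max_degree_le_def)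

lemma no_loop: "{a} \<notin> edges G"
  using G_simps(1) by (auto simp: simple_graph_def doubleton_eq_iff)

lemma g_eq: "g a b = - 6 / 10 * of_bool ({a, b} \<in> edges G)"
  by (simp add: g_def pair_coupling_def G_simps)

lemma g_sym: "g a b = g b a"
  unfolding g_eq by (simp only: insert_commute[of a])

lemma g_diag: "g a a = 0"
  by (simp add: g_eq no_loop)

lemma g_nonpos: "g a b \<le> 0"
  by (simp add: g_eq)

lemma sum_g: "(\<Sum>u<N. \<Sum>v<N. g u v) / 2 = - 3 / 10 * real cnt"
  unfolding g_eq cnt_def of_nat_sum of_nat_of_bool sum_distrib_left[symmetric] by simp

lemma cnt_le: "cnt \<le> 3 * N"
proof -
  have "(\<Sum>v<N. of_bool ({u, v} \<in> edges G)) \<le> (3::nat)" if "u < N" for u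
  proof -
    have fin: "finite (edges G)"
      by (rule finite_subset[of _ "Pow {..<N}"]) (use G_simps(1,2) in \<open>auto simp: simple_graph_def\<close>)
    have "(\<Sum>v<N. of_bool ({u, v} \<in> edges G)) = card {v \<in> {..<N}. {u, v} \<in> edges G}"
      by (simp add: Int_def)
    also have "\<dots> \<le> card {e \<in> edges G. u \<in> e}"
      by (rule card_inj_on_le[of "\<lambda>v. {u, v}"]) (auto simp: inj_on_def doubleton_eq_iff fin)
    also have "\<dots> \<le> 3" using G_simps(4)[OF that] .
    finally show ?thesis .
  qed
  then have "cnt \<le> (\<Sum>u<N. 3)"
    unfolding cnt_def by (intro sum_mono) auto
  then show ?thesis by simp
qed

lemma Z_eq: "Z = (\<Sum>\<tau>\<in>configs N. exp (pair_energy N g \<tau>))"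
  unfolding Z_def partition_function_def g_def using weight_eq_exp_pair_energy[OF G_simps(1,5)] G_simps(2) by simp

lemma Z_le: "Z \<le> 2 ^ N"
proof -
  have "Z \<le> (\<Sum>\<tau>\<in>configs N. 1)"
    unfolding Z_eq using pair_energy_nonpos[where g = g, OF g_nonpos] by (intro sum_mono) simp
  then show ?thesis by (simp add: card_configs)
qed

text \<open>The worst energy has all edges monochromatic, and \<open>cnt \<le> 3 * N\<close> bounds
  it by 9/10 of \<open>N\<close>. With \<open>Z_le\<close> this delimits the values of
  \<open>Zhat\<close> for which the tester is needed.\<close>

lemma Z_ge: "Z \<ge> exp (- real N)"
proof -
  have "configs N \<noteq> {}" by (simp add: configs_def PiE_eq_empty_iff)
  then obtain \<tau> where \<tau>: "\<tau> \<in> configs N" by blast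
  have "3 / 10 * real cnt \<le> real N" using cnt_le by linarith
  then have "- real N \<le> pair_energy N g \<tau>"
    using pair_energy_ge[where g = g, OF g_nonpos, of N \<tau>] unfolding sum_g by linarith
  then have "exp (- real N) \<le> exp (pair_energy N g \<tau>)" by simp
  also have "\<dots> \<le> Z"
    unfolding Z_eq using \<tau> by (intro member_le_sum) (auto simp: finite_configs)
  finally show ?thesis .
qed

end

text \<open>Up to sign, \<open>y * N\<close> is the exponent of the free phase without the factor
  \<open>Z\<close>, and \<open>u + 1 / D + 3 / 10 * cnt\<close> that of a frozen configuration.
  Tuning makes their difference \<open>ln Zhat\<close> up to 5.\<close>

locale tuned_gadget = reduction N L m y D + cubic_instance N G cnt
  for N L m y D G cnt +
  fixes u :: nat and Zhat r :: real
  assumes u_le: "u \<le> L * N * (N + 1) + 3 * N"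
    and Zhat: "Zhat > 0" and r: "r \<ge> 1"
    and tuned: "\<bar>y * real N - real u - 1 / D - 3 / 10 * real cnt - ln Zhat\<bar> \<le> 5"
begin

definition "\<omega> = (D * real u + 1) / D\<^sup>2"
definition "\<kappa> = 1 / (real N + 1)"
definition "M = gadget m N g 10 \<omega> \<kappa>"
definition "X = exp (- (real u + 1 / D) - 3 / 10 * real cnt)"

lemma \<omega>_nonneg: "\<omega> \<ge> 0" "\<omega> \<noteq> 0"
proof -
  have "D * real u + 1 > 0" using D_ge by (intro add_nonneg_pos) auto
  then show "\<omega> \<ge> 0" "\<omega> \<noteq> 0" using D_ge by (simp_all add: \<omega>_def)
qed

lemma \<omega>_m: "\<omega> * (real m)\<^sup>2 = real u + 1 / D"
proof -
  have "\<omega> * (real m)\<^sup>2 = \<omega> * D" by (simp only: D_def)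
  also have "\<dots> = real u + 1 / D"
    using D_ge by (simp add: \<omega>_def power2_eq_square field_simps)
  finally show ?thesis .
qed

lemma \<omega>_le: "\<omega> \<le> 10"
proof -
  have "real u \<le> real (L * N * (N + 1) + 3 * N)"
    using u_le by (simp only: of_nat_le_iff)
  also have "\<dots> = y * real N + 3 * real N"
    by (simp add: y_def algebra_simps)
  also have "\<dots> \<le> y * real N + y"
    using y_ge by simp
  also have "\<dots> = real m" by (simp add: m_eq algebra_simps)
  also have "\<dots> * 1 \<le> D"
    unfolding D_def power2_eq_square using m_ge(2) by (intro mult_left_mono) auto
  finally have "D * real u + 1 \<le> D * D + D * D"
    using D_ge mult_mono[of 1 D 1 D] by (intro add_mono mult_left_mono) auto
  moreover have "D * D \<ge> 0" by simp
  ultimately have "D * real u + 1 \<le> 10 * (D * D)" by linarith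
  then show ?thesis
    using D_ge by (simp add: \<omega>_def power2_eq_square divide_le_eq)
qed

lemma \<kappa>_m: "\<kappa> * m = y"
  by (simp add: \<kappa>_def m_eq)

lemma u_bound: "real u + 1 / D + 3 / 10 * real cnt \<le> 2 * real m"
proof -
  have "real u \<le> real (L * N * (N + 1) + 3 * N)"
    using u_le by (simp only: of_nat_le_iff)
  also have "\<dots> = y * real N + 3 * real N"
    by (simp add: y_def algebra_simps)
  finally have "real u \<le> y * real N + 3 * real N" .
  moreover have "1 / D \<le> 1" using D_ge by simp
  moreover have "3 / 10 * real cnt \<le> real N" using cnt_le by linarith
  moreover have "y * real N + y = real m" by (simp add: m_eq algebra_simps)
  ultimately show ?thesis using y_ge m_ge(1) by linarith
qed

lemma weight_special: "c \<in> {1, 2} \<Longrightarrow> weight M (special m N c) = X"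
  unfolding M_def weight_gadget_special[where g = g, OF g_sym g_diag] sum_g X_def
  using \<omega>_m by simp

lemma pmf_special: "c \<in> {1, 2} \<Longrightarrow> pmf (gibbs M) (special m N c) = X / partition_function M"
  using special_in_configs[of c m N] weight_special[of c]
  by (auto simp: pmf_gibbs M_def gadget_def simp del: insert_iff)

lemma X_ratio: "exp (- y * N) / X \<le> exp 5 / Zhat" "X / exp (- y * N) \<le> exp 5 * Zhat"
proof -
  have "- y * N - (- (real u + 1 / D) - 3 / 10 * real cnt) \<le> 5 - ln Zhat"
    using tuned by linarith
  then have "exp (- y * N - (- (real u + 1 / D) - 3 / 10 * real cnt)) \<le> exp (5 - ln Zhat)"
    by (simp only: exp_le_cancel_iff)
  then show "exp (- y * N) / X \<le> exp 5 / Zhat"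
    unfolding X_def exp_diff exp_ln[OF Zhat] .
  have "(- (real u + 1 / D) - 3 / 10 * real cnt) - (- y * N) \<le> 5 + ln Zhat"
    using tuned by linarith
  then have "exp ((- (real u + 1 / D) - 3 / 10 * real cnt) - (- y * N)) \<le> exp (5 + ln Zhat)"
    by (simp only: exp_le_cancel_iff)
  then show "X / exp (- y * N) \<le> exp 5 * Zhat"
    unfolding X_def exp_diff exp_add exp_ln[OF Zhat] .
qed

lemma X_pos: "X > 0"
  by (simp add: X_def)

lemma low_case:
  assumes "Z \<le> Zhat / r" "c \<in> {1, 2}"
  shows "1 \<le> 2 * (1 + (2 * exp (- y) + 243 / r)) * pmf (gibbs M) (special m N c)"
proof -
  let ?h = "exp (- 3 / 10 * real cnt)"
  have le: "partition_function M \<le> 2 * exp (- (real u + 1 / D)) * (?h + 2 ^ N * exp (- 2 * y))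
      + 2 * exp (- y * N) * Z + 2 ^ (4 * m + N) * exp (- 10 * real m)"
  proof -
    have "\<kappa> \<ge> 0" by (simp add: \<kappa>_def)
    have eqs: "- \<omega> * (real m)\<^sup>2 = - (real u + 1 / D)" "- 2 * \<kappa> * real m = - 2 * y"
        "- \<kappa> * real m * real N = - y * real N"
      using \<omega>_m \<kappa>_m by simp_all
    show ?thesis
      using partition_function_gadget_le[where g = g, OF g_sym g_diag g_nonpos m_ge(2) _ \<omega>_nonneg(1) \<open>\<kappa> \<ge> 0\<close>, of 10 N]
      unfolding eqs sum_g Z_eq[symmetric] M_def[symmetric] by simp
  qed
  have X: "X = exp (- (real u + 1 / D)) * ?h"
    by (simp add: X_def flip: exp_add)
  have 1: "exp (- (real u + 1 / D)) * (2 ^ N * exp (- 2 * y)) \<le> X * exp (- y)"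
  proof -
    have "2 ^ N * exp (- 2 * y) \<le> exp (real N) * exp (- 2 * y)"
      by (intro mult_right_mono two_power_le_exp) auto
    also have "\<dots> = exp (real N - 2 * y)" by (simp flip: exp_add)
    also have "\<dots> \<le> exp (- 3 / 10 * real cnt - y)"
      using y_ge cnt_le by simp
    also have "\<dots> = ?h * exp (- y)" unfolding exp_add[symmetric] by simp
    finally show ?thesis unfolding X by (simp add: mult.assoc)
  qed
  have 2: "exp (- y * N) * Z \<le> X * (243 / r)"
  proof -
    have "exp (- y * N) * Z = X * (exp (- y * N) / X * Z)"
      using X_pos by simp
    also have "\<dots> \<le> X * (exp 5 / Zhat * (Zhat / r))"
      using X_pos X_ratio(1) assms(1) Zhat r partition_function_pos[of G]
      by (intro mult_left_mono mult_mono) (auto simp: Z_def)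
    also have "\<dots> = X * (exp 5 / r)" using Zhat by simp
    also have "\<dots> \<le> X * (243 / r)"
      using exp_5_le X_pos r by (intro mult_left_mono divide_right_mono) auto
    finally show ?thesis .
  qed
  have 3: "2 ^ (4 * m + N) * exp (- 10 * real m) \<le> X * exp (- y)"
  proof -
    have "2 ^ (4 * m + N) * exp (- 10 * real m) \<le> exp (real (4 * m + N)) * exp (- 10 * real m)"
      by (intro mult_right_mono two_power_le_exp) auto
    also have "\<dots> = exp (real N - 6 * real m)"
      by (simp flip: exp_add)
    also have "\<dots> \<le> exp (- (real u + 1 / D) - 3 / 10 * real cnt - y)"
      using u_bound y_ge m_ge by simp
    also have "\<dots> = X * exp (- y)"
      unfolding X_def exp_add[symmetric] by simp
    finally show ?thesis .
  qed
  have "2 * exp (- (real u + 1 / D)) * (?h + 2 ^ N * exp (- 2 * y))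
      = 2 * X + 2 * (exp (- (real u + 1 / D)) * (2 ^ N * exp (- 2 * y)))"
    unfolding X by (simp add: distrib_left)
  with le 1 2 3 have "partition_function M \<le> 2 * X + 2 * (X * exp (- y)) + 2 * (X * (243 / r)) + X * exp (- y)"
    by linarith
  also have "\<dots> \<le> 2 * X + 4 * (X * exp (- y)) + 2 * (X * (243 / r))"
    using X_pos by simp
  also have "\<dots> = 2 * (1 + (2 * exp (- y) + 243 / r)) * X"
    by (simp add: algebra_simps)
  finally show ?thesis
    using partition_function_pos[of M] by (simp only: pmf_special[OF assms(2)]) (simp add: field_simps)
qed

text \<open>The free phase alone outweighs each frozen configuration by the factor
  \<open>r / 243\<close>.\<close>

lemma high_case:
  assumes "Z \<ge> r * Zhat"
  shows "measure_pmf.prob (gibbs M) {special m N 1, special m N 2} \<le> 2 * 243 / r"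
proof -
  let ?Z = "partition_function M"
  have pos: "?Z > 0" by (rule partition_function_pos)
  have "exp (- y * N) * Z \<le> ?Z"
    using partition_function_gadget_ge[where g = g, OF g_sym g_diag, of \<kappa> m N 10 \<omega>] \<kappa>_m
    unfolding M_def Z_eq by (simp add: mult.assoc)
  moreover have "exp (- y * N) * (r * Zhat) \<le> exp (- y * N) * Z"
    using assms by simp
  ultimately have ge: "exp (- y * N) * (r * Zhat) \<le> ?Z" by linarith
  have "X * r = X / exp (- y * N) * exp (- y * N) * r" by simp
  also have "\<dots> \<le> exp 5 * Zhat * exp (- y * N) * r"
    using X_ratio(2) r by (intro mult_right_mono) auto
  also have "\<dots> = exp 5 * (exp (- y * N) * (r * Zhat))" by simp
  also have "\<dots> \<le> exp 5 * ?Z" using ge by simp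
  also have "\<dots> \<le> 243 * ?Z" using exp_5_le pos by simp
  finally have "X / ?Z \<le> 243 / r"
    using pos r by (simp add: field_simps)
  moreover have "measure_pmf.prob (gibbs M) {special m N 1, special m N 2} = X / ?Z + X / ?Z"
    unfolding measure_gibbs_pair[OF special_ne[OF m_ge(2)]] by (subst (1 2) pmf_special) auto
  ultimately show ?thesis by simp
qed

end

section \<open>Deterministic programs\<close>

text \<open>The elapsed time \<open>t\<close> is fixed before source, subroutine and counters: such
  a program ignores its surroundings, so its costs add up without any probability.\<close>

definition runs :: "com \<Rightarrow> store \<Rightarrow> store \<Rightarrow> nat \<Rightarrow> bool" where
  "runs c s s' T \<longleftrightarrow> (\<exists>t\<le>T. \<forall>smp sub t0 k. exec smp sub c (s, t0, k) = return_spmf (s', t0 + t, k))"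

lemma runsE:
  assumes "runs c s s' T"
  obtains t where "t \<le> T" "\<And>smp sub t0 k. exec smp sub c (s, t0, k) = return_spmf (s', t0 + t, k)"
  using assms unfolding runs_def by blast

lemma runs_mono: "runs c s s' T \<Longrightarrow> T \<le> T' \<Longrightarrow> runs c s s' T'"
  unfolding runs_def by (meson order_trans)

lemma runs_Skip: "runs Skip s s T"
  unfolding runs_def by (rule exI[of _ 0]) simp

lemma runs_Assign:
  assumes "expr_val e s = v" "expr_cost e s + 1 \<le> T"
  shows "runs (Assign x e) s (s(x := v)) T"
  unfolding runs_def using assms by (intro exI[of _ "expr_cost e s + 1"]) simp

lemma runs_Seq:
  assumes "runs c s s' T" "runs d s' s'' T'" "T + T' \<le> T''"
  shows "runs (Seq c d) s s'' T''"
proof -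
  obtain t where t: "t \<le> T" "\<And>smp sub t0 k. exec smp sub c (s, t0, k) = return_spmf (s', t0 + t, k)"
    by (rule runsE[OF assms(1)]) blast
  obtain t' where t': "t' \<le> T'" "\<And>smp sub t0 k. exec smp sub d (s', t0, k) = return_spmf (s'', t0 + t', k)"
    by (rule runsE[OF assms(2)]) blast
  show ?thesis
    unfolding runs_def using t t' assms(3) by (intro exI[of _ "t + t'"]) (simp add: add.assoc)
qed

lemma runs_If:
  assumes "runs (if truthy (expr_val e s) then c else d) s s' T" "1 + expr_cost e s + T \<le> T'"
  shows "runs (If e c d) s s' T'"
proof -
  obtain t where t: "t \<le> T"
    "\<And>smp sub t0 k. exec smp sub (if truthy (expr_val e s) then c else d) (s, t0, k) = return_spmf (s', t0 + t, k)"
    by (rule runsE[OF assms(1)]) blast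
  have "exec smp sub (If e c d) (s, t0, k) = return_spmf (s', t0 + (1 + expr_cost e s + t), k)" for smp sub t0 k
    using t(2)[of smp sub "t0 + 1 + expr_cost e s" k] by (auto simp: add.assoc split: if_splits)
  then show ?thesis
    unfolding runs_def using t(1) assms(2) by (intro exI[of _ "1 + expr_cost e s + t"]) auto
qed

lemma exec_While_unfold:
  "exec smp sub (While e c) (s, t, k) =
    (if truthy (expr_val e s) then bind_spmf (exec smp sub c (s, t + 1 + expr_cost e s, k)) (exec smp sub (While e c))
     else return_spmf (s, t + 1 + expr_cost e s, k))"
proof (cases "truthy (expr_val e s)")
  case True
  then show ?thesis
    unfolding exec.simps by (subst while_spmf.simps) (simp add: map_spmf_bind_spmf o_def)
next
  case False
  then show ?thesis
    unfolding exec.simps by (subst while_spmf.simps) simp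
qed

text \<open>Counting down lets the counter itself be the loop test and leaves its register at 0,
  ready for reuse.\<close>

definition For :: "nat \<Rightarrow> expr \<Rightarrow> com \<Rightarrow> com" where
  "For i l c = Seq (Assign i l) (While (Reg i) (Seq c (Assign i (Arith Sub (Reg i) (Lit (Atom 1))))))"

lemma floorlog_le: "floorlog 2 n \<le> n"
proof (cases "n = 0")
  case False
  have "n < 2 ^ n" by (rule less_exp)
  then show ?thesis
    using False floorlog_leI[of n 2 n] by simp
qed (simp add: floorlog_def)

text \<open>In \<open>f j\<close>, the store after \<open>j\<close> rounds, the counter is masked as
  0; so one family describes start, rounds and end. Test and decrement cost at most
  \<open>k + 7\<close> per round, with the bit lengths bounded crudely by
  \<open>k + 1\<close>.\<close>

lemma runs_For:
  assumes l: "expr_val l s = Atom k" "expr_cost l s \<le> C"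
    and f0: "f 0 = s" and i: "\<And>j. j \<le> k \<Longrightarrow> f j i = Atom 0"
    and step: "\<And>j. j < k \<Longrightarrow> runs c ((f j)(i := Atom (k - j))) ((f (Suc j))(i := Atom (k - j))) B"
  shows "runs (For i l c) s (f k) (C + k * (B + k + 7) + 3)"
proof -
  let ?W = "While (Reg i) (Seq c (Assign i (Arith Sub (Reg i) (Lit (Atom 1)))))"
  have W: "runs ?W ((f j)(i := Atom (k - j))) (f k) ((k - j) * (B + k + 7) + 2)" if "j \<le> k" for j
    using that
  proof (induction "k - j" arbitrary: j)
    case 0
    then have "f k = (f j)(i := Atom (k - j))"
      using i[of k] by (auto simp: fun_upd_idem)
    with 0 i[of k] show ?case
      unfolding runs_def by (intro exI[of _ 2]) (simp add: exec_While_unfold truthy_def del: exec.simps)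
  next
    case (Suc d)
    then have j: "j < k" by simp
    let ?s = "(f j)(i := Atom (k - j))"
    obtain t where t: "t \<le> B"
      "\<And>smp sub t0 n. exec smp sub c (?s, t0, n) = return_spmf ((f (Suc j))(i := Atom (k - j)), t0 + t, n)"
      by (rule runsE[OF step[OF j]]) blast
    have IH: "runs ?W ((f (Suc j))(i := Atom (k - Suc j))) (f k) ((k - Suc j) * (B + k + 7) + 2)"
      using Suc.hyps(2) j by (intro Suc.hyps(1)) auto
    obtain t' where t': "t' \<le> (k - Suc j) * (B + k + 7) + 2"
      "\<And>smp sub t0 n. exec smp sub ?W ((f (Suc j))(i := Atom (k - Suc j)), t0, n) = return_spmf (f k, t0 + t', n)"
      by (rule runsE[OF IH]) blast
    let ?c = "floorlog 2 (k - j) + floorlog 2 1"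
    have c: "?c \<le> k + 1" using floorlog_le[of "k - j"] floorlog_le[of 1] by linarith
    have "exec smp sub ?W (?s, t0, n) = return_spmf (f k, t0 + (6 + t + ?c + t'), n)" for smp sub t0 n
    proof -
      have "k - (1 + j) = k - Suc j" by simp
      then show ?thesis
        using j by (subst exec_While_unfold)
          (simp add: truthy_def t(2) t'(2) ac_simps del: exec.simps(5) One_nat_def)
    qed
    moreover have "6 + t + ?c + t' \<le> (k - j) * (B + k + 7) + 2"
    proof -
      have "(k - j) * (B + k + 7) = (B + k + 7) + (k - Suc j) * (B + k + 7)"
        using j by (simp add: Suc_diff_Suc flip: mult_Suc)
      with t(1) t'(1) c show ?thesis by linarith
    qed
    ultimately show ?case
      unfolding runs_def by (intro exI[of _ "6 + t + ?c + t'"]) auto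
  qed
  have "runs (Assign i l) s (s(i := Atom k)) (C + 1)"
    using l by (intro runs_Assign) auto
  moreover have "runs ?W (s(i := Atom k)) (f k) (k * (B + k + 7) + 2)"
    using W[of 0] f0 by simp
  ultimately show ?thesis
    unfolding For_def by (rule runs_Seq) simp
qed

section \<open>Programs that write lists in blocks\<close>

definition prepend :: "nat \<Rightarrow> val \<Rightarrow> val \<Rightarrow> val" where
  "prepend k v w = foldr Cell (replicate k v) w"

lemma prepend_Suc: "prepend (Suc k) v w = Cell v (prepend k v w)"
  by (simp add: prepend_def)

lemma prepend_enc_list: "prepend k v (enc_list vs) = enc_list (replicate k v @ vs)"
  by (simp add: prepend_def enc_list_def)

definition Rep :: "nat \<Rightarrow> nat \<Rightarrow> nat \<Rightarrow> nat \<Rightarrow> com" where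
  "Rep i l x y = For i (Reg l) (Assign y (MkCell (Reg x) (Reg y)))"

lemma runs_Rep:
  assumes "s l = Atom k" "s i = Atom 0" "i \<noteq> x" "i \<noteq> y" "x \<noteq> y"
  shows "runs (Rep i l x y) s (s(y := prepend k (s x) (s y))) (k * (k + 11) + 4)"
proof -
  let ?f = "\<lambda>j. s(y := prepend j (s x) (s y))"
  have "runs (Rep i l x y) s (?f k) (1 + k * (4 + k + 7) + 3)"
    unfolding Rep_def
  proof (rule runs_For)
    show "runs (Assign y (MkCell (Reg x) (Reg y))) ((?f j)(i := Atom (k - j))) ((?f (Suc j))(i := Atom (k - j))) 4"
      if "j < k" for j
    proof -
      have eq: "(?f (Suc j))(i := Atom (k - j)) = ((?f j)(i := Atom (k - j)))(y := Cell (s x) (prepend j (s x) (s y)))"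
        using assms by (simp add: prepend_Suc fun_upd_twist)
      show ?thesis
        unfolding eq by (rule runs_Assign) (use assms in auto)
    qed
  qed (use assms in \<open>auto simp: prepend_def\<close>)
  then show ?thesis
    by (rule runs_mono) (simp add: add.commute)
qed

text \<open>Lists grow at the front, so the last block is written first. Register \<open>9\<close>
  counts, register \<open>12\<close> holds the block length.\<close>

definition Prefix :: "nat \<Rightarrow> nat \<Rightarrow> nat \<Rightarrow> nat \<Rightarrow> nat \<Rightarrow> com" where
  "Prefix x0 x1 x2 x3 y = Seq (Rep 9 12 x3 y) (Seq (Rep 9 12 x2 y) (Seq (Rep 9 12 x1 y) (Rep 9 12 x0 y)))"

lemma runs_Prefix:
  assumes "s 12 = Atom k" "s 9 = Atom 0" "9 \<notin> {x0, x1, x2, x3, y}" "y \<notin> {x0, x1, x2, x3, 12}"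
  shows "runs (Prefix x0 x1 x2 x3 y) s
    (s(y := prepend k (s x0) (prepend k (s x1) (prepend k (s x2) (prepend k (s x3) (s y)))))) (4 * (k * (k + 11) + 4))"
proof -
  let ?T = "k * (k + 11) + 4"
  let ?s1 = "s(y := prepend k (s x3) (s y))"
  let ?s2 = "?s1(y := prepend k (s x2) (?s1 y))"
  let ?s3 = "?s2(y := prepend k (s x1) (?s2 y))"
  let ?s4 = "?s3(y := prepend k (s x0) (?s3 y))"
  have 1: "runs (Rep 9 12 x3 y) s ?s1 ?T"
    using assms by (intro runs_Rep) auto
  have 2: "runs (Rep 9 12 x2 y) ?s1 ?s2 ?T"
    using assms runs_Rep[of ?s1 12 k 9 x2 y] by auto
  have 3: "runs (Rep 9 12 x1 y) ?s2 ?s3 ?T"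
    using assms runs_Rep[of ?s2 12 k 9 x1 y] by auto
  have 4: "runs (Rep 9 12 x0 y) ?s3 ?s4 ?T"
    using assms runs_Rep[of ?s3 12 k 9 x0 y] by auto
  have "runs (Prefix x0 x1 x2 x3 y) s ?s4 (4 * ?T)"
    unfolding Prefix_def
    by (rule runs_Seq[OF 1 runs_Seq[OF 2 runs_Seq[OF 3 4 order_refl] order_refl]]) simp
  then show ?thesis by simp
qed

definition block_list :: "nat \<Rightarrow> nat \<Rightarrow> val \<Rightarrow> val \<Rightarrow> val \<Rightarrow> val \<Rightarrow> val \<Rightarrow> val" where
  "block_list m N v0 v1 v2 v3 v4 = enc_list (replicate m v0 @ replicate m v1 @ replicate m v2 @ replicate m v3 @ replicate N v4)"

definition Blocks :: "nat \<Rightarrow> nat \<Rightarrow> nat \<Rightarrow> nat \<Rightarrow> nat \<Rightarrow> nat \<Rightarrow> com" where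
  "Blocks x0 x1 x2 x3 x4 y = Seq (Assign y (Lit (Atom 0))) (Seq (Rep 9 1 x4 y) (Prefix x0 x1 x2 x3 y))"

lemma runs_Blocks:
  assumes "s 12 = Atom m" "s 1 = Atom N" "s 9 = Atom 0"
    "9 \<notin> {x0, x1, x2, x3, x4, y}" "y \<notin> {x0, x1, x2, x3, x4, 12, 1}"
  shows "runs (Blocks x0 x1 x2 x3 x4 y) s (s(y := block_list m N (s x0) (s x1) (s x2) (s x3) (s x4)))
    (4 * (m * (m + 11) + 4) + N * (N + 11) + 6)"
proof -
  let ?s1 = "s(y := Atom 0)"
  let ?s2 = "?s1(y := prepend N (s x4) (Atom 0))"
  let ?s3 = "?s2(y := prepend m (s x0) (prepend m (s x1) (prepend m (s x2) (prepend m (s x3) (?s2 y)))))"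
  have 1: "runs (Assign y (Lit (Atom 0))) s ?s1 2"
    by (intro runs_Assign) auto
  have 2: "runs (Rep 9 1 x4 y) ?s1 ?s2 (N * (N + 11) + 4)"
    using assms runs_Rep[of ?s1 1 N 9 x4 y] by auto
  have 3: "runs (Prefix x0 x1 x2 x3 y) ?s2 ?s3 (4 * (m * (m + 11) + 4))"
    using assms runs_Prefix[of ?s2 m x0 x1 x2 x3 y] by auto
  have "runs (Blocks x0 x1 x2 x3 x4 y) s ?s3 (4 * (m * (m + 11) + 4) + N * (N + 11) + 6)"
    unfolding Blocks_def by (rule runs_Seq[OF 1 runs_Seq[OF 2 3 order_refl]]) simp
  moreover have "?s3 = s(y := block_list m N (s x0) (s x1) (s x2) (s x3) (s x4))"
    by (simp add: block_list_def prepend_def enc_list_def)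
  ultimately show ?thesis by simp
qed

section \<open>The search and the adjacency matrix\<close>

abbreviation num :: "nat \<Rightarrow> expr" where
  "num k \<equiv> Lit (Atom k)"

primrec Assigns :: "(nat \<times> expr) list \<Rightarrow> com" where
  "Assigns [] = Skip"
| "Assigns (a # as) = Seq (Assign (fst a) (snd a)) (Assigns as)"

primrec store_after :: "(nat \<times> expr) list \<Rightarrow> store \<Rightarrow> store" where
  "store_after [] s = s"
| "store_after (a # as) s = store_after as (s(fst a := expr_val (snd a) s))"

primrec cost_of :: "(nat \<times> expr) list \<Rightarrow> store \<Rightarrow> nat" where
  "cost_of [] s = 0"
| "cost_of (a # as) s = 1 + expr_cost (snd a) s + cost_of as (s(fst a := expr_val (snd a) s))"

lemma runs_Assigns:
  "store_after as s = s' \<Longrightarrow> cost_of as s \<le> T \<Longrightarrow> runs (Assigns as) s s' T"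
proof (induction as arbitrary: s T)
  case Nil
  then show ?case by (simp add: runs_Skip)
next
  case (Cons a as)
  let ?s = "s(fst a := expr_val (snd a) s)"
  have "runs (Assign (fst a) (snd a)) s ?s (expr_cost (snd a) s + 1)"
    by (intro runs_Assign) auto
  moreover have "runs (Assigns as) ?s s' (cost_of as ?s)"
    using Cons by auto
  ultimately show ?case
    unfolding Assigns.simps by (rule runs_Seq) (use Cons.prems(2) in simp)
qed

lemma floorlog_mult_le: "floorlog 2 (x * c) \<le> floorlog 2 x + c"
proof (cases "x = 0")
  case False
  have "x < 2 ^ floorlog 2 x" using False floorlog_bounds[of x 2] by simp
  moreover have "c < 2 ^ c" by (rule less_exp)
  ultimately have "x * c < 2 ^ floorlog 2 x * 2 ^ c"
    by (intro mult_strict_mono') auto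
  then show ?thesis
    by (intro floorlog_leI) (auto simp: power_add)
qed (simp add: floorlog_def)

lemma floorlog_mult_power_le: "floorlog 2 (x * c ^ j) \<le> floorlog 2 x + j * c"
proof (induction j)
  case (Suc j)
  have "floorlog 2 (x * c ^ j * c) \<le> floorlog 2 (x * c ^ j) + c" by (rule floorlog_mult_le)
  with Suc show ?case by (simp add: ac_simps)
qed simp

text \<open>Registers: \<open>0\<close> input and output; \<open>1\<close> \<open>N\<close>; \<open>2\<close> rows of the adjacency matrix; \<open>3\<close>, \<open>4\<close> the two
  sides of the search for the logarithm; \<open>5\<close> \<open>N + 1\<close>; \<open>6\<close> \<open>(N + 1) N\<close>; \<open>7\<close>, \<open>9\<close> loop counters; \<open>8\<close> result of
  the search; \<open>10\<close> flag; \<open>11\<close> number of nonzero matrix entries; \<open>12\<close> block size \<open>m\<close>; \<open>13\<close> \<open>m\<^sup>2\<close>;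
  \<open>14\<close>, \<open>15\<close>, \<open>31\<close> codes of the couplings \<open>\<omega>\<close>, \<open>\<kappa>\<close>, \<open>10\<close>; \<open>17\<close> \<open>N + 2\<close>; \<open>18\<close> to \<open>21\<close> matrix rows of the
  blocks; \<open>23\<close> new matrix; \<open>24\<close>, \<open>25\<close> the frozen configurations; \<open>26\<close> fields; \<open>27\<close> the gadget;
  \<open>28\<close> answer of the tester; \<open>30\<close> is never written and holds \<open>0\<close>; \<open>16\<close>, \<open>22\<close>, \<open>29\<close>, \<open>32\<close> to \<open>34\<close> temporaries
  and constants.\<close>

definition Setup :: com where
  "Setup = Assigns [(1, Left (Left (Reg 0))), (2, Left (Right (Left (Reg 0)))),
     (3, Right (Left (Right (Right (Reg 0))))), (4, Right (Right (Right (Reg 0)))),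
     (5, Arith Add (Reg 1) (num 1)), (6, Arith Mul (Reg 5) (Reg 1)), (17, Arith Add (Reg 5) (num 1))]"

lemma runs_Setup:
  assumes "s 0 = Cell (Cell (Atom N) (Cell rws flds)) (Cell r (Cell (Cell sg (Atom a)) (Atom b)))"
  shows "runs Setup s (s(1 := Atom N, 2 := rws, 3 := Atom a, 4 := Atom b, 5 := Atom (N + 1),
     6 := Atom ((N + 1) * N), 17 := Atom (N + 2))) (60 + 4 * N)"
  unfolding Setup_def using assms floorlog_le[of N] floorlog_le[of "Suc N"] floorlog_le[of "Suc 0"]
  by (intro runs_Assigns) simp_all

text \<open>Divides the fraction \<open>a / b\<close> by \<open>(1 + 1 / (N + 1)) ^ K\<close>, which
  is at least 2^N for \<open>K = (N + 1) * N\<close>. Then the search only has to move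
  upwards.\<close>

definition Power :: com where
  "Power = For 7 (Reg 6) (Assigns [(4, Arith Mul (Reg 4) (Reg 17)), (3, Arith Mul (Reg 3) (Reg 5))])"

lemma runs_Power:
  assumes s: "s 3 = Atom a" "s 4 = Atom b" "s 5 = Atom (N + 1)" "s 6 = Atom K" "s 17 = Atom (N + 2)" "s 7 = Atom 0"
  defines "W \<equiv> floorlog 2 a + floorlog 2 b + K * (N + 2)"
  shows "runs Power s (s(3 := Atom (a * (N + 1) ^ K), 4 := Atom (b * (N + 2) ^ K)))
    (1 + K * ((2 * W + 2 * N + 20) + K + 7) + 3)"
proof -
  let ?f = "\<lambda>j. s(3 := Atom (a * (N + 1) ^ j), 4 := Atom (b * (N + 2) ^ j))"
  show ?thesis
    unfolding Power_def
  proof (rule runs_For[where f = ?f])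
    fix j assume j: "j < K"
    have "j * (N + 1) \<le> K * (N + 2)" "j * (N + 2) \<le> K * (N + 2)"
      using j by (intro mult_le_mono; simp)+
    then have "floorlog 2 (a * (N + 1) ^ j) \<le> W" "floorlog 2 (b * (N + 2) ^ j) \<le> W"
      using floorlog_mult_power_le[of a "N + 1" j] floorlog_mult_power_le[of b "N + 2" j]
      unfolding W_def by linarith+
    then show "runs (Assigns [(4, Arith Mul (Reg 4) (Reg 17)), (3, Arith Mul (Reg 3) (Reg 5))])
        ((?f j)(7 := Atom (K - j))) ((?f (Suc j))(7 := Atom (K - j))) (2 * W + 2 * N + 20)"
      using s floorlog_le[of "N + 1"] floorlog_le[of "N + 2"]
      by (intro runs_Assigns) (auto simp: fun_eq_iff ac_simps)
  qed (use s in \<open>auto simp: fun_eq_iff\<close>)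
qed

text \<open>The search counter after a given number of rounds. Once the inequality fails the counter
  rests, so idle rounds replace a loop exit and the time is known in advance.\<close>

primrec steps_up :: "nat \<Rightarrow> nat \<Rightarrow> nat \<Rightarrow> nat \<Rightarrow> nat" where
  "steps_up Q P M 0 = 0"
| "steps_up Q P M (Suc i) = (let j = steps_up Q P M i in if Q * (M + 1) ^ j < P * M ^ j then j + 1 else j)"

lemma steps_up_le: "steps_up Q P M i \<le> i"
  by (induction i) (auto simp: Let_def)

text \<open>\<open>K\<close> rounds can undo the scaling done by \<open>Power\<close>; the other
  \<open>2 * K\<close> reach down to fractions of about 4^(-N), below every possible partition
  function.\<close>

definition Search :: com where
  "Search = For 7 (Arith Mul (num 3) (Reg 6)) (If (Arith Less (Reg 3) (Reg 4))
     (Assigns [(3, Arith Mul (Reg 3) (Reg 17)), (4, Arith Mul (Reg 4) (Reg 5)), (8, Arith Add (Reg 8) (num 1))]) Skip)"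

lemma runs_Search:
  assumes s: "s 3 = Atom Q" "s 4 = Atom P" "s 5 = Atom (N + 1)" "s 6 = Atom K" "s 17 = Atom (N + 2)"
    "s 7 = Atom 0" "s 8 = Atom 0"
  defines "W \<equiv> floorlog 2 Q + floorlog 2 P + 3 * K * (N + 2)" and "J \<equiv> steps_up Q P (N + 1)"
  shows "runs Search s (s(3 := Atom (Q * (N + 2) ^ J (3 * K)), 4 := Atom (P * (N + 1) ^ J (3 * K)), 8 := Atom (J (3 * K))))
    (K + 10 + 3 * K * ((5 * W + 2 * N + 40) + 3 * K + 7) + 3)"
proof -
  let ?f = "\<lambda>i. s(3 := Atom (Q * (N + 2) ^ J i), 4 := Atom (P * (N + 1) ^ J i), 8 := Atom (J i))"
  let ?c = "Assigns [(3, Arith Mul (Reg 3) (Reg 17)), (4, Arith Mul (Reg 4) (Reg 5)), (8, Arith Add (Reg 8) (num 1))]"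
  show ?thesis
    unfolding Search_def
  proof (rule runs_For[where f = ?f])
    fix j assume j: "j < 3 * K"
    then have "J j \<le> 3 * K" using steps_up_le[of Q P "N + 1" j] by (simp add: J_def)
    then have "J j * (N + 1) \<le> 3 * K * (N + 2)" "J j * (N + 2) \<le> 3 * K * (N + 2)" "J j * 1 \<le> 3 * K * (N + 2)"
      by (intro mult_le_mono; simp)+
    then have W: "floorlog 2 (Q * (N + 2) ^ J j) \<le> W" "floorlog 2 (P * (N + 1) ^ J j) \<le> W" "floorlog 2 (J j) \<le> W"
      using floorlog_mult_power_le[of P "N + 1" "J j"] floorlog_mult_power_le[of Q "N + 2" "J j"] floorlog_le[of "J j"]
      unfolding W_def by linarith+
    let ?s = "(?f j)(7 := Atom (3 * K - j))" and ?s' = "(?f (Suc j))(7 := Atom (3 * K - j))"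
    have J: "J (Suc j) = (if Q * (N + 2) ^ J j < P * (N + 1) ^ J j then J j + 1 else J j)"
      by (simp add: J_def Let_def)
    show "runs (If (Arith Less (Reg 3) (Reg 4)) ?c Skip) ?s ?s' (5 * W + 2 * N + 40)"
    proof (rule runs_If[where T = "3 * W + 2 * N + 30"])
      show "1 + expr_cost (Arith Less (Reg 3) (Reg 4)) ?s + (3 * W + 2 * N + 30) \<le> 5 * W + 2 * N + 40"
        using W by simp
      show "runs (if truthy (expr_val (Arith Less (Reg 3) (Reg 4)) ?s) then ?c else Skip) ?s ?s' (3 * W + 2 * N + 30)"
      proof (cases "Q * (N + 2) ^ J j < P * (N + 1) ^ J j")
        case True
        then have "truthy (expr_val (Arith Less (Reg 3) (Reg 4)) ?s)" by (simp add: truthy_def)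
        moreover have "runs ?c ?s ?s' (3 * W + 2 * N + 30)"
        proof (rule runs_Assigns)
          show "store_after [(3, Arith Mul (Reg 3) (Reg 17)), (4, Arith Mul (Reg 4) (Reg 5)), (8, Arith Add (Reg 8) (num 1))] ?s = ?s'"
            using s True by (auto simp: fun_eq_iff J ac_simps)
          show "cost_of [(3, Arith Mul (Reg 3) (Reg 17)), (4, Arith Mul (Reg 4) (Reg 5)), (8, Arith Add (Reg 8) (num 1))] ?s
              \<le> 3 * W + 2 * N + 30"
            using s W floorlog_le[of "N + 1"] floorlog_le[of "N + 2"] floorlog_le[of "Suc 0"] by simp
        qed
        ultimately show ?thesis by simp
      next
        case False
        then have "\<not> truthy (expr_val (Arith Less (Reg 3) (Reg 4)) ?s)" by (simp add: truthy_def)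
        moreover have "?s' = ?s" using False by (simp add: J)
        ultimately show ?thesis by (simp add: runs_Skip)
      qed
    qed
  next
    show "expr_cost (Arith Mul (num 3) (Reg 6)) s \<le> K + 10"
      using s floorlog_le[of 3] floorlog_le[of K] by simp
  qed (use s in \<open>auto simp: fun_eq_iff J_def\<close>)
qed

section \<open>Counting edges and extending the adjacency rows\<close>

lemma enc_list_simps [simp]: "enc_list [] = Atom 0" "enc_list (v # vs) = Cell v (enc_list vs)"
  by (simp_all add: enc_list_def)

lemma left_val_drop: "j < length xs \<Longrightarrow> left_val (enc_list (drop j xs)) = xs ! j"
  by (simp add: Cons_nth_drop_Suc[symmetric])

lemma right_val_drop: "j < length xs \<Longrightarrow> right_val (enc_list (drop j xs)) = enc_list (drop (Suc j) xs)"
  by (simp add: Cons_nth_drop_Suc[symmetric])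

definition count_cells :: "val list \<Rightarrow> nat" where
  "count_cells vs = sum_list (map (\<lambda>v. of_bool (is_cell v)) vs)"

lemma count_cells_le: "count_cells vs \<le> length vs"
  by (induction vs) (auto simp: count_cells_def)

lemma count_cells_take_Suc:
  "j < length vs \<Longrightarrow> count_cells (take (Suc j) vs) = count_cells (take j vs) + of_bool (is_cell (vs ! j))"
  by (simp add: count_cells_def take_Suc_conv_app_nth)

definition Count_row :: com where
  "Count_row = For 9 (Reg 1)
     (Assigns [(11, Arith Add (Reg 11) (IsCell (Left (Reg 16)))), (16, Right (Reg 16))])"

lemma runs_Count_row:
  assumes s: "s 1 = Atom N" "s 9 = Atom 0" "s 11 = Atom c" "s 16 = enc_list ro" and ro: "length ro = N"
  shows "runs Count_row s (s(11 := Atom (c + count_cells ro), 16 := Atom 0)) (1 + N * ((c + N + 15) + N + 7) + 3)"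
proof -
  let ?f = "\<lambda>j. s(11 := Atom (c + count_cells (take j ro)), 16 := enc_list (drop j ro))"
  have "runs Count_row s (?f N) (1 + N * ((c + N + 15) + N + 7) + 3)"
    unfolding Count_row_def
  proof (rule runs_For[where f = ?f])
    fix j assume j: "j < N"
    have "c + count_cells (take j ro) \<le> c + N"
      using count_cells_le[of "take j ro"] j ro by simp
    then have "floorlog 2 (c + count_cells (take j ro)) \<le> c + N"
      using floorlog_le order_trans by blast
    then show "runs (Assigns [(11, Arith Add (Reg 11) (IsCell (Left (Reg 16)))), (16, Right (Reg 16))])
        ((?f j)(9 := Atom (N - j))) ((?f (Suc j))(9 := Atom (N - j))) (c + N + 15)"
      using s ro j floorlog_le[of "of_bool (is_cell (ro ! j))"]
      by (intro runs_Assigns)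
        (auto simp: fun_eq_iff left_val_drop right_val_drop count_cells_take_Suc)
  qed (use s ro in \<open>auto simp: fun_eq_iff count_cells_def\<close>)
  then show ?thesis using ro by simp
qed

definition Count :: com where
  "Count = Seq (Assigns [(29, Reg 2)])
     (For 7 (Reg 1) (Seq (Assigns [(16, Left (Reg 29)), (29, Right (Reg 29))]) Count_row))"

lemma runs_Count:
  assumes s: "s 1 = Atom N" "s 7 = Atom 0" "s 9 = Atom 0" "s 11 = Atom 0" "s 16 = Atom 0" "s 29 = Atom 0"
      "s 2 = enc_list (map enc_list rws)"
    and rws: "length rws = N" "\<forall>ro\<in>set rws. length ro = N"
  shows "runs Count s (s(11 := Atom (sum_list (map count_cells rws))))
    (2 + (1 + N * ((6 + (1 + N * ((N * N + N + 15) + N + 7) + 3)) + N + 7) + 3))"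
proof -
  let ?c = "\<lambda>j. sum_list (map count_cells (take j rws))"
  have c_le: "?c j \<le> N * N" if "j < N" for j
  proof -
    have "?c j \<le> (\<Sum>_\<leftarrow>take j rws. N)"
      using rws(2) by (intro sum_list_mono) (metis count_cells_le in_set_takeD)
    also have "\<dots> = min (length rws) j * N"
      by (simp add: sum_list_triv)
    also have "\<dots> \<le> N * N" using rws(1) by (intro mult_le_mono) auto
    finally show ?thesis .
  qed
  let ?f = "\<lambda>j. s(11 := Atom (?c j), 29 := enc_list (map enc_list (drop j rws)))"
  let ?B = "6 + (1 + N * ((N * N + N + 15) + N + 7) + 3)"
  have 1: "runs (Assigns [(29, Reg 2)]) s (?f 0) 2"
    by (rule runs_Assigns) (use s in \<open>auto simp: fun_eq_iff\<close>)
  have 2: "runs (For 7 (Reg 1) (Seq (Assigns [(16, Left (Reg 29)), (29, Right (Reg 29))]) Count_row)) (?f 0) (?f N)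
      (1 + N * (?B + N + 7) + 3)"
  proof (rule runs_For[where f = ?f])
    fix j assume j: "j < N"
    let ?s = "(?f j)(7 := Atom (N - j))"
    let ?s1 = "?s(16 := enc_list (rws ! j), 29 := enc_list (map enc_list (drop (Suc j) rws)))"
    have a: "runs (Assigns [(16, Left (Reg 29)), (29, Right (Reg 29))]) ?s ?s1 6"
      using j rws left_val_drop[of j "map enc_list rws"] right_val_drop[of j "map enc_list rws"]
      by (intro runs_Assigns) (auto simp: fun_eq_iff drop_map)
    have "runs Count_row ?s1 (?s1(11 := Atom (?c j + count_cells (rws ! j)), 16 := Atom 0))
        (1 + N * ((?c j + N + 15) + N + 7) + 3)"
      using s rws j by (intro runs_Count_row) auto
    then have b: "runs Count_row ?s1 (?s1(11 := Atom (?c j + count_cells (rws ! j)), 16 := Atom 0))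
        (1 + N * ((N * N + N + 15) + N + 7) + 3)"
      by (rule runs_mono) (use c_le[OF j] in auto)
    have "?s1(11 := Atom (?c j + count_cells (rws ! j)), 16 := Atom 0) = (?f (Suc j))(7 := Atom (N - j))"
      using s rws j by (auto simp: fun_eq_iff take_Suc_conv_app_nth)
    with a b show "runs (Seq (Assigns [(16, Left (Reg 29)), (29, Right (Reg 29))]) Count_row) ?s
        ((?f (Suc j))(7 := Atom (N - j))) ?B"
      by (auto intro: runs_Seq)
  qed (use s rws in auto)
  have "?f N = s(11 := Atom (sum_list (map count_cells rws)))"
    using s rws by (auto simp: fun_eq_iff)
  then show ?thesis
    using runs_Seq[OF 1 2 order_refl] unfolding Count_def by simp
qed

definition last_row :: "nat \<Rightarrow> val \<Rightarrow> val list \<Rightarrow> val" where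
  "last_row m kc ro = enc_list (replicate m kc @ replicate m (Atom 0) @ replicate m kc @ replicate m (Atom 0) @ ro)"

text \<open>The first loop extends the rows but stacks them in reverse order; the second restores
  the order.\<close>

definition Rows :: com where
  "Rows = Seq (For 7 (Reg 1) (Seq (Assigns [(16, Left (Reg 2)), (2, Right (Reg 2))])
       (Seq (Prefix 15 30 15 30 16) (Assigns [(22, MkCell (Reg 16) (Reg 22)), (16, num 0)]))))
     (For 7 (Reg 1) (Assigns [(23, MkCell (Left (Reg 22)) (Reg 23)), (22, Right (Reg 22))]))"

lemma runs_Rows:
  assumes s: "s 1 = Atom N" "s 7 = Atom 0" "s 9 = Atom 0" "s 12 = Atom m" "s 16 = Atom 0" "s 22 = Atom 0" "s 23 = Atom 0"
      "s 15 = kc" "s 30 = Atom 0" "s 2 = enc_list (map enc_list rws)"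
    and rws: "length rws = N"
  shows "runs Rows s (s(2 := Atom 0, 23 := enc_list (map (last_row m kc) rws)))
    ((1 + N * ((12 + 4 * (m * (m + 11) + 4)) + N + 7) + 3) + (1 + N * (8 + N + 7) + 3))"
proof -
  let ?R = "map (last_row m kc) rws"
  let ?f = "\<lambda>j. s(2 := enc_list (map enc_list (drop j rws)), 22 := enc_list (rev (take j ?R)))"
  let ?B = "12 + 4 * (m * (m + 11) + 4)"
  have 1: "runs (For 7 (Reg 1) (Seq (Assigns [(16, Left (Reg 2)), (2, Right (Reg 2))])
       (Seq (Prefix 15 30 15 30 16) (Assigns [(22, MkCell (Reg 16) (Reg 22)), (16, num 0)])))) s (?f N)
      (1 + N * (?B + N + 7) + 3)"
  proof (rule runs_For[where f = ?f])
    fix j assume j: "j < N"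
    let ?s = "(?f j)(7 := Atom (N - j))"
    let ?s1 = "?s(16 := enc_list (rws ! j), 2 := enc_list (map enc_list (drop (Suc j) rws)))"
    let ?s2 = "?s1(16 := last_row m kc (rws ! j))"
    have a: "runs (Assigns [(16, Left (Reg 2)), (2, Right (Reg 2))]) ?s ?s1 6"
      using j rws left_val_drop[of j "map enc_list rws"] right_val_drop[of j "map enc_list rws"]
      by (intro runs_Assigns) (auto simp: fun_eq_iff drop_map)
    have "runs (Prefix 15 30 15 30 16) ?s1 (?s1(16 := prepend m (?s1 15) (prepend m (?s1 30)
        (prepend m (?s1 15) (prepend m (?s1 30) (?s1 16)))))) (4 * (m * (m + 11) + 4))"
      using s by (intro runs_Prefix) auto
    then have b: "runs (Prefix 15 30 15 30 16) ?s1 ?s2 (4 * (m * (m + 11) + 4))"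
      using s by (simp add: last_row_def prepend_enc_list)
    have c: "runs (Assigns [(22, MkCell (Reg 16) (Reg 22)), (16, num 0)]) ?s2 ((?f (Suc j))(7 := Atom (N - j))) 6"
      using s rws j by (intro runs_Assigns) (auto simp: fun_eq_iff take_Suc_conv_app_nth)
    show "runs (Seq (Assigns [(16, Left (Reg 2)), (2, Right (Reg 2))])
       (Seq (Prefix 15 30 15 30 16) (Assigns [(22, MkCell (Reg 16) (Reg 22)), (16, num 0)]))) ?s
        ((?f (Suc j))(7 := Atom (N - j))) ?B"
      by (rule runs_Seq[OF a runs_Seq[OF b c order_refl]]) simp
  qed (use s rws in \<open>auto simp: fun_eq_iff\<close>)
  let ?g = "\<lambda>j. s(2 := Atom 0, 22 := enc_list (drop j (rev ?R)), 23 := enc_list (rev (take j (rev ?R))))"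
  have 2: "runs (For 7 (Reg 1) (Assigns [(23, MkCell (Left (Reg 22)) (Reg 23)), (22, Right (Reg 22))])) (?f N) (?g N)
      (1 + N * (8 + N + 7) + 3)"
  proof (rule runs_For[where f = ?g])
    fix j assume j: "j < N"
    show "runs (Assigns [(23, MkCell (Left (Reg 22)) (Reg 23)), (22, Right (Reg 22))])
        ((?g j)(7 := Atom (N - j))) ((?g (Suc j))(7 := Atom (N - j))) 8"
      using s rws j left_val_drop[of j "rev ?R"] right_val_drop[of j "rev ?R"] take_Suc_conv_app_nth[of j "rev ?R"]
      by (intro runs_Assigns) (auto simp: fun_eq_iff)
  qed (use s rws in \<open>auto simp: fun_eq_iff\<close>)
  have "?g N = s(2 := Atom 0, 23 := enc_list ?R)"
    using s rws by (auto simp: fun_eq_iff)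
  then show ?thesis
    using runs_Seq[OF 1 2 order_refl] unfolding Rows_def by simp
qed

section \<open>Writing down the gadget\<close>

text \<open>The code of the negative number \<open>- p / q\<close>, provided that the fraction is
  positive and in lowest terms.\<close>

definition frac_val :: "nat \<Rightarrow> nat \<Rightarrow> val" where
  "frac_val p q = Cell (Cell (Atom 1) (Atom p)) (Atom q)"

definition zero_val :: val where
  "zero_val = Cell (Cell (Atom 0) (Atom 0)) (Atom 1)"

lemma enc_real_of_rat: "enc_real (of_rat q) = enc_rat q"
  by (simp add: enc_real_def)

lemma enc_real_neg_frac:
  assumes "coprime p q" "p > 0" "q > 0"
  shows "enc_real (- (real p / real q)) = frac_val p q"
proof -
  have "- (real p / real q) = of_rat (Fract (- int p) (int q))"
    using assms(3) by (simp add: of_rat_rat)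
  moreover have "quotient_of (Fract (- int p) (int q)) = (- int p, int q)"
    using assms by (simp add: quotient_of_Fract normalize_stable)
  ultimately show ?thesis
    using assms(2) by (simp add: enc_real_of_rat enc_rat_def frac_val_def)
qed

lemma enc_real_zero: "enc_real 0 = zero_val"
  using enc_real_of_rat[of 0] by (simp add: enc_rat_def zero_val_def)

lemma is_cell_enc_real: "is_cell (enc_real x)"
  by (simp add: enc_real_def enc_rat_def split: prod.split)

definition entry_val :: "real \<Rightarrow> val" where
  "entry_val w = (if w = 0 then Atom 0 else enc_real w)"

lemma map_upt_const:
  assumes "\<And>u. a \<le> u \<Longrightarrow> u < b \<Longrightarrow> f u = v"
  shows "map f [a..<b] = replicate (b - a) v"
  using assms by (intro nth_equalityI) auto

lemma map_upt_blocks: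
  assumes "\<And>a u. a < 4 \<Longrightarrow> u \<in> block m N a \<Longrightarrow> f u = h a"
  shows "map f [0..<4 * m + N] = replicate m (h 0) @ replicate m (h 1) @ replicate m (h 2) @ replicate m (h 3)
    @ map (\<lambda>i. f (4 * m + i)) [0..<N]"
proof -
  have split: "[i..<k] = [i..<j] @ [j..<k]" if "i \<le> j" "j \<le> k" for i j k :: nat
    using upt_add_eq_append[of i j "k - j"] that by simp
  have "[0..<4 * m + N] = [0..<m] @ [m..<2 * m] @ [2 * m..<3 * m] @ [3 * m..<4 * m] @ [4 * m..<4 * m + N]"
    using split[of 0 m "4 * m + N"] split[of m "2 * m" "4 * m + N"]
      split[of "2 * m" "3 * m" "4 * m + N"] split[of "3 * m" "4 * m" "4 * m + N"] by simp
  moreover have "map f [4 * m..<4 * m + N] = map (\<lambda>i. f (4 * m + i)) [0..<N]"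
    by (intro nth_equalityI) auto
  moreover have "map f [0..<m] = replicate (m - 0) (h 0)" "map f [m..<2 * m] = replicate (2 * m - m) (h 1)"
      "map f [2 * m..<3 * m] = replicate (3 * m - 2 * m) (h 2)" "map f [3 * m..<4 * m] = replicate (4 * m - 3 * m) (h 3)"
    by (intro map_upt_const assms; simp add: block_def)+
  ultimately show ?thesis by simp
qed

lemma enc_model_model_of:
  assumes "\<And>u v. W u v = W v u" "\<And>u. W u u = 0"
  shows "enc_model (model_of n W) = Cell (Atom n)
    (Cell (enc_list (map (\<lambda>u. enc_list (map (\<lambda>v. entry_val (W u v)) [0..<n])) [0..<n]))
      (enc_list (map (\<lambda>_. Cell zero_val zero_val) [0..<n])))"
proof -
  have "(if {u, v} \<in> edges (model_of n W) then enc_real (coupling (model_of n W) {u, v}) else Atom 0) = entry_val (W u v)"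
    if "u < n" "v < n" for u v
    using that edges_model_of_iff[OF assms(1), where n = n and u = u and v = v]
      coupling_model_of[OF assms(1), where n = n and u = u and v = v] assms(2)
    by (auto simp: entry_val_def)
  then have "map (\<lambda>u. enc_list (map (\<lambda>v. if {u, v} \<in> edges (model_of n W)
        then enc_real (coupling (model_of n W) {u, v}) else Atom 0) [0..<n])) [0..<n]
      = map (\<lambda>u. enc_list (map (\<lambda>v. entry_val (W u v)) [0..<n])) [0..<n]"
    by (intro map_cong refl arg_cong[where f = enc_list]) auto
  then show ?thesis
    by (simp only: enc_model_def Let_def enc_real_zero nverts_model_of ext_field_model_of)
qed

text \<open>Brings the code of the gadget into the shape in which the program writes it: four rows
  repeated \<open>m\<close> times each, and \<open>N\<close> individual ones.\<close>

lemma enc_model_gadget: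
  assumes g: "\<And>u v. g u v = g v u" "\<And>u. g u u = 0"
    and b: "entry_val (- \<beta>) = bv" "entry_val (- \<omega>) = wv" "entry_val (- \<kappa>) = kv"
  shows "enc_model (gadget m N g \<beta> \<omega> \<kappa>) = Cell (Atom (4 * m + N))
    (Cell (enc_list (replicate m (block_list m N (Atom 0) bv wv (Atom 0) kv)
        @ replicate m (block_list m N bv (Atom 0) (Atom 0) (Atom 0) (Atom 0))
        @ replicate m (block_list m N wv (Atom 0) (Atom 0) bv kv)
        @ replicate m (block_list m N (Atom 0) (Atom 0) bv (Atom 0) (Atom 0))
        @ map (\<lambda>i. last_row m kv (map (\<lambda>j. entry_val (g i j)) [0..<N])) [0..<N]))
      (block_list m N (Cell zero_val zero_val) (Cell zero_val zero_val) (Cell zero_val zero_val)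
        (Cell zero_val zero_val) (Cell zero_val zero_val)))"
proof -
  let ?J = "gadget_table \<beta> \<omega> \<kappa>"
  let ?W = "block_coupling m g ?J" and ?n = "4 * m + N"
  have sym: "?W u v = ?W v u" for u v
    by (rule block_coupling_sym[where g = g and J = ?J]) (rule g gadget_table_sym)+
  have diag: "?W u u = 0" for u
    by (simp add: block_coupling_def g(2) gadget_table_diag)
  let ?r = "\<lambda>u. enc_list (map (\<lambda>v. entry_val (?W u v)) [0..<?n])"
  have J: "entry_val (?J 0 0) = Atom 0" "entry_val (?J 0 1) = bv" "entry_val (?J 0 2) = wv" "entry_val (?J 0 3) = Atom 0"
    "entry_val (?J 0 4) = kv" "entry_val (?J 1 0) = bv" "entry_val (?J 1 1) = Atom 0" "entry_val (?J 1 2) = Atom 0"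
    "entry_val (?J 1 3) = Atom 0" "entry_val (?J 1 4) = Atom 0" "entry_val (?J 2 0) = wv" "entry_val (?J 2 1) = Atom 0"
    "entry_val (?J 2 2) = Atom 0" "entry_val (?J 2 3) = bv" "entry_val (?J 2 4) = kv" "entry_val (?J 3 0) = Atom 0"
    "entry_val (?J 3 1) = Atom 0" "entry_val (?J 3 2) = bv" "entry_val (?J 3 3) = Atom 0" "entry_val (?J 3 4) = Atom 0"
    "entry_val (?J 4 0) = kv" "entry_val (?J 4 1) = Atom 0" "entry_val (?J 4 2) = kv" "entry_val (?J 4 3) = Atom 0"
    using b by (simp_all add: gadget_table_def doubleton_eq_iff) (simp_all add: entry_val_def)
  have W: "?W u v = ?J a c" if "u \<in> block m N a" "v \<in> block m N c" "a < 5" "c < 5" "a < 4 \<or> c < 4" for u v a c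
    using that block_of_eq[OF that(1,3)] block_of_eq[OF that(2,4)]
    by (auto simp: block_coupling_def block_of_def split: if_splits)
  have last: "4 * m + i \<in> block m N 4" if "i < N" for i
    using that by (simp add: block_def)
  have r: "?r u = block_list m N (entry_val (?J a 0)) (entry_val (?J a 1)) (entry_val (?J a 2)) (entry_val (?J a 3)) (entry_val (?J a 4))"
    if a: "a < 4" "u \<in> block m N a" for a u
  proof -
    have "map (\<lambda>v. entry_val (?W u v)) [0..<?n] = replicate m (entry_val (?J a 0)) @ replicate m (entry_val (?J a 1))
        @ replicate m (entry_val (?J a 2)) @ replicate m (entry_val (?J a 3)) @ map (\<lambda>i. entry_val (?W u (4 * m + i))) [0..<N]"
      using W[OF a(2)] a(1) by (intro map_upt_blocks[where h = "\<lambda>c. entry_val (?J a c)"]) auto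
    also have "map (\<lambda>i. entry_val (?W u (4 * m + i))) [0..<N] = replicate N (entry_val (?J a 4))"
      using map_upt_const[of 0 N "\<lambda>i. entry_val (?W u (4 * m + i))" "entry_val (?J a 4)"] W[OF a(2) last] a(1) by simp
    finally show ?thesis by (simp add: block_list_def)
  qed
  have r4: "?r (4 * m + i) = last_row m kv (map (\<lambda>j. entry_val (g i j)) [0..<N])" if i: "i < N" for i
  proof -
    have "map (\<lambda>v. entry_val (?W (4 * m + i) v)) [0..<?n] = replicate m (entry_val (?J 4 0)) @ replicate m (entry_val (?J 4 1))
        @ replicate m (entry_val (?J 4 2)) @ replicate m (entry_val (?J 4 3)) @ map (\<lambda>j. entry_val (?W (4 * m + i) (4 * m + j))) [0..<N]"
      using W[OF last[OF i]] by (intro map_upt_blocks[where h = "\<lambda>c. entry_val (?J 4 c)"]) auto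
    then show ?thesis
      by (simp add: last_row_def J J[unfolded One_nat_def] block_coupling_def)
  qed
  have "map ?r [0..<?n] = replicate m (block_list m N (Atom 0) bv wv (Atom 0) kv)
        @ replicate m (block_list m N bv (Atom 0) (Atom 0) (Atom 0) (Atom 0))
        @ replicate m (block_list m N wv (Atom 0) (Atom 0) bv kv)
        @ replicate m (block_list m N (Atom 0) (Atom 0) bv (Atom 0) (Atom 0))
        @ map (\<lambda>i. ?r (4 * m + i)) [0..<N]"
    by (subst map_upt_blocks[where h = "\<lambda>a. block_list m N (entry_val (?J a 0)) (entry_val (?J a 1)) (entry_val (?J a 2))
        (entry_val (?J a 3)) (entry_val (?J a 4))"]) (erule r, assumption, simp only: J)
  also have "map (\<lambda>i. ?r (4 * m + i)) [0..<N] = map (\<lambda>i. last_row m kv (map (\<lambda>j. entry_val (g i j)) [0..<N])) [0..<N]"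
    using r4 by (intro map_cong) auto
  finally have R: "map ?r [0..<?n] = replicate m (block_list m N (Atom 0) bv wv (Atom 0) kv)
        @ replicate m (block_list m N bv (Atom 0) (Atom 0) (Atom 0) (Atom 0))
        @ replicate m (block_list m N wv (Atom 0) (Atom 0) bv kv)
        @ replicate m (block_list m N (Atom 0) (Atom 0) bv (Atom 0) (Atom 0))
        @ map (\<lambda>i. last_row m kv (map (\<lambda>j. entry_val (g i j)) [0..<N])) [0..<N]" .
  have F: "enc_list (map (\<lambda>_. Cell zero_val zero_val) [0..<?n])
      = block_list m N (Cell zero_val zero_val) (Cell zero_val zero_val) (Cell zero_val zero_val)
        (Cell zero_val zero_val) (Cell zero_val zero_val)"
    by (subst map_upt_blocks[where h = "\<lambda>_. Cell zero_val zero_val"])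
      (simp_all add: block_list_def map_replicate_const)
  show ?thesis
    unfolding gadget_def enc_model_model_of[where W = ?W, OF sym diag] R F ..
qed

lemma enc_config_special:
  "enc_config (4 * m + N) (special m N c)
    = block_list m N (Atom c) (Atom (3 - c)) (Atom c) (Atom (3 - c)) (Atom (3 - c))"
proof -
  let ?h = "\<lambda>a::nat. if a \<in> {0, 2} then Atom c else Atom (3 - c)"
  have "map (\<lambda>v. Atom (special m N c v)) [0..<4 * m + N] = replicate m (?h 0) @ replicate m (?h 1) @ replicate m (?h 2)
      @ replicate m (?h 3) @ map (\<lambda>i. Atom (special m N c (4 * m + i))) [0..<N]"
  proof (rule map_upt_blocks[where h = ?h])
    fix a u assume a: "(a::nat) < 4" "u \<in> block m N a"
    then consider "a = 0" | "a = 1" | "a = 2" | "a = 3" by linarith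
    then show "Atom (special m N c u) = ?h a"
      using conf_block[of u m N c c "\<lambda>_. 3 - c"] a(2) by cases (auto simp: special_def)
  qed
  also have "map (\<lambda>i. Atom (special m N c (4 * m + i))) [0..<N] = replicate N (Atom (3 - c))"
    using map_upt_const[of 0 N "\<lambda>i. Atom (special m N c (4 * m + i))"] by (simp add: special_def conf_def)
  finally show ?thesis by (simp add: enc_config_def block_list_def)
qed

section \<open>Computing the parameters of the gadget\<close>

definition params :: "nat \<Rightarrow> (nat \<times> expr) list" where
  "params L = [(12, Arith Mul (num L) (Arith Mul (Reg 5) (Reg 5))), (13, Arith Mul (Reg 12) (Reg 12)),
     (14, Arith Add (Arith Sub (Arith Sub (Arith Mul (num L) (Arith Mul (Reg 1) (Reg 5))) (Reg 1))
        (Arith Div (Arith Mul (num 3) (Reg 11)) (num 10))) (Arith Div (Reg 8) (Reg 5))),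
     (14, MkCell (MkCell (num 1) (Arith Add (Arith Mul (Reg 13) (Reg 14)) (num 1))) (Arith Mul (Reg 13) (Reg 13))),
     (15, MkCell (MkCell (num 1) (num 1)) (Reg 5)),
     (31, Lit (frac_val 10 1)), (32, num 1), (33, num 2), (34, Lit (Cell zero_val zero_val))]"

text \<open>The coupling \<open>\<omega>\<close> is \<open>(D u + 1) / D\<^sup>2\<close> with \<open>D = m\<^sup>2\<close>: the total coupling \<open>m\<^sup>2 \<omega>\<close> is \<open>u\<close> up to an error of
  \<open>1/D\<close>, and the fraction is in lowest terms, as the encoding of rationals requires.\<close>

definition gadget_size :: "nat \<Rightarrow> nat \<Rightarrow> nat" where
  "gadget_size L N = L * ((N + 1) * (N + 1))"

text \<open>The target \<open>y * N - 3 / 10 * cnt - ln Zhat\<close> rounded to a natural number,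
  where the search supplies \<open>N - j / (N + 1)\<close> in place of
  \<open>ln Zhat\<close>.\<close>

definition balance :: "nat \<Rightarrow> nat \<Rightarrow> nat \<Rightarrow> nat \<Rightarrow> nat" where
  "balance L N cnt j = L * (N * (N + 1)) - N - 3 * cnt div 10 + j div (N + 1)"

definition params_cost :: "nat \<Rightarrow> nat \<Rightarrow> nat \<Rightarrow> nat \<Rightarrow> nat" where
  "params_cost L N cnt j = (let D = gadget_size L N * gadget_size L N in
     200 + 40 * (D * D + D * balance L N cnt j + L + (N + 1) * (N + 1) + gadget_size L N + L * (N * (N + 1)) + N + N * (N + 1)
       + 3 * cnt + j + 12 + D + balance L N cnt j))"

lemma runs_params:
  fixes L :: nat
  assumes s: "s 1 = Atom N" "s 5 = Atom (N + 1)" "s 8 = Atom j" "s 11 = Atom cnt"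
  defines "m \<equiv> gadget_size L N" and "u \<equiv> balance L N cnt j"
  shows "runs (Assigns (params L)) s
    (s(12 := Atom m, 13 := Atom (m * m), 14 := frac_val (m * m * u + 1) (m * m * (m * m)), 15 := frac_val 1 (N + 1),
       31 := frac_val 10 1, 32 := Atom 1, 33 := Atom 2, 34 := Cell zero_val zero_val)) (params_cost L N cnt j)"
proof (rule runs_Assigns)
  show "store_after (params L) s = s(12 := Atom m, 13 := Atom (m * m), 14 := frac_val (m * m * u + 1) (m * m * (m * m)), 15 := frac_val 1 (N + 1),
       31 := frac_val 10 1, 32 := Atom 1, 33 := Atom 2, 34 := Cell zero_val zero_val)"
    using s by (simp add: params_def m_def u_def gadget_size_def balance_def frac_val_def)
  \<comment> \<open>A single number bounding all operands, and by \<open>floorlog_le\<close> also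
    their bit lengths. This is generous, but only polynomial growth matters.\<close>
  define V where "V = m * m * (m * m) + m * m * u + L + (N + 1) * (N + 1) + m + L * (N * (N + 1)) + N + N * (N + 1)
       + 3 * cnt + j + 12 + m * m + u"
  have fl: "floorlog 2 x \<le> V" if "x \<le> V" for x
    using floorlog_le[of x] that by linarith
  have d: "x div y \<le> x" for x y :: nat by (rule div_le_dividend)
  have "cost_of (params L) s = 54
      + floorlog 2 L + floorlog 2 ((N + 1) * (N + 1)) + floorlog 2 (N + 1) + floorlog 2 (N + 1)
      + floorlog 2 m + floorlog 2 m
      + floorlog 2 L + floorlog 2 (N * (N + 1)) + floorlog 2 N + floorlog 2 (N + 1)
      + floorlog 2 (L * (N * (N + 1))) + floorlog 2 N
      + floorlog 2 (L * (N * (N + 1)) - N) + floorlog 2 (3 * cnt div 10)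
      + floorlog 2 (3 * cnt) + floorlog 2 10 + floorlog 2 3 + floorlog 2 cnt
      + floorlog 2 j + floorlog 2 (N + 1)
      + floorlog 2 (L * (N * (N + 1)) - N - 3 * cnt div 10) + floorlog 2 (j div (N + 1))
      + floorlog 2 (m * m) + floorlog 2 u + floorlog 2 (m * m * u) + floorlog 2 1
      + floorlog 2 (m * m) + floorlog 2 (m * m)"
    using s by (simp add: params_def m_def u_def gadget_size_def balance_def)
  also have "\<dots> \<le> 200 + 40 * V"
  proof -
    have a: "x \<le> V" if "x \<le> L * (N * (N + 1)) \<or> x \<le> 3 * cnt \<or> x \<le> j" for x
      using that unfolding V_def by linarith
    have "floorlog 2 L \<le> V" "floorlog 2 ((N + 1) * (N + 1)) \<le> V" "floorlog 2 (N + 1) \<le> V" "floorlog 2 m \<le> V"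
        "floorlog 2 (N * (N + 1)) \<le> V" "floorlog 2 N \<le> V" "floorlog 2 10 \<le> V" "floorlog 2 3 \<le> V" "floorlog 2 1 \<le> V"
        "floorlog 2 (m * m) \<le> V" "floorlog 2 u \<le> V" "floorlog 2 (m * m * u) \<le> V"
      by (rule fl, use V_def in linarith)+
    moreover have "floorlog 2 (L * (N * (N + 1))) \<le> V" "floorlog 2 (L * (N * (N + 1)) - N) \<le> V"
        "floorlog 2 (L * (N * (N + 1)) - N - 3 * cnt div 10) \<le> V" "floorlog 2 (3 * cnt div 10) \<le> V"
        "floorlog 2 (3 * cnt) \<le> V" "floorlog 2 cnt \<le> V" "floorlog 2 j \<le> V" "floorlog 2 (j div (N + 1)) \<le> V"
      using d[of "3 * cnt" 10] d[of j "N + 1"] by (intro fl a; simp)+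
    ultimately show ?thesis by linarith
  qed
  finally show "cost_of (params L) s \<le> params_cost L N cnt j"
    by (simp add: params_cost_def Let_def V_def m_def u_def)
qed

definition Build :: "nat \<Rightarrow> com" where
  "Build L = Seq Count (Seq (Assigns (params L)) (Seq (Blocks 30 31 14 30 15 18) (Seq (Blocks 31 30 30 30 30 19)
     (Seq (Blocks 14 30 30 31 15 20) (Seq (Blocks 30 30 31 30 30 21) (Seq (Blocks 32 33 32 33 33 24)
     (Seq (Blocks 33 32 33 32 32 25) (Seq (Blocks 34 34 34 34 34 26) (Seq Rows (Seq (Prefix 18 19 20 21 23)
     (Assigns [(27, MkCell (Arith Add (Arith Mul (num 4) (Reg 12)) (Reg 1)) (MkCell (Reg 23) (Reg 26)))])))))))))))"

definition build_cost :: "nat \<Rightarrow> nat \<Rightarrow> nat \<Rightarrow> nat \<Rightarrow> nat" where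
  "build_cost L N cnt j = (let m = gadget_size L N in
     (2 + (1 + N * ((6 + (1 + N * ((N * N + N + 15) + N + 7) + 3)) + N + 7) + 3)) + params_cost L N cnt j
     + 7 * (4 * (m * (m + 11) + 4) + N * (N + 11) + 6)
     + ((1 + N * ((12 + 4 * (m * (m + 11) + 4)) + N + 7) + 3) + (1 + N * (8 + N + 7) + 3))
     + 4 * (m * (m + 11) + 4) + (20 + 5 * m + N))"

lemma runs_Build:
  fixes L :: nat
  assumes s: "s 1 = Atom N" "s 2 = enc_list (map enc_list rws)" "s 5 = Atom (N + 1)" "s 8 = Atom j"
      "\<forall>i\<in>{7, 9, 11, 16, 22, 23, 29, 30}. s i = Atom 0"
    and rws: "length rws = N" "\<forall>ro\<in>set rws. length ro = N"
  defines "m \<equiv> gadget_size L N" and "cnt \<equiv> sum_list (map count_cells rws)"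
  defines "u \<equiv> balance L N cnt j"
  defines "bv \<equiv> frac_val 10 1" and "wv \<equiv> frac_val (m * m * u + 1) (m * m * (m * m))" and "kv \<equiv> frac_val 1 (N + 1)"
    and "zv \<equiv> Cell zero_val zero_val"
  shows "\<exists>s'. runs (Build L) s s' (build_cost L N cnt j)
    \<and> s' 27 = Cell (Atom (4 * m + N))
    (Cell (enc_list (replicate m (block_list m N (Atom 0) bv wv (Atom 0) kv)
        @ replicate m (block_list m N bv (Atom 0) (Atom 0) (Atom 0) (Atom 0))
        @ replicate m (block_list m N wv (Atom 0) (Atom 0) bv kv)
        @ replicate m (block_list m N (Atom 0) (Atom 0) bv (Atom 0) (Atom 0))
        @ map (last_row m kv) rws))
      (block_list m N zv zv zv zv zv))
    \<and> s' 24 = block_list m N (Atom 1) (Atom 2) (Atom 1) (Atom 2) (Atom 2)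
    \<and> s' 25 = block_list m N (Atom 2) (Atom 1) (Atom 2) (Atom 1) (Atom 1)"
proof -
  let ?Tb = "4 * (m * (m + 11) + 4) + N * (N + 11) + 6"
  let ?bl = "block_list m N" and ?o = "Atom 0"
  define s1 where "s1 = s(11 := Atom cnt)"
  define s2 where "s2 = s1(12 := Atom m, 13 := Atom (m * m), 14 := wv, 15 := kv,
       31 := bv, 32 := Atom 1, 33 := Atom 2, 34 := zv)"
  define s3 where "s3 = s2(18 := ?bl ?o bv wv ?o kv)"
  define s4 where "s4 = s3(19 := ?bl bv ?o ?o ?o ?o)"
  define s5 where "s5 = s4(20 := ?bl wv ?o ?o bv kv)"
  define s6 where "s6 = s5(21 := ?bl ?o ?o bv ?o ?o)"
  define s7 where "s7 = s6(24 := ?bl (Atom 1) (Atom 2) (Atom 1) (Atom 2) (Atom 2))"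
  define s8 where "s8 = s7(25 := ?bl (Atom 2) (Atom 1) (Atom 2) (Atom 1) (Atom 1))"
  define s9 where "s9 = s8(26 := ?bl zv zv zv zv zv)"
  define s10 where "s10 = s9(2 := Atom 0, 23 := enc_list (map (last_row m kv) rws))"
  define mat where "mat = enc_list (replicate m (?bl ?o bv wv ?o kv) @ replicate m (?bl bv ?o ?o ?o ?o)
      @ replicate m (?bl wv ?o ?o bv kv) @ replicate m (?bl ?o ?o bv ?o ?o) @ map (last_row m kv) rws)"
  define s11 where "s11 = s10(23 := mat)"
  define s12 where "s12 = s11(27 := Cell (Atom (4 * m + N)) (Cell mat (?bl zv zv zv zv zv)))"
  note defs = s1_def s2_def s3_def s4_def s5_def s6_def s7_def s8_def s9_def s10_def s11_def s12_def
  have r1: "runs Count s s1 (2 + (1 + N * ((6 + (1 + N * ((N * N + N + 15) + N + 7) + 3)) + N + 7) + 3))"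
    unfolding s1_def cnt_def using s rws by (intro runs_Count) auto
  have r2: "runs (Assigns (params L)) s1 s2 (params_cost L N cnt j)"
    unfolding s2_def wv_def kv_def bv_def zv_def m_def u_def
    using s by (intro runs_params) (auto simp: s1_def)
  have v2: "s2 1 = Atom N" "s2 2 = enc_list (map enc_list rws)" "s2 12 = Atom m" "s2 9 = ?o" "s2 7 = ?o"
      "s2 16 = ?o" "s2 22 = ?o" "s2 23 = ?o" "s2 30 = ?o" "s2 14 = wv" "s2 15 = kv" "s2 31 = bv" "s2 32 = Atom 1"
      "s2 33 = Atom 2" "s2 34 = zv"
    using s by (simp_all add: s1_def s2_def)
  have r3: "runs (Blocks 30 31 14 30 15 18) s2 s3 ?Tb"
    using runs_Blocks[of s2 m N 30 31 14 30 15 18] v2 by (simp add: s3_def)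
  have r4: "runs (Blocks 31 30 30 30 30 19) s3 s4 ?Tb"
    using runs_Blocks[of s3 m N 31 30 30 30 30 19] v2 by (simp add: s3_def s4_def)
  have r5: "runs (Blocks 14 30 30 31 15 20) s4 s5 ?Tb"
    using runs_Blocks[of s4 m N 14 30 30 31 15 20] v2 by (simp add: s3_def s4_def s5_def)
  have r6: "runs (Blocks 30 30 31 30 30 21) s5 s6 ?Tb"
    using runs_Blocks[of s5 m N 30 30 31 30 30 21] v2 by (simp add: s3_def s4_def s5_def s6_def)
  have r7: "runs (Blocks 32 33 32 33 33 24) s6 s7 ?Tb"
    using runs_Blocks[of s6 m N 32 33 32 33 33 24] v2 by (simp add: s3_def s4_def s5_def s6_def s7_def)
  have r8: "runs (Blocks 33 32 33 32 32 25) s7 s8 ?Tb"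
    using runs_Blocks[of s7 m N 33 32 33 32 32 25] v2 by (simp add: s3_def s4_def s5_def s6_def s7_def s8_def)
  have r9: "runs (Blocks 34 34 34 34 34 26) s8 s9 ?Tb"
    using runs_Blocks[of s8 m N 34 34 34 34 34 26] v2 by (simp add: s3_def s4_def s5_def s6_def s7_def s8_def s9_def)
  have r10: "runs Rows s9 s10 ((1 + N * ((12 + 4 * (m * (m + 11) + 4)) + N + 7) + 3) + (1 + N * (8 + N + 7) + 3))"
    unfolding s10_def using v2 rws
    by (intro runs_Rows) (simp_all add: s3_def s4_def s5_def s6_def s7_def s8_def s9_def)
  have v10: "s10 12 = Atom m" "s10 9 = ?o" "s10 18 = ?bl ?o bv wv ?o kv" "s10 19 = ?bl bv ?o ?o ?o ?o"
      "s10 20 = ?bl wv ?o ?o bv kv" "s10 21 = ?bl ?o ?o bv ?o ?o" "s10 23 = enc_list (map (last_row m kv) rws)"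
      "s10 1 = Atom N" "s10 26 = ?bl zv zv zv zv zv"
    using v2 by (simp_all add: s3_def s4_def s5_def s6_def s7_def s8_def s9_def s10_def)
  have r11: "runs (Prefix 18 19 20 21 23) s10 s11 (4 * (m * (m + 11) + 4))"
    using runs_Prefix[of s10 m 18 19 20 21 23] v10 by (simp add: s11_def mat_def prepend_enc_list)
  have r12: "runs (Assigns [(27, MkCell (Arith Add (Arith Mul (num 4) (Reg 12)) (Reg 1)) (MkCell (Reg 23) (Reg 26)))])
      s11 s12 (20 + 5 * m + N)"
    unfolding s12_def using v10 floorlog_le[of m] floorlog_le[of N] floorlog_le[of "4 * m"] floorlog_le[of 4]
    by (intro runs_Assigns) (simp_all add: s11_def)
  have "runs (Build L) s s12 (build_cost L N cnt j)"
    unfolding Build_def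
    by (rule runs_Seq[OF r1 runs_Seq[OF r2 runs_Seq[OF r3 runs_Seq[OF r4 runs_Seq[OF r5 runs_Seq[OF r6 runs_Seq[OF r7
      runs_Seq[OF r8 runs_Seq[OF r9 runs_Seq[OF r10 runs_Seq[OF r11 r12 order_refl] order_refl] order_refl] order_refl]
      order_refl] order_refl] order_refl] order_refl] order_refl] order_refl]])
      (simp add: build_cost_def Let_def flip: m_def)
  moreover have "s12 27 = Cell (Atom (4 * m + N)) (Cell mat (?bl zv zv zv zv zv))"
    "s12 24 = ?bl (Atom 1) (Atom 2) (Atom 1) (Atom 2) (Atom 2)"
    "s12 25 = ?bl (Atom 2) (Atom 1) (Atom 2) (Atom 1) (Atom 1)"
    by (simp_all add: s7_def s8_def s9_def s10_def s11_def s12_def)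
  ultimately show ?thesis
    unfolding mat_def by blast
qed

section \<open>Error and size estimates\<close>

text \<open>An idle round means that the inequality has failed, a counted one that it held just
  before: the counter is the least solution, unless the rounds ran out.\<close>

lemma steps_up_spec:
  fixes Q P M :: nat
  defines "J \<equiv> steps_up Q P M"
  shows "(J i < i \<longrightarrow> P * M ^ J i \<le> Q * (M + 1) ^ J i) \<and>
    (J i > 0 \<longrightarrow> Q * (M + 1) ^ (J i - 1) < P * M ^ (J i - 1))"
proof (induction i)
  case (Suc i)
  have "J i \<le> i" unfolding J_def by (rule steps_up_le)
  moreover have "J (Suc i) = (if Q * (M + 1) ^ J i < P * M ^ J i then J i + 1 else J i)"
    by (simp add: J_def Let_def)
  ultimately show ?case using Suc by auto
qed (simp add: J_def)

lemma ln_one_plus_inverse_bounds: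
  fixes M :: real
  assumes "M \<ge> 1"
  shows "1 / (M + 1) \<le> ln (1 + 1 / M)" "ln (1 + 1 / M) \<le> 1 / M"
proof -
  show "ln (1 + 1 / M) \<le> 1 / M"
    using assms by (intro ln_add_one_self_le_self) auto
  have "ln (M / (M + 1)) \<le> M / (M + 1) - 1"
    using assms by (intro ln_le_minus_one) auto
  also have "\<dots> = - (1 / (M + 1))"
    using assms by (simp add: field_simps)
  finally have "1 / (M + 1) \<le> - ln (M / (M + 1))" by simp
  also have "\<dots> = ln (1 + 1 / M)"
  proof -
    have "1 + 1 / M = (M + 1) / M" using assms by (simp add: field_simps)
    then show ?thesis using assms by (simp add: ln_div)
  qed
  finally show "1 / (M + 1) \<le> ln (1 + 1 / M)" .
qed

text \<open>With \<open>z = ln (1 + 1/M)\<close> this is the search for an integer \<open>j\<close> with \<open>(K - j) z\<close> close to \<open>ln (a/b)\<close>;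
  since \<open>1/(M + 1) \<le> z \<le> 1/M\<close> one may then replace \<open>z\<close> by \<open>1/M\<close>.\<close>

lemma log_search:
  fixes a b N j :: nat
  defines "M \<equiv> N + 1"
  defines "K \<equiv> M * N"
  assumes ab: "a > 0" "b > 0" and j: "j \<le> 3 * K"
    and upper: "a * M ^ K \<le> b * (M + 1) ^ K"
    and lower: "b * (M + 1) ^ K * M ^ j \<le> a * M ^ K * (M + 1) ^ j"
    and tight: "j > 0 \<Longrightarrow> a * M ^ K * (M + 1) ^ (j - 1) < b * (M + 1) ^ K * M ^ (j - 1)"
  shows "\<bar>real N - real j / real M - ln (real a / real b)\<bar> \<le> 3"
proof -
  define z where "z = ln (1 + 1 / real M)"
  define l where "l = ln (real a / real b)"
  have M: "real M \<ge> 1" by (simp add: M_def)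
  have z: "1 / (real M + 1) \<le> z" "z \<le> 1 / real M"
    unfolding z_def by (rule ln_one_plus_inverse_bounds[OF M])+
  have "ln (real M + 1) = z + ln (real M)"
  proof -
    have "1 + 1 / real M = (real M + 1) / real M" using M by (simp add: field_simps)
    then show ?thesis using M by (simp add: z_def ln_div)
  qed
  then have lnM: "ln (real (M + 1)) = z + ln (real M)" by (simp add: add.commute)
  have ln3: "ln (real (x * (M + 1) ^ i * M ^ k)) = ln (real x) + real i * (z + ln (real M)) + real k * ln (real M)"
    if "x > 0" for x i k
  proof -
    have "ln (p * q ^ i * r ^ k) = ln p + real i * ln q + real k * ln r" if "p > 0" "q > 0" "r > 0" for p q r :: real
      using that by (simp add: ln_mult ln_realpow)
    from this[of "real x" "real (M + 1)" "real M"] show ?thesis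
      using that M unfolding lnM of_nat_mult of_nat_power by linarith
  qed
  have l: "l = ln (real a) - ln (real b)" using ab by (simp add: l_def ln_div)
  have mono: "ln (real x) \<le> ln (real y)" if "x \<le> y" "x > 0" for x y :: nat
    using that by simp
  have posM: "M > 0" by (simp add: M_def)
  have "ln (real (a * (M + 1) ^ 0 * M ^ K)) \<le> ln (real (b * (M + 1) ^ K * M ^ 0))"
    using upper ab posM by (intro mono) (simp_all add: ac_simps)
  then have 1: "l \<le> real K * z"
    unfolding ln3[OF ab(1)] ln3[OF ab(2)] l by (simp add: algebra_simps)
  have "ln (real (b * (M + 1) ^ K * M ^ j)) \<le> ln (real (a * (M + 1) ^ j * M ^ K))"
    using lower ab posM by (intro mono) (simp_all add: ac_simps)
  then have 2: "(real K - real j) * z \<le> l"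
    unfolding ln3[OF ab(1)] ln3[OF ab(2)] l by (simp add: algebra_simps)
  have 3: "l \<le> (real K - real j) * z + z"
  proof (cases "j > 0")
    case True
    then obtain i where i: "j = Suc i" by (cases j) auto
    have "ln (real (a * (M + 1) ^ i * M ^ K)) \<le> ln (real (b * (M + 1) ^ K * M ^ i))"
      using tight[OF True] ab posM by (intro mono) (simp_all add: i ac_simps)
    then show ?thesis
      unfolding ln3[OF ab(1)] ln3[OF ab(2)] l by (simp add: i algebra_simps)
  next
    case False
    have "0 \<le> 1 / (real M + 1)" using M by simp
    then have "z \<ge> 0" using z(1) by linarith
    then show ?thesis using 1 False by simp
  qed
  have "1 / real M \<le> 1" using M by simp
  then have z1: "z \<le> 1" using z(2) by linarith
  have K: "real K = real M * real N" by (simp add: K_def)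
  \<comment> \<open>Passing from \<open>z\<close> to \<open>1 / M\<close> changes
    \<open>(K - j) * z\<close> by \<open>(K - j) * e\<close>, which lies between
    \<open>- 2 * K * e\<close> and \<open>K * e\<close>, where \<open>K * e \<le> 1\<close>. With
    the overshoot \<open>z \<le> 1\<close> of the search this gives 3.\<close>
  define e where "e = 1 / real M - z"
  have e: "e \<ge> 0" "e \<le> 1 / (real M * (real M + 1))"
  proof -
    show "e \<ge> 0" using z(2) by (simp add: e_def)
    have "1 / real M - 1 / (real M + 1) = 1 / (real M * (real M + 1))"
      using M by (simp add: field_simps)
    then show "e \<le> 1 / (real M * (real M + 1))" using z(1) by (simp add: e_def)
  qed
  have Ke: "real K * e \<le> 1"
  proof -
    have "real K * e \<le> real K * (1 / (real M * (real M + 1)))"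
      using e(2) by (intro mult_left_mono) auto
    also have "\<dots> = real N / (real M + 1)" using M by (simp add: K)
    also have "\<dots> \<le> 1" by (simp add: M_def)
    finally show ?thesis .
  qed
  have je: "0 \<le> real j * e" "real j * e \<le> 3 * (real K * e)"
  proof -
    show "0 \<le> real j * e" using e(1) by simp
    have "real j \<le> 3 * real K" using j by linarith
    then have "real j * e \<le> 3 * real K * e" using e(1) by (intro mult_right_mono) auto
    then show "real j * e \<le> 3 * (real K * e)" by simp
  qed
  have "real N - real j / real M = (real K - real j) / real M"
    using M by (simp add: K field_simps)
  also have "\<dots> = (real K - real j) * z + real K * e - real j * e"
    by (simp add: e_def algebra_simps diff_divide_distrib)
  finally have eq: "real N - real j / real M = (real K - real j) * z + real K * e - real j * e" .
  have Ke0: "0 \<le> real K * e" using e(1) by simp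
  show ?thesis
    unfolding l_def[symmetric] eq using 2 3 z1 Ke Ke0 je by (intro abs_leI) linarith+
qed

lemma div_bounds: "real (x div y) \<le> real x / real y" "real x / real y \<le> real (x div y) + 1" if "y > 0"
proof -
  have "real x = real (x div y) * real y + real (x mod y)"
    by (metis div_mult_mod_eq of_nat_add of_nat_mult)
  moreover have "real (x mod y) \<le> real y" using that by (simp add: less_imp_le)
  ultimately show "real (x div y) \<le> real x / real y" "real x / real y \<le> real (x div y) + 1"
    using that by (simp_all add: field_simps)
qed

text \<open>The logarithm contributes 3; the two integer divisions and \<open>1 / D\<close>
  contribute at most 1 each, but not all with the same sign, so 5 suffices.\<close>

lemma balance_tuned:
  fixes L N cnt j :: nat and D Zh :: real
  assumes log: "\<bar>real N - real j / real (N + 1) - ln Zh\<bar> \<le> 3" and cnt: "cnt \<le> 3 * N" and L: "L \<ge> 4"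
    and D: "D \<ge> 1"
  shows "\<bar>real L * (real N + 1) * real N - real (balance L N cnt j) - 1 / D - 3 / 10 * real cnt - ln Zh\<bar> \<le> 5"
proof -
  \<comment> \<open>Ensures that the natural subtractions in \<open>balance\<close> do not
    truncate.\<close>
  have "N + 3 * cnt div 10 \<le> 4 * N" using cnt by linarith
  also have "\<dots> \<le> L * (N * (N + 1))" using L by (intro mult_le_mono) auto
  finally have "real (balance L N cnt j) = real (L * (N * (N + 1))) - real N - real (3 * cnt div 10) + real (j div (N + 1))"
    unfolding balance_def by linarith
  moreover have "real (L * (N * (N + 1))) = real L * (real N + 1) * real N" by (simp add: algebra_simps)
  moreover have "0 \<le> 1 / D" "1 / D \<le> 1" using D by simp_all
  moreover have "real (3 * cnt) / real 10 = 3 / 10 * real cnt" by simp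
  ultimately show ?thesis
    using div_bounds[of 10 "3 * cnt"] div_bounds[of "N + 1" j] log unfolding abs_le_iff by linarith
qed

lemma balance_le: "j \<le> 3 * ((N + 1) * N) \<Longrightarrow> balance L N cnt j \<le> L * N * (N + 1) + 3 * N"
proof -
  assume "j \<le> 3 * ((N + 1) * N)"
  then have "j div (N + 1) \<le> (3 * N * (N + 1)) div (N + 1)"
    by (intro div_le_mono) (simp add: algebra_simps)
  also have "\<dots> = 3 * N" by (rule nonzero_mult_div_cancel_right) simp
  finally show ?thesis unfolding balance_def mult.assoc by linarith
qed

text \<open>By Bernoulli, \<open>N + 1\<close> factors \<open>1 + 1 / (N + 1)\<close> at least
  double a number. This is where the number \<open>(N + 1) * N\<close> of search steps comes
  from.\<close>

lemma two_power_le_base: "2 ^ N \<le> (1 + 1 / (real N + 1)) ^ ((N + 1) * N)"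
proof -
  have "2 = 1 + real (N + 1) * (1 / (real N + 1))" by simp
  also have "\<dots> \<le> (1 + 1 / (real N + 1)) ^ (N + 1)"
    by (rule Bernoulli_inequality) (auto simp: field_simps)
  finally have "2 ^ N \<le> ((1 + 1 / (real N + 1)) ^ (N + 1)) ^ N"
    by (rule power_mono) simp
  then show ?thesis by (simp only: power_mult)
qed

text \<open>If even the scaled-down fraction exceeds 1, then \<open>Zhat\<close> is above the
  trivial bound 2^N for the partition function.\<close>

lemma search_too_high:
  fixes a b N :: nat
  defines "M \<equiv> N + 1"
  assumes b: "b > 0" and "b * (M + 1) ^ (M * N) < a * M ^ (M * N)"
  shows "2 ^ N < real a / real b"
proof -
  let ?K = "M * N"
  have pos: "real M ^ ?K > 0" "real b > 0" using b by (simp_all add: M_def)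
  have "real (b * (M + 1) ^ ?K) < real (a * M ^ ?K)"
    using assms(3) by (simp only: of_nat_less_iff)
  then have "real b * (real M + 1) ^ ?K < real a * real M ^ ?K"
    by (simp only: of_nat_mult of_nat_power of_nat_add of_nat_1)
  then have "((real M + 1) / real M) ^ ?K < real a / real b"
    using pos by (simp add: power_divide field_simps)
  moreover have "(real M + 1) / real M = 1 + 1 / (real N + 1)" by (simp add: M_def field_simps)
  ultimately show ?thesis
    using two_power_le_base[of N] by (simp add: M_def)
qed

text \<open>After all \<open>3 * K\<close> rounds the net scaling is by
  \<open>(1 + 1 / M) ^ (2 * K)\<close>, at least 4^N, and still the fraction is below 1.\<close>

lemma search_too_low:
  fixes a b N :: nat
  defines "M \<equiv> N + 1"
  assumes b: "b > 0"
    and "a * M ^ (M * N) * (M + 1) ^ (3 * (M * N)) < b * (M + 1) ^ (M * N) * M ^ (3 * (M * N))"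
  shows "real a / real b < (1 / 4) ^ N"
proof -
  let ?K = "M * N"
  let ?x = "real M ^ ?K" and ?y = "(real M + 1) ^ ?K"
  have pos: "?x > 0" "?y > 0" "real b > 0" using b by (simp_all add: M_def)
  have "real (a * M ^ ?K * (M + 1) ^ (3 * ?K)) < real (b * (M + 1) ^ ?K * M ^ (3 * ?K))"
    using assms(3) by (simp only: of_nat_less_iff)
  then have "real a * ?x * (real M + 1) ^ (3 * ?K) < real b * ?y * real M ^ (3 * ?K)"
    by (simp only: of_nat_mult of_nat_power of_nat_add of_nat_1)
  then have "real a * ?x * ?y ^ 3 < real b * ?y * ?x ^ 3"
    by (simp only: power_mult[symmetric] mult.commute[of 3])
  then have "(real a * ?y ^ 2) * (?x * ?y) < (real b * ?x ^ 2) * (?x * ?y)"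
    by (simp add: power2_eq_square power3_eq_cube ac_simps)
  then have *: "real a * ?y ^ 2 < real b * ?x ^ 2"
    using pos by (simp add: mult_less_cancel_right)
  have "?x * 2 ^ N \<le> ?x * (1 + 1 / (real N + 1)) ^ ?K"
    using two_power_le_base[of N] pos by (simp add: M_def)
  also have "\<dots> = ?y"
    by (simp add: M_def field_simps flip: power_mult_distrib)
  finally have "(?x * 2 ^ N) ^ 2 \<le> ?y ^ 2" using pos by (intro power_mono) auto
  moreover have "((2::real) ^ N) ^ 2 = 4 ^ N"
    using power_mult[of "2::real" N 2] power_mult[of "2::real" 2 N] by (simp add: mult.commute)
  ultimately have "?x ^ 2 * 4 ^ N \<le> ?y ^ 2"
    by (simp only: power_mult_distrib)
  then have "real a * (?x ^ 2 * 4 ^ N) \<le> real a * ?y ^ 2"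
    by (intro mult_left_mono) auto
  with * have "(real a * 4 ^ N) * ?x ^ 2 < real b * ?x ^ 2" by (simp add: ac_simps)
  then have "real a * 4 ^ N < real b" using pos by (simp add: mult_less_cancel_right)
  then show ?thesis using pos by (simp add: power_divide field_simps)
qed

section \<open>Sizes of encodings\<close>

lemma vsize_enc_list_le:
  assumes "\<forall>v\<in>set vs. vsize v \<le> c"
  shows "vsize (enc_list vs) \<le> 1 + length vs * (1 + c)"
  using assms by (induction vs) (auto simp: floorlog_def)

lemma vsize_block_list_le:
  assumes "vsize v0 \<le> c" "vsize v1 \<le> c" "vsize v2 \<le> c" "vsize v3 \<le> c" "vsize v4 \<le> c"
  shows "vsize (block_list m N v0 v1 v2 v3 v4) \<le> 1 + (4 * m + N) * (1 + c)"
  unfolding block_list_def using assms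
  by (intro order_trans[OF vsize_enc_list_le[where c = c]]) auto

lemma vsize_frac_val: "vsize (frac_val p q) \<le> 6 + p + q"
  using floorlog_le[of p] floorlog_le[of q] floorlog_le[of 1] by (simp add: frac_val_def)

lemma vsize_model_le:
  assumes w: "vsize bv \<le> c" "vsize wv \<le> c" "vsize kv \<le> c" "vsize zv \<le> c" "c \<ge> 1"
    and rws: "length rws = N" "\<forall>ro\<in>set rws. length ro = N \<and> (\<forall>v\<in>set ro. vsize v \<le> c)"
  shows "vsize (Cell (Atom (4 * m + N))
    (Cell (enc_list (replicate m (block_list m N (Atom 0) bv wv (Atom 0) kv)
        @ replicate m (block_list m N bv (Atom 0) (Atom 0) (Atom 0) (Atom 0))
        @ replicate m (block_list m N wv (Atom 0) (Atom 0) bv kv)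
        @ replicate m (block_list m N (Atom 0) (Atom 0) bv (Atom 0) (Atom 0))
        @ map (last_row m kv) rws))
      (block_list m N zv zv zv zv zv)))
    \<le> 5 + (4 * m + N) + (4 * m + N) * (1 + (1 + (4 * m + N) * (1 + c))) + (4 * m + N) * (1 + c)"
proof -
  let ?n = "4 * m + N"
  let ?c = "1 + ?n * (1 + c)"
  have o: "vsize (Atom 0) \<le> c" using w(5) by (simp add: floorlog_def)
  have l: "vsize (last_row m kv ro) \<le> ?c" if "ro \<in> set rws" for ro
    unfolding last_row_def using that rws(2) w(3) o
    by (intro order_trans[OF vsize_enc_list_le[where c = c]]) auto
  have "vsize (enc_list (replicate m (block_list m N (Atom 0) bv wv (Atom 0) kv)
        @ replicate m (block_list m N bv (Atom 0) (Atom 0) (Atom 0) (Atom 0))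
        @ replicate m (block_list m N wv (Atom 0) (Atom 0) bv kv)
        @ replicate m (block_list m N (Atom 0) (Atom 0) bv (Atom 0) (Atom 0))
        @ map (last_row m kv) rws)) \<le> 1 + ?n * (1 + ?c)" (is "vsize (enc_list ?vs) \<le> _")
  proof -
    have "\<forall>v\<in>set ?vs. vsize v \<le> ?c"
      using l vsize_block_list_le[OF o w(1,2) o w(3), of m N] vsize_block_list_le[OF w(1) o o o o, of m N]
        vsize_block_list_le[OF w(2) o o w(1,3), of m N] vsize_block_list_le[OF o o w(1) o o, of m N]
      by auto
    moreover have "length ?vs = ?n" using rws(1) by simp
    ultimately show ?thesis using vsize_enc_list_le[of ?vs ?c] by (simp only:)
  qed
  moreover have "vsize (block_list m N zv zv zv zv zv) \<le> ?c"
    by (intro vsize_block_list_le w(4))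
  ultimately show ?thesis
    using floorlog_le[of ?n] unfolding vsize.simps by linarith
qed

section \<open>Polynomial growth\<close>

definition poly_bounded :: "(nat \<Rightarrow> nat) \<Rightarrow> bool" where
  "poly_bounded f \<longleftrightarrow> (\<exists>p :: nat poly. \<forall>x. f x \<le> poly p x)"

lemma poly_nat_mono: "x \<le> y \<Longrightarrow> poly p x \<le> poly p (y :: nat)"
  by (induction p) (auto intro: add_mono mult_mono)

lemma poly_bounded_const: "poly_bounded (\<lambda>_. c)"
  unfolding poly_bounded_def by (rule exI[of _ "[:c:]"]) simp

lemma poly_bounded_id: "poly_bounded (\<lambda>x. x)"
  unfolding poly_bounded_def by (rule exI[of _ "[:0, 1:]"]) simp

lemma poly_bounded_add: "poly_bounded f \<Longrightarrow> poly_bounded g \<Longrightarrow> poly_bounded (\<lambda>x. f x + g x)"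
  unfolding poly_bounded_def by (metis add_mono poly_add)

lemma poly_bounded_mult: "poly_bounded f \<Longrightarrow> poly_bounded g \<Longrightarrow> poly_bounded (\<lambda>x. f x * g x)"
  unfolding poly_bounded_def by (metis mult_le_mono poly_mult)

lemma poly_bounded_poly: "poly_bounded f \<Longrightarrow> poly_bounded (\<lambda>x. poly p (f x))"
  unfolding poly_bounded_def by (metis poly_nat_mono poly_pcompose)

lemmas poly_bounded_intros = poly_bounded_const poly_bounded_id poly_bounded_add poly_bounded_mult poly_bounded_poly

text \<open>Used to choose \<open>L\<close>: a large enough \<open>y\<close> makes
  \<open>exp (- y)\<close> negligible even after multiplication by the number of samples.\<close>

lemma poly_exp_decay:
  fixes q :: "nat poly"
  assumes "\<delta> > 0"
  shows "\<exists>B. \<forall>Y\<ge>B. real (poly q Y) * exp (- real Y) \<le> \<delta>"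
proof -
  have "\<exists>C d. \<forall>Y\<ge>1. poly q Y \<le> C * Y ^ d"
  proof (induction q)
    case (pCons a p)
    then obtain C d where C: "\<And>Y. Y \<ge> 1 \<Longrightarrow> poly p Y \<le> C * Y ^ d" by blast
    have "poly (pCons a p) Y \<le> (a + C) * Y ^ Suc d" if "Y \<ge> 1" for Y
    proof -
      have "a * 1 \<le> a * Y ^ Suc d" using that by (intro mult_le_mono) auto
      moreover have "Y * poly p Y \<le> Y * (C * Y ^ d)" using C[OF that] by simp
      moreover have "(a + C) * Y ^ Suc d = a * Y ^ Suc d + Y * (C * Y ^ d)"
        by (simp add: algebra_simps)
      ultimately show ?thesis unfolding poly_pCons by linarith
    qed
    then show ?case by blast
  qed simp
  then obtain C d where C: "\<And>Y. Y \<ge> 1 \<Longrightarrow> poly q Y \<le> C * Y ^ d" by blast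
  have "((\<lambda>Y. real C * (real Y ^ d / exp (real Y))) \<longlongrightarrow> real C * 0) sequentially"
    by (intro tendsto_intros filterlim_compose[OF tendsto_power_div_exp_0 filterlim_real_sequentially])
  then have "\<forall>\<^sub>F Y in sequentially. real C * (real Y ^ d / exp (real Y)) < \<delta>"
    using assms by (intro order_tendstoD) auto
  then obtain B where B: "\<And>Y. Y \<ge> B \<Longrightarrow> real C * (real Y ^ d / exp (real Y)) < \<delta>"
    by (auto simp: eventually_sequentially)
  have "real (poly q Y) * exp (- real Y) \<le> \<delta>" if "Y \<ge> max 1 B" for Y
  proof -
    have "real (poly q Y) \<le> real (C * Y ^ d)"
      using C[of Y] that by (simp only: of_nat_le_iff)
    then have "real (poly q Y) * exp (- real Y) \<le> real C * real Y ^ d * exp (- real Y)"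
      by (intro mult_right_mono) auto
    also have "\<dots> = real C * (real Y ^ d / exp (real Y))"
      by (simp add: exp_minus divide_inverse)
    finally show ?thesis using B[of Y] that by simp
  qed
  then show ?thesis by blast
qed

section \<open>The reduction\<close>

definition Sampler :: com where
  "Sampler = Seq (Flip 0) (If (Reg 0) (Assign 0 (Reg 24)) (Assign 0 (Reg 25)))"

text \<open>The time 5 is one unit for the flip, two for the test and two for the assignment, in
  either branch.\<close>

lemma exec_Sampler:
  "map_spmf (\<lambda>(s', t', k'). (s' 0, t')) (exec smp sub Sampler (s, 0, 0)) = coin_source (s 24) (s 25) 5"
proof -
  have "exec smp sub (If (Reg 0) (Assign 0 (Reg 24)) (Assign 0 (Reg 25))) (s(0 := Atom (of_bool b)), 1, 0)
      = return_spmf (s(0 := if b then s 24 else s 25), 5, 0)" for b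
    by (cases b) (auto simp: truthy_def)
  then show ?thesis
    by (simp add: Sampler_def coin_source_def map_spmf_conv_bind_spmf o_def del: exec.simps(4))
qed

definition Prepare :: com where
  "Prepare = Seq Setup (Seq Power (Seq (Assigns [(10, Arith Less (Reg 4) (Reg 3))]) Search))"

definition Answer :: com where
  "Answer = Seq (Call 27 Sampler 28) (If (Reg 28) (Assign 0 (num 0)) (Assign 0 (num 1)))"

text \<open>The flag in register \<open>10\<close> signals a \<open>Zhat\<close> above 2^N;
  registers \<open>3\<close> and \<open>4\<close> still in the wrong order after the search signal
  one below 4^(-N). By the bounds on \<open>Z\<close> the answers 0 and 1 are then safe. Otherwise
  the search has found \<open>ln Zhat\<close> well enough to tune the gadget.\<close>

definition Reduce :: "nat \<Rightarrow> com" where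
  "Reduce L = Seq Prepare (If (Reg 10) (Assign 0 (num 0))
     (If (Arith Less (Reg 3) (Reg 4)) (Assign 0 (num 1)) (Seq (Build L) Answer)))"

definition prepare_cost :: "nat \<Rightarrow> nat \<Rightarrow> nat" where
  "prepare_cost N F = (let K = (N + 1) * N; W = F + K * (N + 2); V = 2 * W + 3 * K * (N + 2) in
     (60 + 4 * N) + ((1 + K * ((2 * W + 2 * N + 20) + K + 7) + 3) + ((10 + 2 * W + V)
     + (K + 10 + 3 * K * ((5 * V + 2 * N + 40) + 3 * K + 7) + 3))))"

lemma runs_Prepare:
  fixes a b N :: nat
  assumes s: "s 0 = Cell (Cell (Atom N) (Cell rws flds)) (Cell rv (Cell (Cell sg (Atom a)) (Atom b)))"
    and z: "\<And>i. i \<noteq> 0 \<Longrightarrow> s i = Atom 0"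
  defines "K \<equiv> (N + 1) * N"
  defines "Q \<equiv> a * (N + 1) ^ K" and "P \<equiv> b * (N + 2) ^ K"
  defines "J \<equiv> steps_up Q P (N + 1) (3 * K)"
  shows "\<exists>s'. runs Prepare s s' (prepare_cost N (floorlog 2 a + floorlog 2 b)) \<and> s' 1 = Atom N \<and> s' 2 = rws
    \<and> s' 5 = Atom (N + 1) \<and> s' 8 = Atom J \<and> s' 10 = Atom (of_bool (P < Q))
    \<and> s' 3 = Atom (Q * (N + 2) ^ J) \<and> s' 4 = Atom (P * (N + 1) ^ J)
    \<and> (\<forall>i\<in>{7, 9, 11, 16, 22, 23, 29, 30}. s' i = Atom 0)
    \<and> floorlog 2 (Q * (N + 2) ^ J) \<le> prepare_cost N (floorlog 2 a + floorlog 2 b)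
    \<and> floorlog 2 (P * (N + 1) ^ J) \<le> prepare_cost N (floorlog 2 a + floorlog 2 b)"
proof -
  define W where "W = floorlog 2 a + floorlog 2 b + K * (N + 2)"
  have "K * (N + 1) \<le> K * (N + 2)" by simp
  then have PQ: "floorlog 2 Q \<le> W" "floorlog 2 P \<le> W"
    using floorlog_mult_power_le[of a "N + 1" K] floorlog_mult_power_le[of b "N + 2" K]
    unfolding Q_def P_def W_def by linarith+
  define s1 where "s1 = s(1 := Atom N, 2 := rws, 3 := Atom a, 4 := Atom b, 5 := Atom (N + 1), 6 := Atom K, 17 := Atom (N + 2))"
  define s2 where "s2 = s1(3 := Atom Q, 4 := Atom P)"
  define s3 where "s3 = s2(10 := Atom (of_bool (P < Q)))"
  define s4 where "s4 = s3(3 := Atom (Q * (N + 2) ^ J), 4 := Atom (P * (N + 1) ^ J), 8 := Atom J)"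
  have r1: "runs Setup s s1 (60 + 4 * N)"
    unfolding s1_def K_def by (rule runs_Setup[where s = s, OF s])
  have r2: "runs Power s1 s2 (1 + K * ((2 * W + 2 * N + 20) + K + 7) + 3)"
    unfolding s2_def Q_def P_def W_def by (rule runs_Power) (simp_all add: s1_def z)
  have r3: "runs (Assigns [(10, Arith Less (Reg 4) (Reg 3))]) s2 s3 (10 + 2 * W + (2 * W + 3 * K * (N + 2)))"
    using PQ by (intro runs_Assigns) (simp_all add: s2_def s3_def)
  have "runs Search s3 s4 (K + 10 + 3 * K * ((5 * (floorlog 2 Q + floorlog 2 P + 3 * K * (N + 2)) + 2 * N + 40) + 3 * K + 7) + 3)"
    unfolding s4_def J_def by (rule runs_Search) (simp_all add: s1_def s2_def s3_def z)
  then have r4: "runs Search s3 s4 (K + 10 + 3 * K * ((5 * (2 * W + 3 * K * (N + 2)) + 2 * N + 40) + 3 * K + 7) + 3)"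
    by (rule runs_mono) (use PQ in \<open>intro add_le_mono mult_le_mono order_refl; linarith\<close>)
  have "runs Prepare s s4 (prepare_cost N (floorlog 2 a + floorlog 2 b))"
    unfolding Prepare_def
    by (rule runs_Seq[OF r1 runs_Seq[OF r2 runs_Seq[OF r3 r4 order_refl] order_refl]])
      (simp only: prepare_cost_def Let_def K_def W_def order_refl)
  moreover have "s4 1 = Atom N \<and> s4 2 = rws \<and> s4 5 = Atom (N + 1) \<and> s4 8 = Atom J \<and> s4 10 = Atom (of_bool (P < Q))
    \<and> s4 3 = Atom (Q * (N + 2) ^ J) \<and> s4 4 = Atom (P * (N + 1) ^ J)
    \<and> (\<forall>i\<in>{7, 9, 11, 16, 22, 23, 29, 30}. s4 i = Atom 0)"
    by (simp add: s1_def s2_def s3_def s4_def z)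
  moreover have "floorlog 2 (Q * (N + 2) ^ J) \<le> prepare_cost N (floorlog 2 a + floorlog 2 b)"
    "floorlog 2 (P * (N + 1) ^ J) \<le> prepare_cost N (floorlog 2 a + floorlog 2 b)"
  proof -
    have "J \<le> 3 * K" unfolding J_def by (rule steps_up_le)
    then have "J * (N + 2) \<le> 3 * K * (N + 2)" "J * (N + 1) \<le> 3 * K * (N + 2)"
      by (intro mult_le_mono; simp)+
    moreover have "2 * W + 3 * K * (N + 2) \<le> prepare_cost N (floorlog 2 a + floorlog 2 b)"
      unfolding prepare_cost_def Let_def K_def W_def by linarith
    ultimately show "floorlog 2 (Q * (N + 2) ^ J) \<le> prepare_cost N (floorlog 2 a + floorlog 2 b)"
      "floorlog 2 (P * (N + 1) ^ J) \<le> prepare_cost N (floorlog 2 a + floorlog 2 b)"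
      using PQ floorlog_mult_power_le[of Q "N + 2" J] floorlog_mult_power_le[of P "N + 1" J] by linarith+
  qed
  ultimately show ?thesis by blast
qed

lemma exec_Answer:
  assumes "s 27 \<in> Q"
  shows "exec smp (subroutine_on Q A) Answer (s, t, k) = map_spmf (\<lambda>(v, t', k').
    (s(28 := v, 0 := if truthy v then Atom 0 else Atom 1), t + t' + 5, k))
    (run (coin_source (s 24) (s 25) 5) no_subroutine A (s 27))"
proof -
  have "exec smp (subroutine_on Q A) (If (Reg 28) (Assign 0 (num 0)) (Assign 0 (num 1))) (s(28 := v), t0, k)
      = return_spmf (s(28 := v, 0 := if truthy v then Atom 0 else Atom 1), t0 + 4, k)" for v t0
    by (cases "truthy v") auto
  then show ?thesis
    using assms exec_Sampler[of smp "subroutine_on Q A" s]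
    by (simp add: Answer_def subroutine_on_def map_spmf_conv_bind_spmf o_def case_prod_beta
        del: exec.simps(4)) (simp add: ac_simps)
qed

lemma run_of_runs:
  assumes "runs c ((\<lambda>_. Atom 0)(0 := v)) s' T"
  obtains t where "t \<le> T" "\<And>smp sub. run smp sub c v = return_spmf (s' 0, t, 0)"
proof -
  obtain t where "t \<le> T" "\<And>smp sub t0 k. exec smp sub c ((\<lambda>_. Atom 0)(0 := v), t0, k) = return_spmf (s', t0 + t, k)"
    by (rule runsE[OF assms]) blast
  then show ?thesis by (intro that[of t]) (auto simp: run_def)
qed

lemma exec_If_False:
  "\<not> truthy (expr_val e s) \<Longrightarrow> exec smp sub (If e c d) (s, t, k) = exec smp sub d (s, t + 1 + expr_cost e s, k)"
  by simp

lemma exec_Seq_runs: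
  assumes "runs c s s' T"
  obtains t where "t \<le> T" "\<And>smp sub t0 k d. exec smp sub (Seq c d) (s, t0, k) = exec smp sub d (s', t0 + t, k)"
proof -
  obtain t where "t \<le> T" "\<And>smp sub t0 k. exec smp sub c (s, t0, k) = return_spmf (s', t0 + t, k)"
    by (rule runsE[OF assms]) blast
  then show ?thesis by (intro that[of t]) auto
qed

text \<open>\<open>build_cost\<close> contains the subtractions and divisions of
  \<open>balance\<close>, for which \<open>poly_bounded\<close> has no rule; here they are replaced
  by an upper bound, and \<open>cnt\<close> and \<open>j\<close> by their largest values.\<close>

definition build_bound :: "nat \<Rightarrow> nat \<Rightarrow> nat" where
  "build_bound L x = (let m = gadget_size L x; D = m * m; u = L * x * (x + 1) + 3 * x; j = 3 * ((x + 1) * x) in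
     (2 + (1 + x * ((6 + (1 + x * ((x * x + x + 15) + x + 7) + 3)) + x + 7) + 3))
     + (200 + 40 * (D * D + D * u + L + (x + 1) * (x + 1) + m + L * (x * (x + 1)) + x + x * (x + 1)
       + 3 * (3 * x) + j + 12 + D + u))
     + 7 * (4 * (m * (m + 11) + 4) + x * (x + 11) + 6)
     + ((1 + x * ((12 + 4 * (m * (m + 11) + 4)) + x + 7) + 3) + (1 + x * (8 + x + 7) + 3))
     + 4 * (m * (m + 11) + 4) + (20 + 5 * m + x))"

lemma gadget_size_mono: "N \<le> x \<Longrightarrow> gadget_size L N \<le> gadget_size L x"
  unfolding gadget_size_def by (intro mult_le_mono add_le_mono order_refl)

lemma balance_bound:
  assumes "N \<le> x" "j \<le> 3 * ((N + 1) * N)"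
  shows "balance L N cnt j \<le> L * x * (x + 1) + 3 * x"
proof -
  have "balance L N cnt j \<le> L * N * (N + 1) + 3 * N" by (rule balance_le[OF assms(2)])
  also have "\<dots> \<le> L * x * (x + 1) + 3 * x"
    using assms(1) by (intro add_le_mono mult_le_mono order_refl)
  finally show ?thesis .
qed

lemma build_cost_le:
  assumes "N \<le> x" "cnt \<le> 3 * N" "j \<le> 3 * ((N + 1) * N)"
  shows "build_cost L N cnt j \<le> build_bound L x"
proof -
  have m: "gadget_size L N \<le> gadget_size L x" by (rule gadget_size_mono[OF assms(1)])
  have u: "balance L N cnt j \<le> L * x * (x + 1) + 3 * x" by (rule balance_bound[OF assms(1,3)])
  have c: "cnt \<le> 3 * x" using assms by linarith
  have "(N + 1) * N \<le> (x + 1) * x" using assms(1) by (intro mult_le_mono add_le_mono order_refl)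
  then have j: "j \<le> 3 * ((x + 1) * x)" using assms(3) by linarith
  show ?thesis
    unfolding build_cost_def build_bound_def params_cost_def Let_def
    by (intro add_le_mono mult_le_mono order_refl m u c j assms(1))
qed

lemma prepare_cost_mono: "N \<le> x \<Longrightarrow> F \<le> x \<Longrightarrow> prepare_cost N F \<le> prepare_cost x x"
  unfolding prepare_cost_def Let_def by (intro add_le_mono mult_le_mono order_refl)

definition model_bound :: "nat \<Rightarrow> nat \<Rightarrow> nat" where
  "model_bound L x = (let m = gadget_size L x; n = 4 * m + x;
       c = 60 + (m * m * (L * x * (x + 1) + 3 * x) + m * m * (m * m)) + x in
     5 + n + n * (1 + (1 + n * (1 + c))) + n * (1 + c))"

text \<open>The last summand pays for comparing registers \<open>3\<close> and \<open>4\<close>,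
  whose bit lengths are bounded by the preparation cost.\<close>

definition time_bound :: "nat \<Rightarrow> nat poly \<Rightarrow> nat poly \<Rightarrow> nat \<Rightarrow> nat" where
  "time_bound L ps pt x = (prepare_cost x x + 20) + build_bound L x + 5
     + (poly pt (model_bound L x) + 5 * poly ps (4 * gadget_size L x + x))
     + 10 * prepare_cost x x"

lemma poly_bounded_time_bound: "poly_bounded (time_bound L ps pt)"
  unfolding time_bound_def build_bound_def prepare_cost_def model_bound_def gadget_size_def Let_def
  by (intro poly_bounded_intros)

section \<open>Membership in the family, and the tester on the gadget\<close>

lemma model_of_rational:
  assumes "\<And>u v. W u v = W v u" "\<And>u v. W u v \<in> \<rat>"
  shows "rational_model (model_of n W)"
proof -
  have "coupling (model_of n W) e \<in> \<rat>" if "e \<in> edges (model_of n W)" for e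
  proof -
    have "e \<in> {{u, v} | u v. u < n \<and> v < n \<and> u \<noteq> v \<and> W u v \<noteq> 0}"
      using that by (simp only: model_of_def ising.simps)
    then obtain u v where "e = {u, v}" by blast
    then show ?thesis
      using coupling_model_of[OF assms(1), where n = n and u = u and v = v] assms(2) by simp
  qed
  then show ?thesis by (simp add: rational_model_def)
qed

lemma bipartite_in_ising_minus: "bipartite m N 10 \<in> ising_minus (4 * m + N) (4 * m + N) 10 0"
  unfolding bipartite_def
proof (rule model_of_in_ising_minus)
  let ?W = "block_coupling m (\<lambda>_ _. 0) (bipartite_table 10)"
  show "?W u v = ?W v u" for u v
    by (rule block_coupling_sym[where g = "\<lambda>_ _. 0" and J = "bipartite_table 10", OF refl bipartite_table_sym])
  show "?W u v \<le> 0" "\<bar>?W u v\<bar> \<le> 10" for u v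
    by (simp_all add: block_coupling_def bipartite_table_def)
qed

lemma enc_rat_pos:
  assumes "q > 0"
  obtains a b :: nat where "a > 0" "b > 0" "enc_rat q = Cell (Cell (Atom 0) (Atom a)) (Atom b)"
    "real_of_rat q = real a / real b"
proof -
  obtain p d where pd: "quotient_of q = (p, d)" by (cases "quotient_of q")
  have d: "d > 0" using quotient_of_denom_pos[OF pd] .
  have q: "q = of_int p / of_int d" using quotient_of_div[OF pd] .
  with assms d have p: "p > 0" by (simp add: zero_less_divide_iff)
  show ?thesis
  proof (rule that[of "nat p" "nat d"])
    show "enc_rat q = Cell (Cell (Atom 0) (Atom (nat p))) (Atom (nat d))"
      using p by (simp add: enc_rat_def pd)
    show "real_of_rat q = real (nat p) / real (nat d)"
      using p d by (simp add: q of_rat_divide)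
  qed (use p d in auto)
qed

context cubic_instance
begin

definition "adjacency = map (\<lambda>u. map (\<lambda>v. entry_val (g u v)) [0..<N]) [0..<N]"

lemma enc_model_G: "\<exists>flds. enc_model G = Cell (Atom N) (Cell (enc_list (map enc_list adjacency)) flds)"
proof -
  have "(if {u, v} \<in> edges G then enc_real (coupling G {u, v}) else Atom 0) = entry_val (g u v)" for u v
    by (simp add: g_def pair_coupling_def entry_val_def G_simps(3))
  then show ?thesis
    unfolding enc_model_def Let_def G_simps(2) adjacency_def by (simp add: o_def)
qed

lemma length_adjacency: "length adjacency = N" "\<forall>ro\<in>set adjacency. length ro = N"
  by (auto simp: adjacency_def)

lemma count_adjacency: "sum_list (map count_cells adjacency) = cnt"
proof -
  have "is_cell (entry_val (g u v)) \<longleftrightarrow> {u, v} \<in> edges G" for u v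
    using is_cell_enc_real by (auto simp: entry_val_def g_eq)
  then show ?thesis
    by (simp add: adjacency_def count_cells_def cnt_def o_def interv_sum_list_conv_sum_set_nat atLeast0LessThan)
qed

lemma vsize_adjacency: "ro \<in> set adjacency \<Longrightarrow> v \<in> set ro \<Longrightarrow> vsize v \<le> 14"
proof -
  assume "ro \<in> set adjacency" "v \<in> set ro"
  then obtain a b where v: "v = entry_val (g a b)" by (auto simp: adjacency_def)
  have "- 6 / 10 = - (real 3 / real 5)" by simp
  then have "enc_real (- 6 / 10) = frac_val 3 5"
    using enc_real_neg_frac[of 3 5] by (simp add: coprime_iff_gcd_eq_1 gcd_non_0_nat)
  then show "vsize v \<le> 14"
    using vsize_frac_val[of 3 5] by (auto simp: v entry_val_def g_eq floorlog_def)
qed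

end

context tuned_gadget
begin

lemma entry_vals:
  "entry_val (- 10) = frac_val 10 1"
  "entry_val (- \<omega>) = frac_val (m * m * u + 1) (m * m * (m * m))"
  "entry_val (- \<kappa>) = frac_val 1 (N + 1)"
proof -
  show "entry_val (- 10) = frac_val 10 1"
    using enc_real_neg_frac[of 10 1] by (simp add: entry_val_def)
  have "coprime (m * m * u + 1) (m * m)"
  proof (rule coprimeI)
    fix d assume d: "d dvd m * m * u + 1" "d dvd m * m"
    have "d dvd m * m * u" by (rule dvd_mult2[OF d(2)])
    with d(1) show "is_unit d" using dvd_add_right_iff by blast
  qed
  then have cop: "coprime (m * m * u + 1) (m * m * (m * m))"
    by (simp only: coprime_mult_right_iff)
  have "\<omega> = real (m * m * u + 1) / real (m * m * (m * m))"
    unfolding \<omega>_def unfolding D_def by (simp add: power2_eq_square mult.assoc add.commute)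
  moreover have "enc_real (- (real (m * m * u + 1) / real (m * m * (m * m)))) = frac_val (m * m * u + 1) (m * m * (m * m))"
    using cop m_ge(2) by (intro enc_real_neg_frac) auto
  ultimately show "entry_val (- \<omega>) = frac_val (m * m * u + 1) (m * m * (m * m))"
    using \<omega>_nonneg(2) by (simp only: entry_val_def neg_equal_0_iff_equal if_False)
  have "\<kappa> = real 1 / real (N + 1)" by (simp add: \<kappa>_def)
  moreover have "enc_real (- (real 1 / real (N + 1))) = frac_val 1 (N + 1)"
    by (intro enc_real_neg_frac) auto
  moreover have "\<kappa> \<noteq> 0" by (simp add: \<kappa>_def)
  ultimately show "entry_val (- \<kappa>) = frac_val 1 (N + 1)"
    by (simp only: entry_val_def neg_equal_0_iff_equal if_False)
qed

lemma enc_model_M: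
  "enc_model M = Cell (Atom (4 * m + N))
    (Cell (enc_list (replicate m (block_list m N (Atom 0) (frac_val 10 1) (frac_val (m * m * u + 1) (m * m * (m * m))) (Atom 0) (frac_val 1 (N + 1)))
        @ replicate m (block_list m N (frac_val 10 1) (Atom 0) (Atom 0) (Atom 0) (Atom 0))
        @ replicate m (block_list m N (frac_val (m * m * u + 1) (m * m * (m * m))) (Atom 0) (Atom 0) (frac_val 10 1) (frac_val 1 (N + 1)))
        @ replicate m (block_list m N (Atom 0) (Atom 0) (frac_val 10 1) (Atom 0) (Atom 0))
        @ map (last_row m (frac_val 1 (N + 1))) adjacency))
      (block_list m N (Cell zero_val zero_val) (Cell zero_val zero_val) (Cell zero_val zero_val)
        (Cell zero_val zero_val) (Cell zero_val zero_val)))"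
  unfolding M_def enc_model_gadget[where g = g, OF g_sym g_diag entry_vals]
  by (simp add: adjacency_def o_def)

lemma vsize_M:
  "vsize (enc_model M) \<le> 5 + (4 * m + N) + (4 * m + N) * (1 + (1 + (4 * m + N) * (1 + (60 + (m * m * u + m * m * (m * m)) + N))))
    + (4 * m + N) * (1 + (60 + (m * m * u + m * m * (m * m)) + N))"
  unfolding enc_model_M
proof (rule vsize_model_le)
  let ?c = "60 + (m * m * u + m * m * (m * m)) + N"
  show "vsize (frac_val 10 1) \<le> ?c" "vsize (frac_val (m * m * u + 1) (m * m * (m * m))) \<le> ?c"
      "vsize (frac_val 1 (N + 1)) \<le> ?c"
    using vsize_frac_val[of 10 1] vsize_frac_val[of "m * m * u + 1" "m * m * (m * m)"] vsize_frac_val[of 1 "N + 1"]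
    by linarith+
  show "vsize (Cell zero_val zero_val) \<le> ?c"
    using floorlog_le[of 0] floorlog_le[of 1] by (simp add: zero_val_def)
  show "\<forall>ro\<in>set adjacency. length ro = N \<and> (\<forall>v\<in>set ro. vsize v \<le> ?c)"
    using length_adjacency(2) vsize_adjacency by fastforce
qed (simp_all add: length_adjacency)

lemma M_in: "M \<in> ising_minus (4 * m + N) (4 * m + N) 10 0" and M_rational: "rational_model M"
proof -
  let ?J = "gadget_table 10 \<omega> \<kappa>"
  let ?W = "block_coupling m g ?J"
  have sym: "?W a b = ?W b a" for a b
    by (rule block_coupling_sym[where g = g and J = ?J]) (rule g_sym gadget_table_sym)+
  have "\<kappa> \<le> 1" by (simp add: \<kappa>_def)
  moreover have "0 \<le> \<kappa>" by (simp add: \<kappa>_def)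
  ultimately have \<kappa>: "0 \<le> \<kappa>" "\<kappa> \<le> 10" by (simp_all only: order_trans[OF _ one_le_numeral])
  have J: "?J a b \<in> {-10, -\<omega>, -\<kappa>, 0}" for a b
    by (simp add: gadget_table_def)
  have g: "g a b \<in> {- 6 / 10, 0}" for a b
    by (simp add: g_eq)
  have W: "?W a b \<in> {-10, -\<omega>, -\<kappa>, - 6 / 10, 0}" for a b
    using J[of "block_of m a" "block_of m b"] g[of "a - 4 * m" "b - 4 * m"] unfolding block_coupling_def by auto
  show "M \<in> ising_minus (4 * m + N) (4 * m + N) 10 0"
    unfolding M_def gadget_def
  proof (rule model_of_in_ising_minus)
    show "?W a b \<le> 0" "\<bar>?W a b\<bar> \<le> 10" for a b
      using W[of a b] \<kappa> \<omega>_nonneg(1) \<omega>_le by auto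
  qed (rule sym)
  have "\<omega> \<in> \<rat>" unfolding \<omega>_def unfolding D_def by simp
  moreover have "\<kappa> \<in> \<rat>" by (simp add: \<kappa>_def)
  ultimately have "?W a b \<in> \<rat>" for a b
    using W[of a b] by auto
  then show "rational_model M"
    unfolding M_def gadget_def by (intro model_of_rational sym)
qed

lemma tester_answers:
  fixes n :: nat
  defines "n \<equiv> 4 * m + N"
  defines "src \<equiv> coin_source (enc_config n (special m N 1)) (enc_config n (special m N 2)) 5"
  assumes tester: "identity_tester (\<lambda>n. ising_minus n n 10 0) \<epsilon> ps pt A" and \<epsilon>: "\<epsilon> > 0"
    and K: "real (poly ps n) * exp (- y) \<le> 1 / 10" "exp (- y) \<le> \<epsilon> / 2"
    and rr: "2430 * real (poly ps n) \<le> r" "972 / \<epsilon> \<le> r"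
  shows "lossless_spmf (run src no_subroutine A (enc_model M))"
    and "\<forall>(v, t, k)\<in>set_spmf (run src no_subroutine A (enc_model M)). t \<le> poly pt (vsize (enc_model M)) + 5 * poly ps n"
    and "Z \<le> Zhat / r \<Longrightarrow> prob_accept (run src no_subroutine A (enc_model M)) \<ge> 5 / 8"
    and "Z \<ge> r * Zhat \<Longrightarrow> prob_reject (run src no_subroutine A (enc_model M)) \<ge> 5 / 8"
proof -
  let ?B = "bipartite m N 10"
  have n: "nverts M = n" "nverts ?B = n"
    by (simp_all add: M_def gadget_def bipartite_def n_def)
  have in_n: "M \<in> ising_minus n n 10 0" "?B \<in> ising_minus n n 10 0"
    using M_in bipartite_in_ising_minus by (simp_all add: n_def)
  have ne: "special m N 1 \<noteq> special m N 2" by (rule special_ne[OF m_ge(2)])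
  have e0: "exp (- y) \<ge> 0" by simp
  have p1: "(1 + exp (- y)) ^ poly ps n \<le> 3 / 2"
    using K(1) by (intro one_plus_power_le) auto
  \<comment> \<open>The samples are dominated by the bipartite model whatever \<open>Z\<close> is;
    so this comparison also provides termination and the time bound when neither case of the promise
    holds.\<close>
  note B = tester_on_coin_source[OF tester in_n(1) M_rational in_n(2) n(2) ne gibbs_bipartite(1) gibbs_bipartite(1) _ p1,
      where d = 5, folded src_def]
  show "lossless_spmf (run src no_subroutine A (enc_model M))"
    by (rule B(1)) simp_all
  show "\<forall>(v, t, k)\<in>set_spmf (run src no_subroutine A (enc_model M)). t \<le> poly pt (vsize (enc_model M)) + 5 * poly ps n"
    by (rule B(2)) simp_all
  {
    assume low: "Z \<le> Zhat / r"
    have "real (poly ps n) * (243 / r) \<le> 1 / 10"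
      using rr(1) r by (simp add: field_simps)
    then have p2: "(1 + (2 * exp (- y) + 243 / r)) ^ poly ps n \<le> 3 / 2"
    proof (intro one_plus_power_le)
      have "real (poly ps n) * (2 * exp (- y) + 243 / r) = 2 * (real (poly ps n) * exp (- y)) + real (poly ps n) * (243 / r)"
        by (simp add: distrib_left)
      with K(1) \<open>real (poly ps n) * (243 / r) \<le> 1 / 10\<close>
      show "real (poly ps n) * (2 * exp (- y) + 243 / r) \<le> 3 / 10" by linarith
    qed (use r in simp)
    have ge: "1 \<le> 1 + (2 * exp (- y) + 243 / r)" using r by simp
    show "prob_accept (run src no_subroutine A (enc_model M)) \<ge> 5 / 8"
      unfolding src_def
      by (rule tester_on_coin_source(3)[OF tester in_n(1) M_rational in_n(1) n(1) ne low_case[OF low] low_case[OF low] ge p2])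
        simp_all
  }
  {
    assume high: "Z \<ge> r * Zhat"
    let ?S = "{special m N 1, special m N 2}"
    have "2 * 243 / r \<le> \<epsilon> / 2"
      using rr(2) r \<epsilon> by (simp add: field_simps)
    then have "1 - \<epsilon> \<le> \<bar>measure_pmf.prob (gibbs M) ?S - measure_pmf.prob (gibbs ?B) ?S\<bar>"
      using high_case[OF high] gibbs_bipartite(2) K(2) by linarith
    also have "\<dots> \<le> tv_dist (gibbs M) (gibbs ?B)" by (rule tv_dist_ge)
    finally show "prob_reject (run src no_subroutine A (enc_model M)) \<ge> 5 / 8"
      by (intro B(4)) simp_all
  }
qed

end

section \<open>Correctness of the reduction\<close>

lemma prob_return_spmf:
  "prob_accept (return_spmf (v, t, k)) = of_bool (v = Atom 1)"
  "prob_reject (return_spmf (v, t, k)) = of_bool (v = Atom 0)"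
  by (simp_all add: prob_accept_def prob_reject_def measure_spmf_return_spmf measure_return indicator_def)

lemma Reduce_correct:
  fixes N L r :: nat and \<epsilon> :: real and ps pt :: "nat poly" and Zhat :: rat
  defines "m \<equiv> gadget_size L N"
  defines "n \<equiv> 4 * m + N" and "y \<equiv> real L * (real N + 1)"
  assumes L: "L \<ge> 4" and \<epsilon>: "\<epsilon> > 0"
    and tester: "identity_tester (\<lambda>n. ising_minus n n 10 0) \<epsilon> ps pt A"
    and G: "G \<in> ising_minus_hat N 3 (-0.6)" and Zhat: "Zhat > 0"
    and rr: "r > 1" "2430 * poly ps n \<le> r" "972 / \<epsilon> \<le> real r"
    and y: "real (poly ps n) * exp (- y) \<le> 1 / 10" "exp (- y) \<le> \<epsilon> / 2"
  defines "res \<equiv> run no_samples (subroutine_on (enc_model ` {M \<in> ising_minus n n 10 0. rational_model M}) A)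
    (Reduce L) (Cell (enc_model G) (Cell (Atom r) (enc_rat Zhat)))"
  shows "lossless_spmf res
    \<and> (\<forall>(v, t, k)\<in>set_spmf res. t \<le> time_bound L ps pt (N + vsize (enc_rat Zhat)))
    \<and> (partition_function G \<le> of_rat Zhat / real r \<longrightarrow> prob_reject res \<ge> 5 / 8)
    \<and> (partition_function G \<ge> real r * of_rat Zhat \<longrightarrow> prob_accept res \<ge> 5 / 8)"
proof -
  note m_gadget = m_def
  define cnt where "cnt = (\<Sum>u<N. \<Sum>v<N. of_bool ({u, v} \<in> edges G) :: nat)"
  define D where "D = (real m)\<^sup>2"
  interpret cubic_instance N G cnt
    by unfold_locales (rule G, rule cnt_def)
  interpret reduction N L m y D
    by unfold_locales (simp_all add: L m_def gadget_size_def power2_eq_square y_def D_def)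
  obtain a b where ab: "a > 0" "b > 0" and enc: "enc_rat Zhat = Cell (Cell (Atom 0) (Atom a)) (Atom b)"
    and Zab: "real_of_rat Zhat = real a / real b"
    using enc_rat_pos[OF Zhat] by blast
  obtain flds where encG: "enc_model G = Cell (Atom N) (Cell (enc_list (map enc_list adjacency)) flds)"
    using enc_model_G by blast
  define v where "v = Cell (enc_model G) (Cell (Atom r) (enc_rat Zhat))"
  define s0 :: store where "s0 = (\<lambda>_. Atom 0)(0 := v)"
  define K where "K = (N + 1) * N"
  define Q where "Q = a * (N + 1) ^ K"
  define P where "P = b * (N + 2) ^ K"
  define J where "J = steps_up Q P (N + 1) (3 * K)"
  define x where "x = N + vsize (enc_rat Zhat)"
  define c where "c = prepare_cost N (floorlog 2 a + floorlog 2 b)"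
  have x: "N \<le> x" "floorlog 2 a + floorlog 2 b \<le> x" by (simp_all add: x_def enc)
  have c: "c \<le> prepare_cost x x" unfolding c_def by (rule prepare_cost_mono[OF x])
  have "s0 0 = Cell (Cell (Atom N) (Cell (enc_list (map enc_list adjacency)) flds))
      (Cell (Atom r) (Cell (Cell (Atom 0) (Atom a)) (Atom b)))"
    by (simp add: s0_def v_def enc encG)
  from runs_Prepare[where s = s0, OF this, folded K_def, folded Q_def P_def, folded J_def c_def]
  obtain s1 where prep: "runs Prepare s0 s1 c" and s1: "s1 1 = Atom N" "s1 2 = enc_list (map enc_list adjacency)"
      "s1 5 = Atom (N + 1)" "s1 8 = Atom J" "s1 10 = Atom (of_bool (P < Q))"
      "s1 3 = Atom (Q * (N + 2) ^ J)" "s1 4 = Atom (P * (N + 1) ^ J)"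
      "\<forall>i\<in>{7, 9, 11, 16, 22, 23, 29, 30}. s1 i = Atom 0"
    and fl: "floorlog 2 (Q * (N + 2) ^ J) \<le> c" "floorlog 2 (P * (N + 1) ^ J) \<le> c"
    by (auto simp: s0_def)
  have res: "res = run no_samples (subroutine_on (enc_model ` {M \<in> ising_minus n n 10 0. rational_model M}) A) (Reduce L) v"
    by (simp add: res_def v_def)
  have Zr: "Z = partition_function G" by (simp add: Z_def)
  have Zpos: "real a / real b > 0" using ab by simp
  have N2: "N + 1 + 1 = N + 2" by simp
  have J_le: "J \<le> 3 * K" unfolding J_def by (rule steps_up_le)
  note J_spec = steps_up_spec[of Q P "N + 1" "3 * K", folded J_def, unfolded N2]
  have time: "t \<le> time_bound L ps pt x" if "t \<le> 3 * c + 20" for t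
    using that c by (simp add: time_bound_def)
  consider (high) "P < Q" | (low) "\<not> P < Q" "Q * (N + 2) ^ J < P * (N + 1) ^ J"
    | (mid) "\<not> P < Q" "\<not> Q * (N + 2) ^ J < P * (N + 1) ^ J" by blast
  then show ?thesis
  proof cases
    case high
    have "runs (Reduce L) s0 (s1(0 := Atom 0)) (c + 4)"
      unfolding Reduce_def
    proof (rule runs_Seq[OF prep])
      show "runs (If (Reg 10) (Assign 0 (num 0)) (If (Arith Less (Reg 3) (Reg 4)) (Assign 0 (num 1)) (Seq (Build L) Answer)))
          s1 (s1(0 := Atom 0)) 4"
        by (rule runs_If[where T = 2]) (simp_all add: s1 high truthy_def runs_Assign)
    qed simp
    then obtain t where t: "t \<le> c + 4" and "res = return_spmf ((s1(0 := Atom 0)) 0, t, 0)"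
      unfolding s0_def res by (rule run_of_runs) blast
    then have res': "res = return_spmf (Atom 0, t, 0)" by simp
    have "2 ^ N < real a / real b"
      using search_too_high[OF ab(2), of N a] high unfolding Q_def P_def K_def N2 by blast
    then have "Z < real a / real b" using Z_le by linarith
    also have "\<dots> \<le> real r * (real a / real b)"
      using mult_right_mono[of 1 "real r" "real a / real b"] rr(1) Zpos by simp
    finally have "Z < real r * (real a / real b)" .
    then show ?thesis
      using time[of t] t by (simp add: res' prob_return_spmf Zr Zab flip: x_def)
  next
    case low
    have "runs (Reduce L) s0 (s1(0 := Atom 1)) (c + (2 + (4 + 2 * c) + 2))"
      unfolding Reduce_def
    proof (rule runs_Seq[OF prep])
      have "runs (If (Arith Less (Reg 3) (Reg 4)) (Assign 0 (num 1)) (Seq (Build L) Answer)) s1 (s1(0 := Atom 1)) (4 + 2 * c + 2)"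
        by (rule runs_If[where T = 2]) (use fl low(2) in \<open>simp_all add: s1 truthy_def runs_Assign\<close>)
      then show "runs (If (Reg 10) (Assign 0 (num 0)) (If (Arith Less (Reg 3) (Reg 4)) (Assign 0 (num 1)) (Seq (Build L) Answer)))
          s1 (s1(0 := Atom 1)) (2 + (4 + 2 * c) + 2)"
        by (intro runs_If[where T = "4 + 2 * c + 2"]) (simp_all add: s1 low truthy_def)
    qed simp
    then obtain t where t: "t \<le> c + (2 + (4 + 2 * c) + 2)" and "res = return_spmf ((s1(0 := Atom 1)) 0, t, 0)"
      unfolding s0_def res by (rule run_of_runs) blast
    then have res': "res = return_spmf (Atom 1, t, 0)" by simp
    \<comment> \<open>If any round had been idle, \<open>J_spec\<close> would give the opposite
      inequality.\<close>
    have "J = 3 * K"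
      using J_spec J_le low(2) by (metis le_neq_implies_less linorder_not_less)
    then have "real a / real b < (1 / 4) ^ N"
      using search_too_low[OF ab(2), of a N] low(2) unfolding Q_def P_def K_def N2 by blast
    also have "\<dots> \<le> exp (- real N)"
    proof -
      have "(1 / 4 :: real) \<le> exp (- 1)"
        using exp_le by (simp add: exp_minus field_simps)
      then have "(1 / 4 :: real) ^ N \<le> exp (- 1) ^ N" by (intro power_mono) auto
      then show ?thesis by (simp add: exp_of_nat_mult[symmetric])
    qed
    also have "\<dots> \<le> Z" by (rule Z_ge)
    finally have "real a / real b < Z" .
    moreover have "real a / real b / real r \<le> real a / real b"
      using divide_left_mono[of 1 "real r" "real a / real b"] rr(1) Zpos by simp
    ultimately have "\<not> Z \<le> real a / real b / real r" by linarith
    then show ?thesis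
      using time[of t] t by (simp add: res' prob_return_spmf Zr Zab flip: x_def)
  next
    case mid
    define u where "u = balance L N cnt J"
    have log: "\<bar>real N - real J / real (N + 1) - ln (real a / real b)\<bar> \<le> 3"
    proof (rule log_search[OF ab])
      show "J \<le> 3 * ((N + 1) * N)" using J_le by (simp only: K_def)
      show "a * (N + 1) ^ ((N + 1) * N) \<le> b * (N + 1 + 1) ^ ((N + 1) * N)"
        using mid(1) unfolding Q_def P_def K_def N2 by (simp only: not_less)
      show "b * (N + 1 + 1) ^ ((N + 1) * N) * (N + 1) ^ J \<le> a * (N + 1) ^ ((N + 1) * N) * (N + 1 + 1) ^ J"
        using mid(2) unfolding Q_def P_def K_def N2 by (simp only: not_less)
      show "a * (N + 1) ^ ((N + 1) * N) * (N + 1 + 1) ^ (J - 1) < b * (N + 1 + 1) ^ ((N + 1) * N) * (N + 1) ^ (J - 1)"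
        if "J > 0"
        using J_spec that unfolding Q_def P_def K_def N2 by blast
    qed
    have J3: "J \<le> 3 * ((N + 1) * N)" using J_le by (simp only: K_def)
    interpret tuned_gadget N L m y D G cnt u "real a / real b" "real r"
    proof unfold_locales
      show "u \<le> L * N * (N + 1) + 3 * N" unfolding u_def by (rule balance_le[OF J3])
      show "\<bar>y * real N - real u - 1 / D - 3 / 10 * real cnt - ln (real a / real b)\<bar> \<le> 5"
        unfolding y_def u_def by (rule balance_tuned[OF log cnt_le L D_ge])
    qed (use ab rr in simp_all)
    obtain s2 where build: "runs (Build L) s1 s2 (build_cost L N cnt J)" and s2: "s2 27 = enc_model M"
        "s2 24 = enc_config n (special m N 1)" "s2 25 = enc_config n (special m N 2)"
      using runs_Build[where s = s1 and L = L, OF s1(1-4,8) length_adjacency, unfolded count_adjacency, folded m_gadget u_def]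
      unfolding enc_model_M n_def enc_config_special by auto
    have b_le: "build_cost L N cnt J \<le> build_bound L x"
      by (rule build_cost_le[OF x(1) cnt_le J3])
    obtain t1 where t1: "t1 \<le> c" "\<And>smp sub t0 k d. exec smp sub (Seq Prepare d) (s0, t0, k) = exec smp sub d (s1, t0 + t1, k)"
      by (rule exec_Seq_runs[OF prep]) blast
    obtain t2 where t2: "t2 \<le> build_cost L N cnt J" "\<And>smp sub t0 k d. exec smp sub (Seq (Build L) d) (s1, t0, k) = exec smp sub d (s2, t0 + t2, k)"
      by (rule exec_Seq_runs[OF build]) blast
    let ?sub = "subroutine_on (enc_model ` {M \<in> ising_minus n n 10 0. rational_model M}) A"
    let ?src = "coin_source (enc_config n (special m N 1)) (enc_config n (special m N 2)) 5"
    let ?R = "run ?src no_subroutine A (enc_model M)"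
    let ?lt = "Arith Less (Reg 3) (Reg 4)"
    define t3 where "t3 = 0 + t1 + 1 + expr_cost (Reg 10) s1 + 1 + expr_cost ?lt s1 + t2"
    have f: "\<not> truthy (expr_val (Reg 10) s1)" "\<not> truthy (expr_val ?lt s1)"
      using mid by (simp_all add: s1 truthy_def)
    have "exec no_samples ?sub (Reduce L) (s0, 0, 0) = exec no_samples ?sub Answer (s2, t3, 0)"
      unfolding Reduce_def t1(2) exec_If_False[OF f(1)] exec_If_False[OF f(2)] t2(2) t3_def ..
    also have "\<dots> = map_spmf (\<lambda>(v, t', k'). (s2(28 := v, 0 := if truthy v then Atom 0 else Atom 1), t3 + t' + 5, 0)) ?R"
      using M_in M_rational exec_Answer[of s2 "enc_model ` {M \<in> ising_minus n n 10 0. rational_model M}" no_samples A t3 0]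
      by (simp add: s2 n_def)
    finally have res': "res = map_spmf (\<lambda>(v, t', k'). (if truthy v then Atom 0 else Atom 1, t3 + t' + 5, 0)) ?R"
      unfolding res run_def s0_def[symmetric] by (simp add: spmf.map_comp o_def case_prod_beta)
    have r': "2430 * real (poly ps n) \<le> real r"
      using rr(2) by (metis of_nat_le_iff of_nat_mult of_nat_numeral)
    note T = tester_answers[folded n_def, OF tester \<epsilon> y r' rr(3)]
    have size: "vsize (enc_model M) \<le> model_bound L x"
    proof -
      have m_le: "m \<le> gadget_size L x" unfolding m_gadget by (rule gadget_size_mono[OF x(1)])
      have u_le: "u \<le> L * x * (x + 1) + 3 * x" unfolding u_def by (rule balance_bound[OF x(1) J3])
      show ?thesis
        unfolding model_bound_def Let_def
        by (rule order_trans[OF vsize_M]) (intro add_le_mono mult_le_mono order_refl m_le u_le x(1))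
    qed
    have n_le: "n \<le> 4 * gadget_size L x + x"
      unfolding n_def m_gadget by (intro add_le_mono mult_le_mono order_refl gadget_size_mono x(1))
    have t3: "t3 \<le> 3 * c + 6 + build_bound L x"
      unfolding t3_def using t1(1) t2(1) b_le fl by (simp add: s1)
    have "lossless_spmf res"
      unfolding res' using T(1) by simp
    moreover have "t \<le> time_bound L ps pt x" if in_res: "(v, t, k) \<in> set_spmf res" for v t k
    proof -
      obtain v' t' k' where "(v', t', k') \<in> set_spmf ?R" and t: "t = t3 + t' + 5"
        using in_res unfolding res' by auto
      then have "t' \<le> poly pt (vsize (enc_model M)) + 5 * poly ps n"
        using T(2) by blast
      also have "\<dots> \<le> poly pt (model_bound L x) + 5 * poly ps (4 * gadget_size L x + x)"
        by (intro add_le_mono mult_le_mono order_refl poly_nat_mono size n_le)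
      finally show ?thesis
        using t t3 c unfolding time_bound_def by linarith
    qed
    moreover have "prob_accept ?R \<le> prob_reject res"
      unfolding res' prob_accept_def prob_reject_def measure_map_spmf
      by (rule measure_spmf.finite_measure_mono) (auto simp: truthy_def)
    moreover have "prob_reject ?R \<le> prob_accept res"
      unfolding res' prob_accept_def prob_reject_def measure_map_spmf
      by (rule measure_spmf.finite_measure_mono) (auto simp: truthy_def)
    ultimately show ?thesis
      using T(3,4) unfolding Zr Zab x_def by force
  qed
qed

lemma theta_size: "(\<lambda>N. real N) \<in> \<Theta>(\<lambda>N. sqrt (real (4 * gadget_size L N + N)))" if "L \<ge> 1"
proof (rule bigthetaI)
  show "(\<lambda>N. real N) \<in> O(\<lambda>N. sqrt (real (4 * gadget_size L N + N)))"
  proof (rule bigoI[of _ 1], rule always_eventually, rule allI)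
    fix N
    have "1 * (N * N) \<le> L * ((N + 1) * (N + 1))" using that by (intro mult_le_mono) auto
    then have "N * N \<le> 4 * gadget_size L N + N" unfolding gadget_size_def by linarith
    then have "real N * real N \<le> real (4 * gadget_size L N + N)"
      by (metis of_nat_le_iff of_nat_mult)
    then show "norm (real N) \<le> 1 * norm (sqrt (real (4 * gadget_size L N + N)))"
      by (simp add: real_le_rsqrt power2_eq_square del: of_nat_add of_nat_mult)
  qed
  show "(\<lambda>N. real N) \<in> \<Omega>(\<lambda>N. sqrt (real (4 * gadget_size L N + N)))"
    unfolding bigomega_iff_bigo
  \<comment> \<open>The constant 17 is 4 * 4 + 1: the square of \<open>N + 1\<close> is at most four
    times that of \<open>N\<close>, which requires \<open>N \<ge> 1\<close>, and the extra
    \<open>N\<close> is absorbed by the 1.\<close>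
  proof (rule bigoI[of _ "sqrt (real (17 * L))"], rule eventually_sequentiallyI[of 1])
    fix N :: nat assume N: "N \<ge> 1"
    have "L * ((N + 1) * (N + 1)) \<le> L * ((2 * N) * (2 * N))" using N by (intro mult_le_mono) auto
    moreover have "1 * N \<le> L * (N * N)" using that N by (intro mult_le_mono) auto
    moreover have "L * ((2 * N) * (2 * N)) = 4 * (L * (N * N))" by simp
    ultimately have "4 * gadget_size L N + N \<le> 17 * (L * (N * N))"
      unfolding gadget_size_def by linarith
    then have "4 * gadget_size L N + N \<le> 17 * L * (N * N)" by (simp only: mult.assoc)
    then have "real (4 * gadget_size L N + N) \<le> real (17 * L) * (real N * real N)"
      by (metis of_nat_le_iff of_nat_mult)
    then have "sqrt (real (4 * gadget_size L N + N)) \<le> sqrt (real (17 * L) * (real N * real N))"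
      by (rule real_sqrt_le_mono)
    then show "norm (sqrt (real (4 * gadget_size L N + N))) \<le> sqrt (real (17 * L)) * norm (real N)"
      by (simp add: real_sqrt_mult del: of_nat_add of_nat_mult)
  qed
qed

theorem theorem3p2:
  fixes \<epsilon> :: real
  assumes "0 < \<epsilon>" and "\<epsilon> < 1"
  shows "\<exists>\<beta>\<^sub>0>0. \<forall>ps pt :: nat poly. \<exists>(R :: com) (size_n :: nat \<Rightarrow> nat) (r :: nat poly) (p :: nat poly).
    (\<lambda>N. real N) \<in> \<Theta>(\<lambda>N. sqrt (real (size_n N))) \<and>
    (\<forall>N. poly r N > 1) \<and>
    (\<forall>A. identity_tester (\<lambda>n. ising_minus n n \<beta>\<^sub>0 0) \<epsilon> ps pt A \<longrightarrow>
       decision_counter (\<lambda>N. ising_minus_hat N 3 (-0.6)) (poly r) p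
         (\<lambda>N. subroutine_on
                (enc_model ` {M \<in> ising_minus (size_n N) (size_n N) \<beta>\<^sub>0 0. rational_model M}) A) R)"
proof (intro exI[of _ "10::real"] conjI allI)
  show "(0::real) < 10" by simp
  fix ps pt :: "nat poly"
  \<comment> \<open>The polynomial \<open>[:0, 0, 5:]\<close> is five times the square of its
    argument. With \<open>Y = L * (N + 1)\<close>, the value of \<open>y\<close>, it bounds the size
    of the gadget, so the decay can be stated in \<open>Y\<close> alone.\<close>
  obtain B1 where B1: "\<And>Y. Y \<ge> B1 \<Longrightarrow> real (poly (pcompose ps [:0, 0, 5:]) Y) * exp (- real Y) \<le> 1 / 10"
    using poly_exp_decay[of "1 / 10" "pcompose ps [:0, 0, 5:]"] by auto
  obtain B2 where B2: "\<And>Y. Y \<ge> B2 \<Longrightarrow> real (poly [:1::nat:] Y) * exp (- real Y) \<le> \<epsilon> / 2"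
    using poly_exp_decay[of "\<epsilon> / 2" "[:1:]"] assms(1) by auto
  \<comment> \<open>As \<open>Y \<ge> L\<close> for every \<open>N\<close>, exceeding both
    thresholds once makes the estimates valid for all \<open>N\<close>, small ones included.\<close>
  define L where "L = max 4 (max B1 B2)"
  define sz where "sz N = 4 * gadget_size L N + N" for N
  define q :: "nat poly" where "q = [:4 * L, 8 * L + 1, 4 * L:]"
  have q: "poly q N = sz N" for N
    by (simp add: q_def sz_def gadget_size_def algebra_simps)
  define c where "c = nat \<lceil>972 / \<epsilon>\<rceil> + 2"
  define r :: "nat poly" where "r = [:c:] + smult 2430 (pcompose ps q)"
  have r: "poly r N = c + 2430 * poly ps (sz N)" for N
    by (simp add: r_def poly_pcompose q)
  obtain p :: "nat poly" where p: "\<And>x. time_bound L ps pt x \<le> poly p x"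
    using poly_bounded_time_bound unfolding poly_bounded_def by blast
  have c: "972 / \<epsilon> \<le> real c"
    unfolding c_def using real_nat_ceiling_ge[of "972 / \<epsilon>"] by simp
  have dec: "decision_counter (\<lambda>N. ising_minus_hat N 3 (-0.6)) (poly r) p
      (\<lambda>N. subroutine_on (enc_model ` {M \<in> ising_minus (sz N) (sz N) 10 0. rational_model M}) A) (Reduce L)"
    if tester: "identity_tester (\<lambda>n. ising_minus n n 10 0) \<epsilon> ps pt A" for A
    unfolding decision_counter_def Let_def
  proof (intro allI ballI impI)
    fix N G and Zhat :: rat
    assume G: "G \<in> ising_minus_hat N 3 (-0.6)" and Zhat: "0 < Zhat"
    let ?Y = "L * (N + 1)"
    have Y: "?Y \<ge> L" "real ?Y = real L * (real N + 1)" by (simp_all add: algebra_simps)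
    have L4: "L \<ge> 4" by (simp add: L_def)
    have "sz N \<le> 5 * (?Y * ?Y)"
    proof -
      have NY: "N + 1 \<le> ?Y" using L4 mult_le_mono1[of 1 L "N + 1"] by simp
      then have "L * ((N + 1) * (N + 1)) \<le> L * ((N + 1) * (L * (N + 1)))"
        by (intro mult_le_mono order_refl)
      moreover have "1 * N \<le> ?Y * ?Y" using NY by (intro mult_le_mono) linarith+
      moreover have "?Y * ?Y = L * ((N + 1) * (L * (N + 1)))" by (simp only: mult.assoc)
      ultimately show ?thesis unfolding sz_def gadget_size_def by linarith
    qed
    then have "poly ps (sz N) \<le> poly (pcompose ps [:0, 0, 5:]) ?Y"
      unfolding poly_pcompose by (intro poly_nat_mono) (simp add: algebra_simps)
    then have "real (poly ps (sz N)) * exp (- real ?Y) \<le> real (poly (pcompose ps [:0, 0, 5:]) ?Y) * exp (- real ?Y)"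
      by (intro mult_right_mono) simp_all
    also have "\<dots> \<le> 1 / 10" using Y(1) by (intro B1) (simp add: L_def)
    finally have y1: "real (poly ps (4 * gadget_size L N + N)) * exp (- (real L * (real N + 1))) \<le> 1 / 10"
      unfolding Y(2) sz_def .
    have "exp (- real ?Y) \<le> \<epsilon> / 2"
      using B2[of ?Y] Y(1) by (simp add: L_def)
    then have y2: "exp (- (real L * (real N + 1))) \<le> \<epsilon> / 2"
      unfolding Y(2) .
    have r1: "poly r N > 1" "2430 * poly ps (4 * gadget_size L N + N) \<le> poly r N" "972 / \<epsilon> \<le> real (poly r N)"
      using c by (simp_all add: r sz_def c_def)
    let ?res = "run no_samples (subroutine_on (enc_model ` {M \<in> ising_minus (sz N) (sz N) 10 0. rational_model M}) A)
      (Reduce L) (Cell (enc_model G) (Cell (Atom (poly r N)) (enc_rat Zhat)))"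
    from Reduce_correct[OF L4 assms(1) tester G Zhat r1 y1 y2, folded sz_def]
    show "lossless_spmf ?res \<and> (\<forall>(v, t, k)\<in>set_spmf ?res. t \<le> poly p (N + vsize (enc_rat Zhat)))
        \<and> (partition_function G \<le> of_rat Zhat / real (poly r N) \<longrightarrow> 5 / 8 \<le> prob_reject ?res)
        \<and> (real (poly r N) * of_rat Zhat \<le> partition_function G \<longrightarrow> 5 / 8 \<le> prob_accept ?res)"
      using order_trans[OF _ p] by blast
  qed
  show "\<exists>(R :: com) (size_n :: nat \<Rightarrow> nat) (r :: nat poly) (p :: nat poly).
    (\<lambda>N. real N) \<in> \<Theta>(\<lambda>N. sqrt (real (size_n N))) \<and>
    (\<forall>N. poly r N > 1) \<and>
    (\<forall>A. identity_tester (\<lambda>n. ising_minus n n 10 0) \<epsilon> ps pt A \<longrightarrow>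
       decision_counter (\<lambda>N. ising_minus_hat N 3 (-0.6)) (poly r) p
         (\<lambda>N. subroutine_on
                (enc_model ` {M \<in> ising_minus (size_n N) (size_n N) 10 0. rational_model M}) A) R)"
  proof (rule exI[of _ "Reduce L"], rule exI[of _ sz], rule exI[of _ r], rule exI[of _ p], intro conjI allI impI)
    show "(\<lambda>N. real N) \<in> \<Theta>(\<lambda>N. sqrt (real (sz N)))"
      unfolding sz_def by (rule theta_size) (simp add: L_def)
    show "poly r N > 1" for N by (simp add: r c_def)
  qed (rule dec)
qed

end
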